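(* Let $m\geq 2$ be an integer, and put $\delta=2$ if $m=2$ and $\delta=1$ if $m\geq 3$. There exists a kernel $K$ on $S^m$ that is $L^2$-positive definite, belongs to $W_2^\infty$, and is such that $\mathcal{K}_{0,r}:L^2(S^m)\to L^2(S^m)$ is bounded for all $r\in\mathbb{N}$, with the following property: for every sequence $\{\beta_n\}_n$ of positive numbers for which there is a positive constant $c$ with $$c\sqrt[m]{n}<\beta_n\quad\text{for all sufficiently large } n,$$ the sequence $$n^{\frac{\sqrt[m]{n}}{\delta m}+\beta_n}\,\lambda_n(\mathcal{K}),\qquad n=1,2,\ldots,$$ does not converge to zero as $n\to\infty$.
   Context: $S^m$ is the unit sphere of $\mathbb{R}^{m+1}$ centered at the origin, with surface measure $\sigma_m$ induced by Lebesgue measure and total volume $\omega_m$. $L^2(S^m)=L^2(S^m,\sigma_m)$ is the Hilbert space of square-integrable functions $f:S^m\to\mathbb{C}$ with inner product $\langle f,g\rangle_2=\frac{1}{\omega_m}\int_{S^m}f\overline{g}\,d\sigma_m$ and norm $\|\cdot\|_2$; $L^2(S^m\times S^m)=L^2(S^m\times S^m,\sigma_m\otimes\sigma_m)$. A kernel $K\in L^2(S^m\times S^m)$ generates the compact operator $\mathcal{K}:L^2(S^m)\to L^2(S^m)$, $\mathcal{K}(f)=\int_{S^m}K(\cdot,y)f(y)\,d\sigma_m(y)$. A kernel $K\in L^2(S^m\times S^m)$ is $L^2$-positive definite if $\mathcal{K}$ is a positive operator, i.e. $\langle \mathcal{K}f,f\rangle_2\geq 0$ for all $f\in L^2(S^m)$.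 Then $\mathcal{K}$ is self-adjoint and its eigenvalues are non-negative; they are listed in non-increasing order $\lambda_1(\mathcal{K})\geq\lambda_2(\mathcal{K})\geq\cdots\geq 0$, repeated according to multiplicity (with zeros appended if only finitely many are nonzero). Laplace-Beltrami derivative: for $t\in(-1,1)$ let $S_t^m(f)(x)=\frac{1}{|R_t^m|}\int_{x\cdot y=t}f(y)\,dy$, $x\in S^m$, where $dy$ is the measure element of the rim $R_t^m=\{y\in S^m: x\cdot y=t\}$ and $|R_t^m|=\omega_{m-1}(1-t^2)^{(m-1)/2}$ is its volume. A function $f\in L^2(S^m)$ is LB-differentiable if there is $\mathcal{D}f\in L^2(S^m)$ with $\lim_{t\to1^-}\left\|\frac{f-S_t^m(f)}{1-t}-\mathcal{D}f\right\|_2=0$; $\mathcal{D}f$ is the Laplace-Beltrami derivative of $f$. Put $\mathcal{D}^1=\mathcal{D}$ and $\mathcal{D}^r=\mathcal{D}\circ\mathcal{D}^{r-1}$ for $r\geq 2$. (On spherical harmonics $Y$ of degree $n$ in $m+1$ variables, $\mathcal{D}^rY=\frac{n^r(n+m-1)^r}{m^r}Y$.) $W_2^\infty$ is the space of $f\in L^2(S^m)$ such that $\mathcal{D}^rf$ exists in $L^2(S^m)$ for all $r=1,2,\ldots$. A kernel $K$ is said to belong to $W_2^\infty$ if $K(x,\cdot)\in W_2^\infty$ for almost every $x\in S^m$. $K_{0,r}:=\mathcal{D}_y^rK$ denotes the $r$-th order Laplace-Beltrami derivative of $K$ with respect to its second variable $y$, and $\mathcal{K}_{0,r}$ is the integral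 operator generated by $K_{0,r}$, $\mathcal{K}_{0,r}(f)=\int_{S^m}K_{0,r}(\cdot,y)f(y)\,d\sigma_m(y)$. *)

theory Defs
  imports "HOL-Analysis.Analysis"
begin

section \<open>Surface measures\<close>

text \<open>
  The cone construction: if \<open>M\<close> is Lebesgue measure on a \<open>d\<close>-dimensional linear subspace, then
  the surface measure of a subset \<open>A\<close> of its unit sphere is \<open>d\<close> times the \<open>M\<close>-measure of the cone
  \<open>{r u. u \<in> A, 0 < r \<le> 1}\<close>.
\<close>

definition cone_measure :: "nat \<Rightarrow> 'a::euclidean_space measure \<Rightarrow> 'a measure" where
  "cone_measure d M =
     scale_measure (of_nat d)
       (distr (restrict_space M (cball 0 1 - {0})) (restrict_space borel (sphere 0 1))
         (\<lambda>x. x /\<^sub>R norm x))"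

definition sphere_measure :: "'a::euclidean_space measure" where
  "sphere_measure = cone_measure DIM('a) lborel"

text \<open>
  Lebesgue measure of the hyperplane orthogonal to a unit vector \<open>x\<close>: a subset of that hyperplane
  has the same measure as the cylinder of height one over it.
\<close>

definition hyperplane_measure :: "'a::euclidean_space \<Rightarrow> 'a measure" where
  "hyperplane_measure x =
     distr (restrict_space lborel {z. 0 \<le> x \<bullet> z \<and> x \<bullet> z \<le> 1}) borel (\<lambda>z. z - (x \<bullet> z) *\<^sub>R x)"

text \<open>
  With \<open>DIM('a) = m + 1\<close>, the rim \<open>{y. norm y = 1, x \<bullet> y = t}\<close> is the image of the unit sphere of
  the hyperplane orthogonal to \<open>x\<close> under \<open>u \<mapsto> t x + sqrt (1 - t\<^sup>2) u\<close>, which multiplies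
  \<open>(m - 1)\<close>-dimensional measure by \<open>sqrt (1 - t\<^sup>2) ^ (m - 1)\<close>.
\<close>

definition rim :: "'a::euclidean_space \<Rightarrow> real \<Rightarrow> 'a set" where
  "rim x t = {y \<in> sphere 0 1. x \<bullet> y = t}"

definition rim_measure :: "'a::euclidean_space \<Rightarrow> real \<Rightarrow> 'a measure" where
  "rim_measure x t =
     restrict_space
       (scale_measure (ennreal (sqrt (1 - t\<^sup>2) ^ (DIM('a) - 2)))
         (distr (cone_measure (DIM('a) - 1) (hyperplane_measure x)) borel
           (\<lambda>u. t *\<^sub>R x + sqrt (1 - t\<^sup>2) *\<^sub>R u)))
       (rim x t)"

section \<open>Square-integrable functions\<close>

text \<open>
  Elements of \<open>L\<^sup>2\<close> are represented by Borel functions; classes are compared with almost everywhere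
  equality. Values outside the sphere play no role, as \<open>space sphere_measure = sphere 0 1\<close>.
\<close>

definition L2 :: "'a measure \<Rightarrow> ('a \<Rightarrow> complex) set" where
  "L2 M = {f \<in> borel_measurable M. integrable M (\<lambda>x. (cmod (f x))\<^sup>2)}"

abbreviation L2_sphere :: "('a::euclidean_space \<Rightarrow> complex) set" where
  "L2_sphere \<equiv> L2 sphere_measure"

definition sphere_inner ::
    "('a::euclidean_space \<Rightarrow> complex) \<Rightarrow> ('a \<Rightarrow> complex) \<Rightarrow> complex" where
  "sphere_inner f g =
     (LINT x|sphere_measure. f x * cnj (g x)) /
       of_real (measure (sphere_measure :: 'a measure) (space sphere_measure))"

definition sphere_norm :: "('a::euclidean_space \<Rightarrow> complex) \<Rightarrow> real" where
  "sphere_norm f = sqrt (Re (sphere_inner f f))"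

section \<open>Integral operators and their eigenvalues\<close>

definition kernel_op ::
    "('a::euclidean_space \<Rightarrow> 'a \<Rightarrow> complex) \<Rightarrow> ('a \<Rightarrow> complex) \<Rightarrow> 'a \<Rightarrow> complex" where
  "kernel_op K f x = (LINT y|sphere_measure. K x y * f y)"

definition L2_positive_definite :: "('a::euclidean_space \<Rightarrow> 'a \<Rightarrow> complex) \<Rightarrow> bool" where
  "L2_positive_definite K \<longleftrightarrow>
     case_prod K \<in> L2 (sphere_measure \<Otimes>\<^sub>M sphere_measure) \<and>
     (\<forall>f\<in>L2_sphere. sphere_inner (kernel_op K f) f \<in> \<real>\<^sub>\<ge>\<^sub>0)"

definition bounded_on_L2 ::
    "(('a::euclidean_space \<Rightarrow> complex) \<Rightarrow> 'a \<Rightarrow> complex) \<Rightarrow> bool" where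
  "bounded_on_L2 T \<longleftrightarrow>
     (\<exists>C. \<forall>f\<in>L2_sphere. T f \<in> L2_sphere \<and> sphere_norm (T f) \<le> C * sphere_norm f)"

definition eigenspace ::
    "(('a::euclidean_space \<Rightarrow> complex) \<Rightarrow> 'a \<Rightarrow> complex) \<Rightarrow> complex \<Rightarrow> ('a \<Rightarrow> complex) set" where
  "eigenspace T \<mu> = {f \<in> L2_sphere. AE x in sphere_measure. T f x = \<mu> * f x}"

text \<open>\<open>V\<close> has complex dimension \<open>k\<close> after identifying functions that agree almost everywhere.\<close>

definition has_L2_dim :: "('a::euclidean_space \<Rightarrow> complex) set \<Rightarrow> nat \<Rightarrow> bool" where
  "has_L2_dim V k \<longleftrightarrow>
     (\<exists>b :: nat \<Rightarrow> 'a \<Rightarrow> complex.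
        (\<forall>i<k. b i \<in> V) \<and>
        (\<forall>c. (AE x in sphere_measure. (\<Sum>i<k. c i * b i x) = 0) \<longrightarrow> (\<forall>i<k. c i = 0)) \<and>
        (\<forall>f\<in>V. \<exists>c. AE x in sphere_measure. f x = (\<Sum>i<k. c i * b i x)))"

text \<open>
  \<open>ev 1 \<ge> ev 2 \<ge> \<dots> \<ge> 0\<close> lists the positive eigenvalues of \<open>T\<close> according to multiplicity, followed by
  zeros if there are only finitely many. These conditions determine \<open>ev n\<close> for every \<open>n \<ge> 1\<close>;
  \<open>ev 0\<close> is irrelevant.
\<close>

definition eigenvalue_sequence ::
    "(('a::euclidean_space \<Rightarrow> complex) \<Rightarrow> 'a \<Rightarrow> complex) \<Rightarrow> (nat \<Rightarrow> real) \<Rightarrow> bool" where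
  "eigenvalue_sequence T ev \<longleftrightarrow>
     (\<forall>n\<ge>1. 0 \<le> ev n) \<and>
     (\<forall>i j. 1 \<le> i \<and> i \<le> j \<longrightarrow> ev j \<le> ev i) \<and>
     (\<forall>\<mu>>0. finite {n. 1 \<le> n \<and> ev n = \<mu>} \<and>
        has_L2_dim (eigenspace T (of_real \<mu>)) (card {n. 1 \<le> n \<and> ev n = \<mu>}))"

section \<open>The Laplace--Beltrami derivative\<close>

definition rim_average ::
    "real \<Rightarrow> ('a::euclidean_space \<Rightarrow> complex) \<Rightarrow> 'a \<Rightarrow> complex" where
  "rim_average t f x =
     (LINT y|rim_measure x t. f y) / of_real (measure (rim_measure x t) (rim x t))"

text \<open>
  The operator \<open>rim_average t\<close> maps \<open>L\<^sup>2\<close> to itself, so the functions whose norms are taken below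
  are square-integrable.
\<close>

definition has_LB_derivative ::
    "('a::euclidean_space \<Rightarrow> complex) \<Rightarrow> ('a \<Rightarrow> complex) \<Rightarrow> bool" where
  "has_LB_derivative f g \<longleftrightarrow>
     f \<in> L2_sphere \<and> g \<in> L2_sphere \<and>
     ((\<lambda>t. sphere_norm (\<lambda>x. (f x - rim_average t f x) / of_real (1 - t) - g x)) \<longlongrightarrow> 0)
       (at_left 1)"

text \<open>
  The \<open>r\<close>-th derivative is unique only up to almost everywhere equality; \<open>LB_derivative\<close> selects a
  representative. For \<open>r = 0\<close> it is the function itself.
\<close>

definition LB_derivative ::
    "nat \<Rightarrow> ('a::euclidean_space \<Rightarrow> complex) \<Rightarrow> 'a \<Rightarrow> complex" where
  "LB_derivative r f = (SOME g. (has_LB_derivative ^^ r) f g)"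

definition W2_infinity :: "('a::euclidean_space \<Rightarrow> complex) set" where
  "W2_infinity = {f \<in> L2_sphere. \<forall>r\<ge>1. \<exists>g. (has_LB_derivative ^^ r) f g}"

definition kernel_in_W2_infinity :: "('a::euclidean_space \<Rightarrow> 'a \<Rightarrow> complex) \<Rightarrow> bool" where
  "kernel_in_W2_infinity K \<longleftrightarrow> (AE x in sphere_measure. K x \<in> W2_infinity)"

definition kernel_LB_derivative ::
    "nat \<Rightarrow> ('a::euclidean_space \<Rightarrow> 'a \<Rightarrow> complex) \<Rightarrow> 'a \<Rightarrow> 'a \<Rightarrow> complex" where
  "kernel_LB_derivative r K x = LB_derivative r (K x)"

end

theory Submission
  imports Defs
begin

text \<open>
  The required lower bound on the eigenvalues is weak: \<open>\<lambda>\<^sub>n\<close> only has to stay above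
  \<open>exp (- root m n) / n ^ d\<close> for some \<open>d\<close>, since \<open>n powr (root m n / (\<delta> m)) \<ge> exp (root m n)\<close>
  eventually and \<open>n powr \<beta> n\<close> beats every power of \<open>n\<close>. On the other hand \<open>exp (- root m n)\<close> decays
  faster than every power of \<open>n\<close>, which is all that smoothness needs. So there is no need to use
  full spaces of spherical harmonics: with \<open>z = x\<^sub>1 + \<i> x\<^sub>2\<close> and \<open>w = y\<^sub>1 + \<i> y\<^sub>2\<close> the kernel
  \<open>K x y = (\<Sum>k. exp (- root m k) cnj z ^ k w ^ k)\<close>, which involves a single harmonic of each
  degree, works. The powers of \<open>z\<close> are pairwise orthogonal, and their \<open>L\<^sup>2\<close> norms decay only
  polynomially. Because \<open>e\<^sub>1 + \<i> e\<^sub>2\<close> is isotropic, \<open>z ^ k\<close> is an eigenfunction of all rim averages;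
  its eigenvalue \<open>p\<^sub>k t\<close> is a polynomial in \<open>t\<close> with \<open>\<bar>1 - p\<^sub>k t\<bar> \<le> 3 k\<^sup>2 (1 - t)\<close>, so rapidly converging
  power series in \<open>z\<close> can be differentiated term by term.
  Iterating the derivative is meaningful because rim averages respect almost everywhere equality.
\<close>

section \<open>Integration over spheres and rims\<close>

text \<open>The obstacle is the encoding of the iterated derivative. \<open>LB_derivative\<close>
  selects an arbitrary representative, and the intermediate functions behind
  \<open>has_LB_derivative ^^ r\<close> are arbitrary as well, so exhibiting one chain of
  derivatives says nothing about the operator generated by the chosen kernel: every chain that
  starts from a power series in \<open>z\<close> has to agree almost everywhere with termwise
  differentiation. The delicate point is that a rim is itself a null set of the sphere, so changing
  a function on a null set can change its average over a given rim. Only for almost every centre is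
  this harmless, which takes Fubini and a null-set argument for rotations towards a fixed vector.
  The conjugate sits on the first variable because the operator integrates
  \<open>K x y * f y\<close> without conjugation: the rows of the kernel are power series in
  \<open>w\<close>, and the eigenfunctions are the powers of \<open>cnj z\<close>, with eigenvalue
  \<open>exp (- root m k)\<close> times the squared norm of \<open>z ^ k\<close>. Both factors
  decrease in \<open>k\<close>, the first one strictly, so the positive eigenvalues are simple and
  already sorted.\<close>

lemma nn_integral_lborel_translate:
  fixes f :: "'a::euclidean_space \<Rightarrow> ennreal"
  assumes [measurable]: "f \<in> borel_measurable borel"
  shows "(\<integral>\<^sup>+x. f (c + x) \<partial>lborel) = (\<integral>\<^sup>+x. f x \<partial>lborel)"
  by (subst (2) lborel_distr_plus[of c, symmetric]) (simp add: nn_integral_distr)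

lemma orthogonal_transformation_measurable [measurable (raw)]:
  fixes Q :: "'a::euclidean_space \<Rightarrow> 'a"
  assumes "orthogonal_transformation Q"
  shows "Q \<in> borel_measurable borel"
  using orthogonal_transformation_linear[OF assms]
  by (intro borel_measurable_continuous_onI linear_continuous_on linear_conv_bounded_linear[THEN iffD1])

text \<open>
  The library computes the effect of linear maps on Lebesgue measure only for well-ordered index
  types. Here the uniqueness argument for translation-invariant measures is used instead: integrate
  \<open>1\<^sub>A (Q x) 1\<^sub>B (y - Q x)\<close> over \<open>x\<close> and \<open>y\<close> in both orders, with \<open>B\<close> the \<open>Q\<close>-invariant unit ball.
\<close>

lemma lborel_distr_orthogonal:
  fixes Q :: "'a::euclidean_space \<Rightarrow> 'a"
  assumes Q: "orthogonal_transformation Q"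
  shows "distr lborel borel Q = lborel"
proof (rule measure_eqI)
  fix A :: "'a set" assume "A \<in> sets (distr lborel borel Q)"
  then have A[measurable]: "A \<in> sets borel" by simp
  have lin: "linear Q" using Q by (rule orthogonal_transformation_linear)
  note [measurable] = orthogonal_transformation_measurable[OF Q]
  define B :: "'a set" where "B = ball 0 1"
  have [measurable]: "B \<in> sets borel" by (simp add: B_def)
  have B: "0 < emeasure lborel B" "emeasure lborel B < \<infinity>"
    using emeasure_lborel_ball_finite[of 0 1] content_ball_pos[of 1 "0::'a"]
    by (auto simp: B_def measure_def enn2real_positive_iff)
  have BQ: "indicator B (- Q x) = (indicator B x :: ennreal)" for x
    by (simp add: B_def indicator_def orthogonal_transformation_norm[OF Q])
  have *: "Q (inv Q y + x) = y + Q x" for x y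
    using orthogonal_transformation_surj[OF Q] by (simp add: linear_add[OF lin] surj_f_inv_f)
  have "emeasure lborel B * emeasure (distr lborel borel Q) A
      = (\<integral>\<^sup>+x. indicator A (Q x) * emeasure lborel B \<partial>lborel)"
    by (subst nn_integral_multc)
       (auto simp: nn_integral_distr mult.commute simp flip: nn_integral_indicator)
  also have "\<dots> = (\<integral>\<^sup>+x. indicator A (Q x) * (\<integral>\<^sup>+y. indicator B (- Q x + y) \<partial>lborel) \<partial>lborel)"
    by (subst nn_integral_lborel_translate) auto
  also have "\<dots> = (\<integral>\<^sup>+x. (\<integral>\<^sup>+y. indicator A (Q x) * indicator B (- Q x + y) \<partial>lborel) \<partial>lborel)"
    by (subst nn_integral_cmult) auto
  also have "\<dots> = (\<integral>\<^sup>+y. (\<integral>\<^sup>+x. indicator A (Q x) * indicator B (- Q x + y) \<partial>lborel) \<partial>lborel)"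
    by (rule lborel_pair.Fubini') measurable
  \<comment> \<open>Shifting \<open>x\<close> by \<open>inv Q y\<close> frees the ball factor from
    \<open>y\<close>: its argument becomes \<open>- Q x\<close>, and the ball is invariant under
    \<open>- Q\<close>.\<close>
  also have "\<dots> = (\<integral>\<^sup>+y. (\<integral>\<^sup>+x. indicator A (Q (inv Q y + x)) * indicator B (- Q (inv Q y + x) + y)
      \<partial>lborel) \<partial>lborel)"
    by (intro nn_integral_cong nn_integral_lborel_translate[symmetric]) measurable
  also have "\<dots> = (\<integral>\<^sup>+y. (\<integral>\<^sup>+x. indicator A (y + Q x) * indicator B x \<partial>lborel) \<partial>lborel)"
    by (simp add: * BQ)
  also have "\<dots> = (\<integral>\<^sup>+x. (\<integral>\<^sup>+y. indicator A (y + Q x) * indicator B x \<partial>lborel) \<partial>lborel)"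
    by (rule lborel_pair.Fubini') measurable
  also have "\<dots> = (\<integral>\<^sup>+x. (\<integral>\<^sup>+y. indicator A (Q x + y) \<partial>lborel) * indicator B x \<partial>lborel)"
    by (subst nn_integral_multc) (auto simp: add.commute)
  also have "\<dots> = emeasure lborel B * emeasure lborel A"
    by (subst nn_integral_lborel_translate) (auto simp: nn_integral_multc mult.commute)
  finally show "emeasure (distr lborel borel Q) A = emeasure lborel A"
    using B by (auto simp add: ennreal_mult_cancel_left)
qed simp

lemma integral_lborel_orthogonal:
  fixes Q :: "'a::euclidean_space \<Rightarrow> 'a" and f :: "'a \<Rightarrow> 'b::{banach, second_countable_topology}"
  assumes "orthogonal_transformation Q" "f \<in> borel_measurable borel"
  shows "(LINT x|lborel. f (Q x)) = (LINT x|lborel. f x)"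
  using integral_distr[of Q lborel borel f] lborel_distr_orthogonal[OF assms(1)]
    orthogonal_transformation_measurable[OF assms(1)] assms(2) by simp

text \<open>Householder reflection in the hyperplane orthogonal to \<open>a - b\<close>. The clause
  about fixed vectors allows a second vector to be moved without disturbing one that is already in
  place.\<close>

lemma orthogonal_transformation_reflect:
  fixes a b :: "'a::euclidean_space"
  assumes "norm a = norm b"
  obtains Q where "orthogonal_transformation Q" "Q a = b" "Q b = a" "\<And>v. v \<bullet> a = v \<bullet> b \<Longrightarrow> Q v = v"
proof (cases "a = b")
  case True
  show ?thesis by (rule that[of "\<lambda>v. v"]) (simp_all add: True)
next
  case False
  define d where "d = a - b"
  define Q where "Q v = v - (2 * (d \<bullet> v) / (d \<bullet> d)) *\<^sub>R d" for v
  have d: "d \<bullet> d \<noteq> 0" using False by (simp add: d_def)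
  then have d': "(d \<bullet> d) / (d \<bullet> d) = 1" "- (d \<bullet> d) / (d \<bullet> d) = -1" by simp_all
  have ab: "a \<bullet> a = b \<bullet> b" using assms by (simp add: norm_eq_sqrt_inner)
  have "orthogonal_transformation Q"
    unfolding orthogonal_transformation_def
  proof (intro conjI allI)
    show "linear Q"
      by (rule linearI)
        (simp_all add: Q_def inner_add_right distrib_left add_divide_distrib scaleR_add_left scaleR_diff_right)
    show "Q v \<bullet> Q w = v \<bullet> w" for v w
    proof -
      have "Q v \<bullet> Q w = v \<bullet> w - 2 * (d \<bullet> w) / (d \<bullet> d) * (d \<bullet> v) - 2 * (d \<bullet> v) / (d \<bullet> d) * (d \<bullet> w)
          + (2 * (d \<bullet> v) / (d \<bullet> d)) * (2 * (d \<bullet> w) / (d \<bullet> d)) * (d \<bullet> d)"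
        unfolding Q_def inner_diff_left inner_diff_right inner_scaleR_left inner_scaleR_right
        by (simp add: inner_commute[of v d])
      then show ?thesis using d by simp
    qed
  qed
  moreover have "Q a = b"
  proof -
    have "2 * (d \<bullet> a) = d \<bullet> d"
      unfolding d_def inner_diff_left inner_diff_right by (simp add: ab inner_commute[of b a])
    then have c: "2 * (d \<bullet> a) / (d \<bullet> d) = 1" by (simp only: d')
    show ?thesis unfolding Q_def c by (simp add: d_def)
  qed
  moreover have "Q b = a"
  proof -
    have "2 * (d \<bullet> b) = - (d \<bullet> d)"
      unfolding d_def inner_diff_left inner_diff_right by (simp add: ab inner_commute[of b a])
    then have c: "2 * (d \<bullet> b) / (d \<bullet> d) = -1" by (simp only: d')
    show ?thesis unfolding Q_def c by (simp add: d_def)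
  qed
  moreover have "Q v = v" if "v \<bullet> a = v \<bullet> b" for v
    using that by (simp add: Q_def d_def inner_diff_left inner_commute[of a v] inner_commute[of b v])
  ultimately show ?thesis using that by blast
qed

text \<open>Two reflections: \<open>P\<close> takes \<open>x\<close> to \<open>e1\<close>, and
  \<open>R\<close> turns \<open>P b\<close> into the direction of \<open>e2\<close>. Both
  \<open>P b\<close> and \<open>e2\<close> are orthogonal to \<open>e1\<close>, so \<open>R\<close>
  keeps \<open>e1\<close> fixed.\<close>

lemma orthogonal_transformation_pair:
  fixes e1 e2 x b :: "'a::euclidean_space"
  assumes "norm e1 = 1" "norm e2 = 1" "e1 \<bullet> e2 = 0" "norm x = 1" "x \<bullet> b = 0"
  obtains Q where "orthogonal_transformation Q" "Q x = e1" "Q b = norm b *\<^sub>R e2"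
proof -
  obtain P where P: "orthogonal_transformation P" "P x = e1"
    using orthogonal_transformation_reflect[of x e1] assms by metis
  have "norm (P b) = norm (norm b *\<^sub>R e2)"
    using assms by (simp add: orthogonal_transformation_norm[OF P(1)])
  then obtain R where R: "orthogonal_transformation R" "R (P b) = norm b *\<^sub>R e2"
      "\<And>v. v \<bullet> P b = v \<bullet> (norm b *\<^sub>R e2) \<Longrightarrow> R v = v"
    using orthogonal_transformation_reflect by metis
  have "e1 \<bullet> P b = 0"
    using P assms unfolding orthogonal_transformation_def by metis
  then have "R e1 = e1" using R(3) assms by simp
  then show ?thesis
    using that[of "R \<circ> P"] R P orthogonal_transformation_compose by auto
qed

lemma integral_scale_measure:
  fixes f :: "'a \<Rightarrow> 'b::{banach, second_countable_topology}"
  assumes "0 \<le> r" "f \<in> borel_measurable M"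
  shows "integral\<^sup>L (scale_measure (ennreal r) M) f = r *\<^sub>R integral\<^sup>L M f"
proof -
  have "scale_measure (ennreal r) M = density M (\<lambda>_. ennreal r)"
    by (rule measure_eqI) (auto simp: emeasure_density nn_integral_cmult_indicator)
  then show ?thesis using assms by (simp add: integral_density)
qed

section \<open>Cone measures as Lebesgue integrals over the punctured ball\<close>

lemma punctured_cball_borel [measurable]: "cball 0 1 - {0::'a::euclidean_space} \<in> sets borel"
  by (intro sets.Diff borel_closed) auto

lemma normalize_measurable:
  "(\<lambda>x::'a::euclidean_space. x /\<^sub>R norm x) \<in>
     restrict_space borel (cball 0 1 - {0}) \<rightarrow>\<^sub>M restrict_space borel (sphere 0 1)"
  by (rule measurable_restrict_space3) auto

lemma space_cone_measure [simp]: "space (cone_measure d M) = sphere 0 1"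
  by (simp add: cone_measure_def space_scale_measure space_restrict_space)

lemma sets_cone_measure [simp, measurable_cong]:
  "sets (cone_measure d M) = sets (restrict_space borel (sphere 0 1))"
  by (simp add: cone_measure_def)

lemma space_sphere_measure [simp]: "space sphere_measure = sphere 0 1"
  by (simp add: sphere_measure_def)

lemma sets_sphere_measure [simp, measurable_cong]:
  "sets sphere_measure = sets (restrict_space borel (sphere 0 1))"
  by (simp add: sphere_measure_def)

lemma nn_integral_cone_measure:
  fixes M :: "'a::euclidean_space measure"
  assumes M: "sets M = sets borel" and f: "f \<in> borel_measurable borel"
  shows "(\<integral>\<^sup>+x. f x \<partial>cone_measure d M) =
    of_nat d * (\<integral>\<^sup>+x. indicator (cball 0 1 - {0}) x * f (x /\<^sub>R norm x) \<partial>M)"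
proof -
  have f': "f \<in> borel_measurable (restrict_space borel (sphere 0 1))"
    using f by (rule measurable_restrict_space1)
  have [measurable_cong]: "sets (restrict_space M (cball 0 1 - {0})) = sets (restrict_space borel (cball 0 1 - {0}))"
    using M by (rule sets_restrict_space_cong)
  have n: "(\<lambda>x. x /\<^sub>R norm x) \<in> restrict_space M (cball 0 1 - {0}) \<rightarrow>\<^sub>M restrict_space borel (sphere 0 1)"
    using normalize_measurable by measurable
  show ?thesis
    unfolding cone_measure_def
    using f' n M sets_eq_imp_space_eq[OF M]
    by (simp add: nn_integral_scale_measure nn_integral_distr nn_integral_restrict_space mult.commute)
qed

lemma integral_cone_measure:
  fixes M :: "'a::euclidean_space measure" and f :: "'a \<Rightarrow> 'b::{banach, second_countable_topology}"
  assumes M: "sets M = sets borel" and f: "f \<in> borel_measurable borel"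
  shows "(LINT x|cone_measure d M. f x) =
    real d *\<^sub>R (LINT x|M. indicator (cball 0 1 - {0}) x *\<^sub>R f (x /\<^sub>R norm x))"
proof -
  have f': "f \<in> borel_measurable (restrict_space borel (sphere 0 1))"
    using f by (rule measurable_restrict_space1)
  have [measurable_cong]: "sets (restrict_space M (cball 0 1 - {0})) = sets (restrict_space borel (cball 0 1 - {0}))"
    using M by (rule sets_restrict_space_cong)
  have n: "(\<lambda>x. x /\<^sub>R norm x) \<in> restrict_space M (cball 0 1 - {0}) \<rightarrow>\<^sub>M restrict_space borel (sphere 0 1)"
    using normalize_measurable by measurable
  have "of_nat d = ennreal (real d)" by (simp add: ennreal_of_nat_eq_real_of_nat)
  then show ?thesis
    unfolding cone_measure_def
    using f' n M sets_eq_imp_space_eq[OF M]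
    by (simp add: integral_scale_measure integral_distr integral_restrict_space)
qed

text \<open>Inherited from Lebesgue measure: an orthogonal map preserves the punctured ball and
  commutes with normalisation.\<close>

lemma integral_sphere_measure_orthogonal:
  fixes Q :: "'a::euclidean_space \<Rightarrow> 'a" and f :: "'a \<Rightarrow> 'b::{banach, second_countable_topology}"
  assumes Q: "orthogonal_transformation Q" and [measurable]: "f \<in> borel_measurable borel"
  shows "(LINT x|sphere_measure. f (Q x)) = (LINT x|sphere_measure. f x)"
proof -
  note [measurable] = orthogonal_transformation_measurable[OF Q]
  have "Q x = 0 \<longleftrightarrow> x = 0" for x
    using orthogonal_transformation_norm[OF Q, of x] by (metis norm_eq_zero)
  then have ind: "indicator (cball 0 1 - {0}) (Q x) = (indicator (cball 0 1 - {0}) x :: real)" for x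
    by (simp add: indicator_def orthogonal_transformation_norm[OF Q])
  have "(LINT x|sphere_measure. f (Q x)) = real DIM('a) *\<^sub>R
     (LINT x|lborel. indicator (cball 0 1 - {0}) x *\<^sub>R f (Q (x /\<^sub>R norm x)))"
    unfolding sphere_measure_def by (rule integral_cone_measure) auto
  also have "\<dots> = real DIM('a) *\<^sub>R
     (LINT x|lborel. (\<lambda>x. indicator (cball 0 1 - {0}) x *\<^sub>R f (x /\<^sub>R norm x)) (Q x))"
    by (simp add: orthogonal_transformation_norm[OF Q] orthogonal_transformation_scaleR[OF Q] ind)
  also have "\<dots> = real DIM('a) *\<^sub>R
     (LINT x|lborel. indicator (cball 0 1 - {0}) x *\<^sub>R f (x /\<^sub>R norm x))"
    by (subst integral_lborel_orthogonal[OF Q]) auto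
  also have "\<dots> = (LINT x|sphere_measure. f x)"
    unfolding sphere_measure_def by (rule integral_cone_measure[symmetric]) auto
  finally show ?thesis .
qed

lemma emeasure_sphere_measure:
  "emeasure (sphere_measure :: 'a::euclidean_space measure) (sphere 0 1) =
    of_nat DIM('a) * emeasure lborel (cball 0 1 :: 'a set)"
proof -
  have "emeasure (sphere_measure :: 'a measure) (sphere 0 1) = (\<integral>\<^sup>+x. 1 \<partial>(sphere_measure :: 'a measure))"
    by simp
  also have "\<dots> = of_nat DIM('a) * (\<integral>\<^sup>+x. indicator (cball 0 1 - {0::'a}) x * 1 \<partial>lborel)"
    unfolding sphere_measure_def by (rule nn_integral_cone_measure) auto
  also have "\<dots> = of_nat DIM('a) * emeasure lborel (cball 0 1 - {0::'a})"
    by (simp add: nn_integral_indicator)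
  also have "\<dots> = of_nat DIM('a) * emeasure lborel (cball 0 1 :: 'a set)"
    by (subst emeasure_Diff) auto
  finally show ?thesis .
qed

lemma finite_sphere_measure: "finite_measure (sphere_measure :: 'a::euclidean_space measure)"
proof
  show "emeasure (sphere_measure :: 'a measure) (space sphere_measure) \<noteq> \<infinity>"
    using emeasure_lborel_cball_finite[of "0::'a" 1]
    by (simp add: emeasure_sphere_measure ennreal_mult_eq_top_iff)
qed

interpretation sphere: finite_measure "sphere_measure :: 'a::euclidean_space measure"
  by (rule finite_sphere_measure)

section \<open>Rims parametrised by the directions orthogonal to their centre\<close>

definition tangent_part :: "'a::euclidean_space \<Rightarrow> 'a \<Rightarrow> 'a" where
  "tangent_part x z = z - (x \<bullet> z) *\<^sub>R x"

definition tangent_dir :: "'a::euclidean_space \<Rightarrow> 'a \<Rightarrow> 'a" where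
  "tangent_dir x z = tangent_part x z /\<^sub>R norm (tangent_part x z)"

text \<open>For a unit vector \<open>x\<close> this merges the slab from
  \<open>hyperplane_measure\<close> with the punctured ball from \<open>cone_measure\<close>.
  Pushing Lebesgue measure on it forward along \<open>tangent_dir x\<close> gives, up to a constant
  factor, surface measure on the unit sphere of the hyperplane orthogonal to \<open>x\<close>. All
  rims are thereby integrated over the same space, which makes Fubini available.\<close>

definition tangent_cylinder :: "'a::euclidean_space \<Rightarrow> 'a set" where
  "tangent_cylinder x = {z. 0 \<le> x \<bullet> z \<and> x \<bullet> z \<le> 1 \<and> norm (tangent_part x z) \<le> 1 \<and> tangent_part x z \<noteq> 0}"

lemma tangent_part_measurable [measurable (raw)]:
  assumes [measurable]: "f \<in> borel_measurable M" "g \<in> borel_measurable M"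
  shows "(\<lambda>w. tangent_part (f w) (g w)) \<in> borel_measurable M"
  unfolding tangent_part_def by measurable

lemma tangent_dir_measurable [measurable (raw)]:
  assumes [measurable]: "f \<in> borel_measurable M" "g \<in> borel_measurable M"
  shows "(\<lambda>w. tangent_dir (f w) (g w)) \<in> borel_measurable M"
  unfolding tangent_dir_def by measurable

lemma tangent_cylinder_pred [measurable (raw)]:
  assumes [measurable]: "f \<in> borel_measurable M" "g \<in> borel_measurable M"
  shows "Measurable.pred M (\<lambda>w. g w \<in> tangent_cylinder (f w))"
  unfolding tangent_cylinder_def mem_Collect_eq by measurable

lemma tangent_cylinder_borel [measurable]: "tangent_cylinder x \<in> sets borel"
proof -
  have "Measurable.pred borel (\<lambda>z. z \<in> tangent_cylinder x)" by measurable
  then show ?thesis by (simp add: pred_def)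
qed

lemma inner_tangent_part: "norm x = 1 \<Longrightarrow> x \<bullet> tangent_part x z = 0"
  by (simp add: tangent_part_def inner_diff_right norm_eq_1)

lemma inner_tangent_dir: "norm x = 1 \<Longrightarrow> x \<bullet> tangent_dir x z = 0"
  by (simp add: tangent_dir_def inner_tangent_part)

text \<open>Where the tangent part vanishes, \<open>tangent_dir\<close> is 0 by the convention for
  division by zero. This is why later bounds are stated on the closed unit ball rather than on the
  unit sphere.\<close>

lemma norm_tangent_dir_le: "norm (tangent_dir x z) \<le> 1"
  by (cases "tangent_part x z = 0") (simp_all add: tangent_dir_def)

lemma norm_tangent_dir: "z \<in> tangent_cylinder x \<Longrightarrow> norm (tangent_dir x z) = 1"
  by (simp add: tangent_dir_def tangent_cylinder_def)

lemma norm_rim_point: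
  assumes "norm x = 1" "0 \<le> t" "t \<le> 1" "norm u = 1" "x \<bullet> u = 0"
  shows "norm (t *\<^sub>R x + sqrt (1 - t\<^sup>2) *\<^sub>R u) = 1"
proof -
  have "t\<^sup>2 \<le> 1" using assms by (simp add: power_le_one)
  then have s: "sqrt (1 - t\<^sup>2) * sqrt (1 - t\<^sup>2) = 1 - t\<^sup>2" by simp
  have 1: "x \<bullet> x = 1" "u \<bullet> u = 1" "u \<bullet> x = 0"
    using assms by (simp_all add: norm_eq_1 inner_commute)
  have "(t *\<^sub>R x + sqrt (1 - t\<^sup>2) *\<^sub>R u) \<bullet> (t *\<^sub>R x + sqrt (1 - t\<^sup>2) *\<^sub>R u) = t * t + (1 - t\<^sup>2)"
    by (simp add: inner_add_left inner_add_right 1 assms s del: real_sqrt_mult_self)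
  then show ?thesis by (simp add: norm_eq_sqrt_inner power2_eq_square)
qed

lemma integral_hyperplane_measure:
  fixes x :: "'a::euclidean_space" and f :: "'a \<Rightarrow> 'b::{banach, second_countable_topology}"
  assumes [measurable]: "f \<in> borel_measurable borel"
  shows "(LINT u|hyperplane_measure x. f u) =
    (LINT z|lborel. indicator {z. 0 \<le> x \<bullet> z \<and> x \<bullet> z \<le> 1} z *\<^sub>R f (tangent_part x z))"
proof -
  have slab: "{z. 0 \<le> x \<bullet> z \<and> x \<bullet> z \<le> 1} \<in> sets borel" by measurable
  have "(\<lambda>z. z - (x \<bullet> z) *\<^sub>R x) \<in> restrict_space lborel {z. 0 \<le> x \<bullet> z \<and> x \<bullet> z \<le> 1} \<rightarrow>\<^sub>M borel"
    by (rule measurable_restrict_space1) measurable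
  then show ?thesis
    unfolding hyperplane_measure_def tangent_part_def
    by (subst integral_distr) (simp_all add: integral_restrict_space slab)
qed

context
  fixes x :: "'a::euclidean_space" and t :: real
  assumes x: "norm x = 1" and t: "0 \<le> t" "t \<le> 1"
begin

private lemma rim_point: "z \<in> tangent_cylinder x \<Longrightarrow> t *\<^sub>R x + sqrt (1 - t\<^sup>2) *\<^sub>R tangent_dir x z \<in> rim x t"
  using x t
  by (simp add: rim_def norm_rim_point norm_tangent_dir inner_tangent_dir inner_add_right
      norm_eq_1[THEN iffD1])

private lemma rim_borel [measurable]: "rim x t \<in> sets borel"
  unfolding rim_def by measurable

private lemma rim_map_measurable:
  "(\<lambda>u. t *\<^sub>R x + sqrt (1 - t\<^sup>2) *\<^sub>R u) \<in> borel_measurable (cone_measure (DIM('a) - 1) (hyperplane_measure x))"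
proof -
  have "(\<lambda>u. t *\<^sub>R x + sqrt (1 - t\<^sup>2) *\<^sub>R u) \<in> borel_measurable (restrict_space borel (sphere 0 1))"
    by (rule measurable_restrict_space1) measurable
  then show ?thesis by (simp cong: measurable_cong_sets)
qed

private lemma rim_scale_nonneg: "0 \<le> sqrt (1 - t\<^sup>2) ^ (DIM('a) - 2)"
  using t by (simp add: power_le_one)

lemma integral_rim_measure:
  fixes f :: "'a \<Rightarrow> 'b::{banach, second_countable_topology}"
  assumes [measurable]: "f \<in> borel_measurable borel"
  shows "(LINT y|rim_measure x t. f y) =
      (sqrt (1 - t\<^sup>2) ^ (DIM('a) - 2) * real (DIM('a) - 1)) *\<^sub>R
      (LINT z|lborel. indicator (tangent_cylinder x) z *\<^sub>R f (t *\<^sub>R x + sqrt (1 - t\<^sup>2) *\<^sub>R tangent_dir x z))"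
proof -
  \<comment> \<open>The indicator comes from the restriction to the rim in
    \<open>rim_measure\<close>; by \<open>rim_point\<close> it equals 1 on the whole cylinder and
    disappears at the end.\<close>
  define G where "G u = indicator (rim x t) (t *\<^sub>R x + sqrt (1 - t\<^sup>2) *\<^sub>R u) *\<^sub>R f (t *\<^sub>R x + sqrt (1 - t\<^sup>2) *\<^sub>R u)" for u
  have [measurable]: "G \<in> borel_measurable borel"
    unfolding G_def by measurable
  have "(LINT y|rim_measure x t. f y) =
      sqrt (1 - t\<^sup>2) ^ (DIM('a) - 2) *\<^sub>R (LINT u|cone_measure (DIM('a) - 1) (hyperplane_measure x). G u)"
    unfolding rim_measure_def G_def using rim_map_measurable rim_scale_nonneg
    by (simp add: integral_restrict_space integral_scale_measure integral_distr space_scale_measure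
        del: power_eq_0_iff zero_le_power_eq)
  also have "(LINT u|cone_measure (DIM('a) - 1) (hyperplane_measure x). G u) = real (DIM('a) - 1) *\<^sub>R
      (LINT u|hyperplane_measure x. indicator (cball 0 1 - {0}) u *\<^sub>R G (u /\<^sub>R norm u))"
    by (rule integral_cone_measure) (auto simp: hyperplane_measure_def)
  also have "(LINT u|hyperplane_measure x. indicator (cball 0 1 - {0}) u *\<^sub>R G (u /\<^sub>R norm u)) =
      (LINT z|lborel. indicator {z. 0 \<le> x \<bullet> z \<and> x \<bullet> z \<le> 1} z *\<^sub>R (indicator (cball 0 1 - {0}) (tangent_part x z) *\<^sub>R
         G (tangent_part x z /\<^sub>R norm (tangent_part x z))))"
    by (rule integral_hyperplane_measure) measurable
  also have "\<dots> = (LINT z|lborel. indicator (tangent_cylinder x) z *\<^sub>R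
        f (t *\<^sub>R x + sqrt (1 - t\<^sup>2) *\<^sub>R tangent_dir x z))"
    using rim_point
    by (intro Bochner_Integration.integral_cong)
       (auto simp: indicator_def tangent_cylinder_def G_def simp flip: tangent_dir_def)
  finally show ?thesis by simp
qed

end

lemma tangent_cylinder_bounded:
  assumes "norm x = 1"
  shows "tangent_cylinder x \<subseteq> cball 0 2"
proof
  fix z assume z: "z \<in> tangent_cylinder x"
  have "norm z = norm (tangent_part x z + (x \<bullet> z) *\<^sub>R x)" by (simp add: tangent_part_def)
  also have "\<dots> \<le> norm (tangent_part x z) + norm ((x \<bullet> z) *\<^sub>R x)" by (rule norm_triangle_ineq)
  also have "\<dots> \<le> 1 + 1" using z assms by (intro add_mono) (auto simp: tangent_cylinder_def)
  finally show "z \<in> cball 0 2" by simp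
qed

lemma tangent_cylinder_finite:
  assumes "norm x = 1"
  shows "emeasure lborel (tangent_cylinder x) < \<infinity>"
  using emeasure_mono[OF tangent_cylinder_bounded[OF assms], of lborel] emeasure_lborel_cball_finite[of 0 2]
  by (auto simp: less_top[symmetric] top_unique)

text \<open>For a unit vector \<open>x\<close>, the integral of \<open>f\<close> over the unit
  sphere of the hyperplane orthogonal to \<open>x\<close>, up to a factor that depends only on the
  dimension.\<close>

definition cyl_integral :: "'a::euclidean_space \<Rightarrow> ('a \<Rightarrow> 'b::{banach, second_countable_topology}) \<Rightarrow> 'b" where
  "cyl_integral x f = (LINT z|lborel. indicator (tangent_cylinder x) z *\<^sub>R f (tangent_dir x z))"

lemma cyl_integrable:
  fixes f :: "'a::euclidean_space \<Rightarrow> 'b::{banach, second_countable_topology}"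
  assumes x: "norm x = 1" and [measurable]: "f \<in> borel_measurable borel"
    and B: "\<And>u. norm u \<le> 1 \<Longrightarrow> norm (f u) \<le> B"
  shows "integrable lborel (\<lambda>z. indicator (tangent_cylinder x) z *\<^sub>R f (tangent_dir x z))"
proof (rule Bochner_Integration.integrable_bound)
  show "integrable lborel (\<lambda>z. indicator (tangent_cylinder x) z * B)"
    using tangent_cylinder_finite[OF x] by (intro integrable_mult_left integrable_real_indicator) auto
  have "0 \<le> B" using order_trans[OF norm_ge_zero B[of 0]] by simp
  then show "AE z in lborel. norm (indicator (tangent_cylinder x) z *\<^sub>R f (tangent_dir x z))
      \<le> norm (indicator (tangent_cylinder x) z * B)"
    using B[OF norm_tangent_dir_le] by (auto simp: indicator_def)
qed measurable

text \<open>Tangent part, cylinder and direction are built from inner products and linear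
  operations, so each of them is equivariant under \<open>Q\<close>.\<close>

lemma cyl_integral_orthogonal:
  fixes Q :: "'a::euclidean_space \<Rightarrow> 'a" and f :: "'a \<Rightarrow> 'b::{banach, second_countable_topology}"
  assumes Q: "orthogonal_transformation Q" and [measurable]: "f \<in> borel_measurable borel"
  shows "cyl_integral (Q x) f = cyl_integral x (\<lambda>u. f (Q u))"
proof -
  have lin: "linear Q" using Q by (rule orthogonal_transformation_linear)
  have inner: "Q v \<bullet> Q w = v \<bullet> w" for v w
    using Q by (simp add: orthogonal_transformation_def)
  have part: "tangent_part (Q x) (Q z) = Q (tangent_part x z)" for z
    by (simp add: tangent_part_def inner linear_diff[OF lin] linear_scale[OF lin])
  have norm: "norm (Q z) = norm z" for z by (rule orthogonal_transformation_norm[OF Q])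
  have "Q z = 0 \<longleftrightarrow> z = 0" for z using norm[of z] by (metis norm_eq_zero)
  then have ind: "indicator (tangent_cylinder (Q x)) (Q z) = (indicator (tangent_cylinder x) z :: real)" for z
    by (simp add: indicator_def tangent_cylinder_def inner part norm)
  have dir: "tangent_dir (Q x) (Q z) = Q (tangent_dir x z)" for z
    by (simp add: tangent_dir_def part norm linear_scale[OF lin])
  have "cyl_integral (Q x) f =
      (LINT z|lborel. indicator (tangent_cylinder (Q x)) (Q z) *\<^sub>R f (tangent_dir (Q x) (Q z)))"
    unfolding cyl_integral_def by (rule integral_lborel_orthogonal[OF Q, symmetric]) measurable
  then show ?thesis by (simp add: cyl_integral_def ind dir)
qed

lemma cyl_integral_cong_tangent:
  assumes "norm x = 1" "\<And>u. x \<bullet> u = 0 \<Longrightarrow> f u = g u"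
  shows "cyl_integral x f = cyl_integral x g"
  unfolding cyl_integral_def
  by (intro Bochner_Integration.integral_cong) (simp_all add: assms inner_tangent_dir)

section \<open>Norm estimates on the sphere\<close>

lemma sphere_norm_eq:
  "sphere_norm (f :: 'a::euclidean_space \<Rightarrow> complex) =
    sqrt ((LINT x|sphere_measure. (cmod (f x))\<^sup>2) / measure (sphere_measure :: 'a measure) (sphere 0 1))"
  unfolding sphere_norm_def sphere_inner_def complex_norm_square[symmetric] integral_complex_of_real
  by (simp only: of_real_divide[symmetric] Re_complex_of_real space_sphere_measure)

lemma sphere_norm_le:
  fixes f :: "'a::euclidean_space \<Rightarrow> complex"
  assumes "\<And>x. norm x = 1 \<Longrightarrow> cmod (f x) \<le> B" "0 \<le> B"
  shows "sphere_norm f \<le> B"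
proof -
  let ?M = "sphere_measure :: 'a measure"
  have "(LINT x|?M. (cmod (f x))\<^sup>2) \<le> B\<^sup>2 * measure ?M (sphere 0 1)"
  \<comment> \<open>If the square is not integrable, its Bochner integral is 0 and the bound is
    trivial.\<close>
  proof (cases "integrable ?M (\<lambda>x. (cmod (f x))\<^sup>2)")
    case True
    have "(LINT x|?M. (cmod (f x))\<^sup>2) \<le> (LINT x|?M. B\<^sup>2)"
      using assms by (intro integral_mono True) (auto intro!: power_mono)
    then show ?thesis by (simp add: mult.commute)
  qed (simp add: not_integrable_integral_eq)
  then have "(LINT x|?M. (cmod (f x))\<^sup>2) / measure ?M (sphere 0 1) \<le> B\<^sup>2"
    by (cases "measure ?M (sphere 0 1) = 0") (simp_all add: divide_le_eq zero_less_measure_iff)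
  then show ?thesis
    using assms(2) by (simp add: sphere_norm_eq real_le_lsqrt)
qed

lemma borel_measurable_sphere_measure:
  "f \<in> borel_measurable borel \<Longrightarrow> f \<in> borel_measurable sphere_measure"
  by (subst measurable_cong_sets[OF sets_sphere_measure refl]) (rule measurable_restrict_space1)

lemma bounded_in_L2_sphere:
  fixes f :: "'a::euclidean_space \<Rightarrow> complex"
  assumes "f \<in> borel_measurable sphere_measure" "\<And>x. norm x = 1 \<Longrightarrow> cmod (f x) \<le> B"
  shows "f \<in> L2_sphere"
proof -
  have "integrable sphere_measure (\<lambda>x. (cmod (f x))\<^sup>2)"
    using assms by (intro sphere.integrable_const_bound[of _ "B\<^sup>2"] AE_I2) (auto intro!: power_mono)
  then show ?thesis using assms by (simp add: L2_def)
qed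

text \<open>Second-order control near 1: the difference factors as \<open>1 - w\<close> times the
  sum of the \<open>w ^ i - 1\<close>, each at most \<open>i\<close> times
  \<open>cmod (1 - w)\<close> on the unit disc. A first-order estimate would not do, because in the
  application \<open>cmod (1 - w)\<close> is only of order \<open>sqrt (1 - t)\<close>, while a
  bound linear in \<open>1 - t\<close> is wanted.\<close>

lemma norm_one_minus_power_taylor:
  fixes w :: complex
  assumes "cmod w \<le> 1"
  shows "cmod (1 - w ^ k - of_nat k * (1 - w)) \<le> real k ^ 2 * (cmod (1 - w))\<^sup>2"
proof -
  have "1 - w ^ k - of_nat k * (1 - w) = (1 - w) * (\<Sum>i<k. w ^ i - 1)"
    by (simp add: one_diff_power_eq sum_subtractf algebra_simps)
  moreover have "cmod (\<Sum>i<k. w ^ i - 1) \<le> (\<Sum>i<k. real k * cmod (1 - w))"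
  proof (rule sum_norm_le)
    fix i assume "i \<in> {..<k}"
    have "cmod (w ^ i - 1 ^ i) \<le> real i * cmod (w - 1)"
      using assms by (intro norm_power_diff) auto
    also have "\<dots> \<le> real k * cmod (1 - w)"
      using \<open>i \<in> {..<k}\<close> by (intro mult_mono) (auto simp: norm_minus_commute)
    finally show "cmod (w ^ i - 1) \<le> real k * cmod (1 - w)" by simp
  qed
  ultimately have "cmod (1 - w ^ k - of_nat k * (1 - w)) \<le> cmod (1 - w) * (\<Sum>i<k. real k * cmod (1 - w))"
    by (simp only: norm_mult) (intro mult_left_mono, auto)
  then show ?thesis by (simp add: power2_eq_square mult_ac)
qed

section \<open>Powers of an isotropic linear form\<close>

locale frame =
  fixes e1 e2 :: "'a::euclidean_space"
  assumes norm_e1 [simp]: "norm e1 = 1" and norm_e2 [simp]: "norm e2 = 1" and e12 [simp]: "e1 \<bullet> e2 = 0"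
begin

lemma frame_inner [simp]: "e1 \<bullet> e1 = 1" "e2 \<bullet> e2 = 1" "e2 \<bullet> e1 = 0"
  using norm_e1 norm_e2 e12 unfolding norm_eq_1 by (simp_all add: inner_commute)

lemma DIM_ge_2: "2 \<le> DIM('a)"
proof -
  have "e1 \<noteq> e2" "e1 \<noteq> 0" "e2 \<noteq> 0" using e12 frame_inner(1,2) by fastforce+
  moreover have "orthogonal e1 e2" by (simp add: orthogonal_def)
  ultimately have "independent {e1, e2}"
    by (intro pairwise_orthogonal_independent) (auto simp: pairwise_def orthogonal_commute)
  then show ?thesis using independent_bound[of "{e1, e2}"] \<open>e1 \<noteq> e2\<close> by simp
qed

definition zf :: "'a \<Rightarrow> complex" where
  "zf x = Complex (x \<bullet> e1) (x \<bullet> e2)"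

lemma zf_alt: "zf x = of_real (x \<bullet> e1) + \<i> * of_real (x \<bullet> e2)"
  by (simp add: zf_def complex_eq_iff)

lemma zf_add: "zf (x + y) = zf x + zf y" and zf_scale: "zf (c *\<^sub>R x) = of_real c * zf x"
  by (simp_all add: zf_alt inner_add_left algebra_simps)

lemma zf_measurable [measurable]: "zf \<in> borel_measurable borel"
  unfolding zf_alt by measurable

lemma cnj_zf_measurable [measurable]: "(\<lambda>x. cnj (zf x)) \<in> borel_measurable borel"
  by (rule measurable_compose[OF zf_measurable]) (intro borel_measurable_continuous_onI continuous_intros)

lemma norm_zf: "cmod (zf x) \<le> norm x"
proof -
  \<comment> \<open>Bessel's inequality: the component of \<open>x\<close> orthogonal to
    \<open>e1\<close> and \<open>e2\<close> has non-negative squared length.\<close>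
  define y where "y = x - (x \<bullet> e1) *\<^sub>R e1 - (x \<bullet> e2) *\<^sub>R e2"
  have "y \<bullet> y = x \<bullet> x - (x \<bullet> e1)\<^sup>2 - (x \<bullet> e2)\<^sup>2"
    by (simp add: y_def inner_diff_left inner_diff_right inner_commute[of e1 x] inner_commute[of e2 x]
        power2_eq_square)
  then have "(x \<bullet> e1)\<^sup>2 + (x \<bullet> e2)\<^sup>2 \<le> x \<bullet> x" using inner_ge_zero[of y] by linarith
  then show ?thesis by (simp add: zf_def cmod_def norm_eq_sqrt_inner)
qed

lemma norm_zf_power: "norm x \<le> 1 \<Longrightarrow> cmod (zf x ^ k) \<le> 1"
  using norm_zf[of x] by (simp add: norm_power power_le_one)

section \<open>Moments over the tangent sphere\<close>

definition cyl_volume :: real where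
  "cyl_volume = measure lborel (tangent_cylinder e1)"

text \<open>By rotation invariance these numbers describe the integrals of powers of any linear form
  over any tangent sphere. Their values stay implicit; what enters is
  \<open>moment 0 = cyl_volume\<close> and the vanishing for odd \<open>j\<close>.\<close>

definition moment :: "nat \<Rightarrow> real" where
  "moment j = cyl_integral e1 (\<lambda>u. (u \<bullet> e2) ^ j)"

lemma cyl_volume_pos: "0 < cyl_volume"
proof -
  \<comment> \<open>This point has height 1/2 and tangent part \<open>e2 / 2\<close>. A displacement
    shorter than 1/4 keeps the height between 1/4 and 3/4, the norm of the tangent part at most 1/2
    + 2/4, and its \<open>e2\<close> component positive.\<close>
  define p where "p = (1/2) *\<^sub>R e1 + (1/2) *\<^sub>R e2"
  have "ball p (1/4) \<subseteq> tangent_cylinder e1"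
  proof
    fix z assume "z \<in> ball p (1/4)"
    then obtain w where w: "z = p + w" "norm w < 1/4"
      by (metis add.commute diff_add_cancel dist_norm mem_ball norm_minus_commute)
    have "\<bar>e1 \<bullet> w\<bar> \<le> norm w" "\<bar>e2 \<bullet> w\<bar> \<le> norm w"
      using Cauchy_Schwarz_ineq2[of e1 w] Cauchy_Schwarz_ineq2[of e2 w] by simp_all
    moreover have 1: "e1 \<bullet> z = 1/2 + e1 \<bullet> w" by (simp add: w p_def inner_add_right)
    moreover have part: "tangent_part e1 z = (1/2) *\<^sub>R e2 + (w - (e1 \<bullet> w) *\<^sub>R e1)"
      unfolding tangent_part_def 1 by (simp add: w p_def algebra_simps)
    moreover have "e2 \<bullet> tangent_part e1 z = 1/2 + e2 \<bullet> w"
      unfolding part by (simp add: inner_add_right inner_diff_right)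
    moreover have "norm (tangent_part e1 z) \<le> norm ((1/2) *\<^sub>R e2) + (norm w + norm ((e1 \<bullet> w) *\<^sub>R e1))"
      unfolding part by (intro norm_triangle_mono order_refl norm_triangle_ineq4)
    ultimately show "z \<in> tangent_cylinder e1"
      using w(2) unfolding tangent_cylinder_def by auto
  qed
  then have "measure lborel (ball p (1/4)) \<le> cyl_volume"
    unfolding cyl_volume_def using tangent_cylinder_finite[OF norm_e1]
    by (intro measure_mono_fmeasurable) (auto simp: fmeasurable_def)
  moreover have "0 < measure lborel (ball p (1/4))"
    by (rule content_ball_pos) simp
  ultimately show ?thesis by linarith
qed

lemma inner_power_le:
  fixes u a :: 'a
  assumes "norm u \<le> 1"
  shows "norm ((u \<bullet> a) ^ j) \<le> norm a ^ j"
proof -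
  have "\<bar>u \<bullet> a\<bar> \<le> norm u * norm a" by (rule Cauchy_Schwarz_ineq2)
  also have "\<dots> \<le> norm a" using assms by (simp add: mult_left_le_one_le)
  finally show ?thesis by (simp add: power_abs power_mono)
qed

text \<open>Directions orthogonal to \<open>x\<close> see only the tangent part \<open>b\<close> of
  \<open>a\<close>. Rotating \<open>x\<close> to \<open>e1\<close> and \<open>b\<close> to
  \<open>norm b *\<^sub>R e2\<close> leaves a standard moment.\<close>

lemma cyl_integral_inner_power:
  fixes x a :: 'a
  assumes x: "norm x = 1"
  shows "cyl_integral x (\<lambda>u. (u \<bullet> a) ^ j) = moment j * norm (tangent_part x a) ^ j"
proof -
  define b where "b = tangent_part x a"
  obtain Q where Q: "orthogonal_transformation Q" "Q x = e1" "Q b = norm b *\<^sub>R e2"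
    using orthogonal_transformation_pair[of e1 e2 x b] x by (auto simp: b_def inner_tangent_part)
  have inner: "Q v \<bullet> Q w = v \<bullet> w" for v w
    using Q(1) by (simp add: orthogonal_transformation_def)
  have "norm b ^ j * moment j = cyl_integral e1 (\<lambda>u. (u \<bullet> (norm b *\<^sub>R e2)) ^ j)"
    unfolding moment_def cyl_integral_def inner_scaleR_right power_mult_distrib mult_scaleR_right[symmetric]
    by (rule integral_mult_right_zero[symmetric])
  also have "\<dots> = cyl_integral x (\<lambda>u. (Q u \<bullet> Q b) ^ j)"
    unfolding Q(2)[symmetric] Q(3) by (rule cyl_integral_orthogonal[OF Q(1)]) measurable
  also have "\<dots> = cyl_integral x (\<lambda>u. (u \<bullet> a) ^ j)"
    by (rule cyl_integral_cong_tangent[OF x])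
       (simp add: inner b_def tangent_part_def inner_diff_right inner_commute)
  finally show ?thesis by (simp add: b_def mult.commute)
qed

text \<open>The reflection that negates \<open>e2\<close> fixes \<open>e1\<close>, hence preserves
  the integral, but changes the sign of the integrand.\<close>

lemma moment_odd:
  assumes "odd j"
  shows "moment j = 0"
proof -
  obtain Q where Q: "orthogonal_transformation Q" "Q e2 = - e2" "\<And>v. v \<bullet> e2 = v \<bullet> (- e2) \<Longrightarrow> Q v = v"
    using orthogonal_transformation_reflect[of e2 "- e2"] by (metis norm_minus_cancel)
  have inner: "Q v \<bullet> Q w = v \<bullet> w" for v w
    using Q(1) by (simp add: orthogonal_transformation_def)
  have Q1: "Q e1 = e1" using Q(3) by simp
  have "moment j = cyl_integral (Q e1) (\<lambda>u. (u \<bullet> e2) ^ j)"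
    by (simp add: moment_def Q1)
  also have "\<dots> = cyl_integral e1 (\<lambda>u. (Q u \<bullet> e2) ^ j)"
    by (rule cyl_integral_orthogonal[OF Q(1)]) measurable
  also have "\<dots> = cyl_integral e1 (\<lambda>u. - ((u \<bullet> e2) ^ j))"
  proof -
    have "(Q u \<bullet> e2) ^ j = - ((u \<bullet> e2) ^ j)" for u
      using inner[of u e2] assms power_minus_odd[of j "u \<bullet> e2"]
      by (simp add: Q(2) minus_equation_iff[of "Q u \<bullet> e2"])
    then show ?thesis by simp
  qed
  also have "\<dots> = - moment j" by (simp add: moment_def cyl_integral_def)
  finally show ?thesis by simp
qed

lemma cyl_integral_of_real:
  fixes f :: "'a \<Rightarrow> real"
  shows "cyl_integral x (\<lambda>u. of_real (f u) :: complex) = of_real (cyl_integral x f)"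
proof -
  have "indicator (tangent_cylinder x) z *\<^sub>R complex_of_real (f (tangent_dir x z)) =
      complex_of_real (indicator (tangent_cylinder x) z *\<^sub>R f (tangent_dir x z))" for z
    by (simp add: scaleR_conv_of_real)
  then show ?thesis unfolding cyl_integral_def by (simp only: integral_complex_of_real)
qed

lemma cyl_integral_cmult:
  fixes f :: "'a \<Rightarrow> complex"
  shows "cyl_integral x (\<lambda>u. c * f u) = c * cyl_integral x f"
  unfolding cyl_integral_def by (simp only: mult_scaleR_right[symmetric] integral_mult_right_zero)

lemma cyl_integral_1:
  fixes x :: 'a
  assumes "norm x = 1"
  shows "cyl_integral x (\<lambda>_. 1 :: complex) = of_real cyl_volume"
proof -
  have "cyl_integral x (\<lambda>_. 1 :: real) = cyl_volume"
    using cyl_integral_inner_power[OF assms, of 0 0]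
    by (simp add: moment_def cyl_integral_def cyl_volume_def)
  then show ?thesis
    using cyl_integral_of_real[of x "\<lambda>_. 1"] by simp
qed

lemma cyl_integral_sum:
  fixes f :: "nat \<Rightarrow> 'a \<Rightarrow> complex"
  assumes "norm x = 1" "\<And>i. f i \<in> borel_measurable borel"
    and "\<And>i u. norm u \<le> 1 \<Longrightarrow> norm (f i u) \<le> B i"
  shows "cyl_integral x (\<lambda>u. \<Sum>i\<in>I. f i u) = (\<Sum>i\<in>I. cyl_integral x (f i))"
  unfolding cyl_integral_def scaleR_sum_right
  by (rule Bochner_Integration.integral_sum) (rule cyl_integrable[OF assms(1,2)], erule assms(3))

text \<open>
  Both sides of the moment formula for \<open>a = e1 + \<tau> e2\<close> are polynomials in the real number \<open>\<tau>\<close>, so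
  they also agree at \<open>\<tau> = \<i>\<close>, where the squared length of the tangential part becomes
  \<open>- (zf x)\<^sup>2\<close> because \<open>e1 + \<i> e2\<close> is isotropic.
\<close>

lemma cyl_integral_zf_power:
  assumes x: "norm x = 1"
  shows "cyl_integral x (\<lambda>u. zf u ^ j) = of_real (moment j) * (\<i> * zf x) ^ j"
proof -
  define M where "M l = cyl_integral x (\<lambda>u. (u \<bullet> e2) ^ l * (u \<bullet> e1) ^ (j - l))" for l
  define P :: "complex poly" where "P = (\<Sum>l\<le>j. monom (of_nat (j choose l) * of_real (M l)) l)"
  define q :: "complex poly" where
    \<comment> \<open>The squared norm of the tangent part of
      \<open>e1 + \<tau> *\<^sub>R e2\<close>, that is
      \<open>a \<bullet> a - (x \<bullet> a)\<^sup>2\<close>, as a polynomial in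
      \<open>\<tau>\<close>.\<close>
    "q = [:of_real (1 - (x \<bullet> e1)\<^sup>2), of_real (- 2 * (x \<bullet> e1) * (x \<bullet> e2)), of_real (1 - (x \<bullet> e2)\<^sup>2):]"
  \<comment> \<open>An odd power of the norm is not a polynomial expression in
    \<open>\<tau>\<close>, but it only occurs together with a vanishing moment.\<close>
  define R where "R = (if even j then smult (of_real (moment j)) (q ^ (j div 2)) else 0)"
  have bound: "norm ((u \<bullet> e2) ^ l * (u \<bullet> e1) ^ k) \<le> 1" if "norm u \<le> 1" for u l k
    using mult_mono[OF inner_power_le[OF that, of e2 l] inner_power_le[OF that, of e1 k]]
    by (simp add: abs_mult)
  have expand: "cyl_integral x (\<lambda>u. (of_real (u \<bullet> e1) + \<tau> * of_real (u \<bullet> e2)) ^ j) = poly P \<tau>" for \<tau> :: complex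
  proof -
    have "cyl_integral x (\<lambda>u. (of_real (u \<bullet> e1) + \<tau> * of_real (u \<bullet> e2)) ^ j) =
       cyl_integral x (\<lambda>u. \<Sum>l\<le>j. (of_nat (j choose l) * \<tau> ^ l) * of_real ((u \<bullet> e2) ^ l * (u \<bullet> e1) ^ (j - l)))"
      by (simp add: add.commute[of "of_real _"] binomial_ring power_mult_distrib mult_ac)
    also have "\<dots> = (\<Sum>l\<le>j. cyl_integral x (\<lambda>u. (of_nat (j choose l) * \<tau> ^ l) * of_real ((u \<bullet> e2) ^ l * (u \<bullet> e1) ^ (j - l))))"
    proof (rule cyl_integral_sum[OF x])
      fix l and u :: 'a assume "norm u \<le> 1"
      then show "norm ((of_nat (j choose l) * \<tau> ^ l) * of_real ((u \<bullet> e2) ^ l * (u \<bullet> e1) ^ (j - l)))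
         \<le> norm (of_nat (j choose l) * \<tau> ^ l) * 1"
        unfolding norm_mult[of "of_nat _ * _"] norm_of_real
        by (intro mult_left_mono) (use bound in auto)
    qed measurable
    also have "\<dots> = poly P \<tau>"
      by (simp only: cyl_integral_cmult cyl_integral_of_real)
         (simp add: P_def M_def poly_sum poly_monom mult_ac)
    finally show ?thesis .
  qed
  have agree: "poly P (of_real \<tau>) = poly R (of_real \<tau>)" for \<tau> :: real
  proof -
    define a where "a = e1 + \<tau> *\<^sub>R e2"
    have "poly P (of_real \<tau>) = cyl_integral x (\<lambda>u. of_real ((u \<bullet> a) ^ j))"
      by (simp add: a_def inner_add_right flip: expand)
    also have "\<dots> = of_real (moment j * norm (tangent_part x a) ^ j)"
      by (simp only: cyl_integral_of_real cyl_integral_inner_power[OF x])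
    also have "\<dots> = poly R (of_real \<tau>)"
    proof (cases "even j")
      case True
      then obtain i where i: "j = 2 * i" by (elim evenE)
      have "(norm (tangent_part x a))\<^sup>2 = a \<bullet> a - (x \<bullet> a)\<^sup>2"
        using x unfolding power2_norm_eq_inner tangent_part_def
        by (simp add: inner_diff_left inner_diff_right norm_eq_1 inner_commute[of a x] power2_eq_square)
      also have "\<dots> = 1 - (x \<bullet> e1)\<^sup>2 + \<tau> * (- 2 * (x \<bullet> e1) * (x \<bullet> e2) + \<tau> * (1 - (x \<bullet> e2)\<^sup>2))"
        by (simp add: a_def inner_add_left inner_add_right power2_eq_square algebra_simps)
      finally have "of_real ((norm (tangent_part x a))\<^sup>2) = poly q (of_real \<tau>)"
        by (simp add: q_def)
      then show ?thesis
        using i by (simp add: R_def power_mult)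
    qed (simp add: R_def moment_odd)
    finally show ?thesis .
  qed
  have "P = R"
  proof (rule ccontr)
    assume "P \<noteq> R"
    then have "finite {w. poly (P - R) w = 0}" by (intro poly_roots_finite) simp
    moreover have "range (of_real :: real \<Rightarrow> complex) \<subseteq> {w. poly (P - R) w = 0}"
      using agree by auto
    ultimately have "finite (range (of_real :: real \<Rightarrow> complex))" by (rule rev_finite_subset)
    then show False
      using finite_imageD[of "of_real :: real \<Rightarrow> complex" UNIV] by (simp add: inj_of_real infinite_UNIV_char_0)
  qed
  have "cyl_integral x (\<lambda>u. zf u ^ j) = poly R \<i>"
    using expand[of \<i>] \<open>P = R\<close> by (simp add: zf_alt)
  also have "\<dots> = of_real (moment j) * (\<i> * zf x) ^ j"
  proof (cases "even j")
    case True
    then obtain i where i: "j = 2 * i" by (elim evenE)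
    have "poly q \<i> = (\<i> * zf x)\<^sup>2"
      by (simp add: q_def zf_alt power2_eq_square complex_eq_iff algebra_simps)
    then show ?thesis using i by (simp add: R_def power_mult)
  qed (simp add: R_def moment_odd)
  finally show ?thesis .
qed

end

section \<open>Rapidly decreasing coefficient sequences\<close>

lemma sphere_norm_nonneg: "0 \<le> sphere_norm f"
  unfolding sphere_norm_eq by (intro real_sqrt_ge_zero divide_nonneg_nonneg integral_nonneg) simp_all

definition rapidly_decreasing :: "(nat \<Rightarrow> complex) \<Rightarrow> bool" where
  "rapidly_decreasing \<alpha> \<longleftrightarrow> (\<forall>r. summable (\<lambda>k. cmod (\<alpha> k) * real k ^ r))"

lemma rapidly_decreasing_summable: "rapidly_decreasing \<alpha> \<Longrightarrow> summable (\<lambda>k. cmod (\<alpha> k))"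
  unfolding rapidly_decreasing_def by (drule spec[of _ 0]) simp

text \<open>Stability under multipliers of polynomial growth is what keeps the iterated derivatives,
  and the difference quotients, inside this class.\<close>

lemma rapidly_decreasing_mult:
  assumes "rapidly_decreasing \<alpha>" "\<And>k. cmod (c k) \<le> C * real k ^ p"
  shows "rapidly_decreasing (\<lambda>k. \<alpha> k * c k)"
  unfolding rapidly_decreasing_def
proof
  fix r
  have "summable (\<lambda>k. C * (cmod (\<alpha> k) * real k ^ (p + r)))"
    using assms(1) unfolding rapidly_decreasing_def by (intro summable_mult) blast
  then show "summable (\<lambda>k. cmod (\<alpha> k * c k) * real k ^ r)"
  proof (rule summable_comparison_test'[where N = 0])
    fix k
    have "cmod (\<alpha> k) * (cmod (c k) * real k ^ r) \<le> cmod (\<alpha> k) * (C * real k ^ p * real k ^ r)"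
      by (intro mult_left_mono mult_right_mono assms(2)) auto
    then show "norm (cmod (\<alpha> k * c k) * real k ^ r) \<le> C * (cmod (\<alpha> k) * real k ^ (p + r))"
      by (simp add: norm_mult power_add mult_ac)
  qed
qed

section \<open>Rim averages of powers of the linear form\<close>

context frame
begin

text \<open>The rim integral and the rim volume carry the same Jacobian factor
  \<open>\<kappa>\<close>, which is non-zero because \<open>t < 1\<close>, and so it
  cancels.\<close>

lemma rim_average_eq:
  fixes x :: 'a
  assumes x: "norm x = 1" and t: "0 \<le> t" "t < 1" and f: "f \<in> borel_measurable borel"
  shows "rim_average t f x =
    cyl_integral x (\<lambda>u. f (t *\<^sub>R x + sqrt (1 - t\<^sup>2) *\<^sub>R u)) / of_real cyl_volume"
proof -
  define \<kappa> where "\<kappa> = sqrt (1 - t\<^sup>2) ^ (DIM('a) - 2) * real (DIM('a) - 1)"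
  have "t\<^sup>2 < 1" using t by (simp add: power_less_one_iff abs_square_less_1)
  then have "\<kappa> \<noteq> 0" using DIM_ge_2 by (simp add: \<kappa>_def)
  have "measure (rim_measure x t) (rim x t) = (LINT y|rim_measure x t. 1)"
    by (simp add: rim_measure_def space_restrict_space space_scale_measure)
  also have "\<dots> = \<kappa> * cyl_integral x (\<lambda>_. 1)"
    unfolding cyl_integral_def \<kappa>_def using integral_rim_measure[OF x, of t "\<lambda>_. 1 :: real"] t by simp
  also have "cyl_integral x (\<lambda>_. 1) = cyl_volume"
    using cyl_integral_of_real[of x "\<lambda>_. 1"] cyl_integral_1[OF x] by simp
  finally have "measure (rim_measure x t) (rim x t) = \<kappa> * cyl_volume" .
  moreover have "(LINT y|rim_measure x t. f y) = \<kappa> *\<^sub>R cyl_integral x (\<lambda>u. f (t *\<^sub>R x + sqrt (1 - t\<^sup>2) *\<^sub>R u))"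
    unfolding cyl_integral_def \<kappa>_def using integral_rim_measure[OF x _ _ f, of t] t by simp
  ultimately show ?thesis
    using \<open>\<kappa> \<noteq> 0\<close> by (simp add: rim_average_def scaleR_conv_of_real)
qed

text \<open>
  Laplace's integral for the Gegenbauer polynomial of degree \<open>k\<close>, normalised to be \<open>1\<close> at \<open>t = 1\<close>.
\<close>

definition zonal :: "nat \<Rightarrow> real \<Rightarrow> complex" where
  "zonal k t = cyl_integral e1 (\<lambda>u. (of_real t + \<i> * of_real (sqrt (1 - t\<^sup>2) * (u \<bullet> e2))) ^ k) / of_real cyl_volume"

text \<open>The function \<open>zonal\<close> with the square root removed: odd powers of it vanish
  together with the odd moments, and its even powers are powers of \<open>T\<^sup>2 - 1\<close> up
  to the sign absorbed from \<open>\<i>\<close>. Unlike the square root, this is differentiable at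
  1.\<close>

definition zonal_poly :: "nat \<Rightarrow> complex \<Rightarrow> complex" where
  "zonal_poly k T = (\<Sum>j\<le>k. of_nat (k choose j) * T ^ (k - j) *
      (if even j then (T\<^sup>2 - 1) ^ (j div 2) else 0) * of_real (moment j)) / of_real cyl_volume"

text \<open>As the polynomial takes the value 1 at 1, its derivative there is the limit of the
  difference quotient. The classical value is \<open>k * (k + m - 1) / m\<close> with
  \<open>m = DIM('a) - 1\<close>; here it enters only through a quadratic bound.\<close>

definition LB_eigenvalue :: "nat \<Rightarrow> complex" where
  "LB_eigenvalue k = deriv (zonal_poly k) 1"

text \<open>The base of Laplace's integrand lies in the unit disc, at a distance from 1 of order
  \<open>sqrt (1 - t)\<close>. The second estimate is what converts a remainder quadratic in
  \<open>1 - w\<close> into one linear in \<open>1 - t\<close>.\<close>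

lemma norm_disc_point:
  assumes "0 \<le> t" "t \<le> 1" "norm u \<le> 1"
  shows "cmod (of_real t + \<i> * of_real (sqrt (1 - t\<^sup>2) * (u \<bullet> e2))) \<le> 1"
    and "(cmod (1 - (of_real t + \<i> * of_real (sqrt (1 - t\<^sup>2) * (u \<bullet> e2)))))\<^sup>2 \<le> 2 * (1 - t)"
proof -
  have t2: "t\<^sup>2 \<le> 1" using assms by (simp add: power_le_one)
  have "\<bar>u \<bullet> e2\<bar> \<le> 1" using inner_power_le[OF assms(3), of e2 1] by simp
  then have "(u \<bullet> e2)\<^sup>2 \<le> 1" by (simp add: abs_square_le_1)
  then have s: "(sqrt (1 - t\<^sup>2) * (u \<bullet> e2))\<^sup>2 \<le> 1 - t\<^sup>2"
    using t2 mult_left_mono[of "(u \<bullet> e2)\<^sup>2" 1 "1 - t\<^sup>2"] by (simp add: power_mult_distrib)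
  then show "cmod (of_real t + \<i> * of_real (sqrt (1 - t\<^sup>2) * (u \<bullet> e2))) \<le> 1"
    by (simp add: cmod_def)
  have "(1 - t)\<^sup>2 + (1 - t\<^sup>2) = 2 * (1 - t)" by (simp add: power2_eq_square algebra_simps)
  then show "(cmod (1 - (of_real t + \<i> * of_real (sqrt (1 - t\<^sup>2) * (u \<bullet> e2)))))\<^sup>2 \<le> 2 * (1 - t)"
    using s unfolding cmod_power2 by simp
qed

lemma zonal_expand:
  assumes t: "0 \<le> t" "t \<le> 1"
  shows "zonal k t = (\<Sum>j\<le>k. of_nat (k choose j) * of_real t ^ (k - j) *
      (\<i> * of_real (sqrt (1 - t\<^sup>2))) ^ j * of_real (moment j)) / of_real cyl_volume"
proof -
  have "cyl_integral e1 (\<lambda>u. (of_real t + \<i> * of_real (sqrt (1 - t\<^sup>2) * (u \<bullet> e2))) ^ k) =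
     cyl_integral e1 (\<lambda>u. \<Sum>j\<le>k. (of_nat (k choose j) * of_real t ^ (k - j) *
      (\<i> * of_real (sqrt (1 - t\<^sup>2))) ^ j) * of_real ((u \<bullet> e2) ^ j))"
    by (simp add: add.commute[of "of_real t"] binomial_ring power_mult_distrib mult_ac)
  also have "\<dots> = (\<Sum>j\<le>k. cyl_integral e1 (\<lambda>u. (of_nat (k choose j) * of_real t ^ (k - j) *
      (\<i> * of_real (sqrt (1 - t\<^sup>2))) ^ j) * of_real ((u \<bullet> e2) ^ j)))"
  proof (rule cyl_integral_sum)
    fix j and u :: 'a assume "norm u \<le> 1"
    then show "norm ((of_nat (k choose j) * of_real t ^ (k - j) *
      (\<i> * of_real (sqrt (1 - t\<^sup>2))) ^ j) * of_real ((u \<bullet> e2) ^ j) :: complex) \<le>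
      norm (of_nat (k choose j) * of_real t ^ (k - j) * (\<i> * of_real (sqrt (1 - t\<^sup>2))) ^ j :: complex) * 1"
      unfolding norm_mult[of "of_nat _ * _ * _"] norm_of_real
      by (intro mult_left_mono) (use inner_power_le[of u e2 j] in auto)
  qed (simp, measurable)
  also have "\<dots> = (\<Sum>j\<le>k. of_nat (k choose j) * of_real t ^ (k - j) *
      (\<i> * of_real (sqrt (1 - t\<^sup>2))) ^ j * of_real (moment j))"
    by (simp only: cyl_integral_cmult cyl_integral_of_real moment_def)
  finally show ?thesis by (simp add: zonal_def)
qed

lemma zonal_eq_poly:
  assumes t: "0 \<le> t" "t \<le> 1"
  shows "zonal k t = zonal_poly k (of_real t)"
proof -
  have "t\<^sup>2 \<le> 1" using t by (simp add: power_le_one)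
  then have "of_real (sqrt (1 - t\<^sup>2)) ^ 2 = (of_real (1 - t\<^sup>2) :: complex)"
    by (simp flip: of_real_power)
  then have sq: "(\<i> * of_real (sqrt (1 - t\<^sup>2))) ^ 2 = ((of_real t)\<^sup>2 - 1 :: complex)"
    by (simp add: power_mult_distrib)
  have "(\<i> * of_real (sqrt (1 - t\<^sup>2))) ^ j * of_real (moment j) =
     (if even j then ((of_real t)\<^sup>2 - 1) ^ (j div 2) else 0) * of_real (moment j)" for j
  proof (cases "even j")
    case True
    then obtain i where "j = 2 * i" by (elim evenE)
    then show ?thesis using sq by (simp only: power_mult) simp
  qed (simp add: moment_odd)
  then show ?thesis
    unfolding zonal_expand[OF t] zonal_poly_def mult.assoc by (simp only:)
qed

lemma zonal_1: "zonal k 1 = 1"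
  using cyl_volume_pos cyl_integral_1[OF norm_e1] by (simp add: zonal_def)

text \<open>An instance of the Funk-Hecke formula. The form is linear, so the binomial theorem
  separates \<open>zf x\<close> from \<open>zf u\<close>; the mean of \<open>zf u ^ j\<close> is a
  multiple of \<open>zf x ^ j\<close>, hence every term contains the full power
  \<open>zf x ^ k\<close>.\<close>

lemma rim_average_zf_power:
  assumes x: "norm x = 1" and t: "0 \<le> t" "t < 1"
  shows "rim_average t (\<lambda>y. zf y ^ k) x = zonal k t * zf x ^ k"
proof -
  define s where "s = sqrt (1 - t\<^sup>2)"
  have "cyl_integral x (\<lambda>u. zf (t *\<^sub>R x + s *\<^sub>R u) ^ k) =
     cyl_integral x (\<lambda>u. \<Sum>j\<le>k. (of_nat (k choose j) * of_real s ^ j * (of_real t * zf x) ^ (k - j)) * zf u ^ j)"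
    by (simp add: zf_add zf_scale add.commute[of "of_real t * _"] binomial_ring power_mult_distrib mult_ac)
  also have "\<dots> = (\<Sum>j\<le>k. cyl_integral x (\<lambda>u. (of_nat (k choose j) * of_real s ^ j *
      (of_real t * zf x) ^ (k - j)) * zf u ^ j))"
  proof (rule cyl_integral_sum[OF x])
    fix j and u :: 'a assume "norm u \<le> 1"
    then show "cmod ((of_nat (k choose j) * of_real s ^ j * (of_real t * zf x) ^ (k - j)) * zf u ^ j) \<le>
       cmod (of_nat (k choose j) * of_real s ^ j * (of_real t * zf x) ^ (k - j)) * 1"
      unfolding norm_mult[of "of_nat _ * _ * _"]
      by (intro mult_left_mono norm_zf_power) auto
  qed measurable
  also have "\<dots> = (\<Sum>j\<le>k. of_nat (k choose j) * of_real t ^ (k - j) * (\<i> * of_real s) ^ j * of_real (moment j)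
      * zf x ^ k)"
  proof (rule sum.cong)
    fix j assume "j \<in> {..k}"
    then have "zf x ^ k = zf x ^ j * zf x ^ (k - j)" by (simp flip: power_add)
    then show "cyl_integral x (\<lambda>u. (of_nat (k choose j) * of_real s ^ j * (of_real t * zf x) ^ (k - j)) * zf u ^ j) =
      of_nat (k choose j) * of_real t ^ (k - j) * (\<i> * of_real s) ^ j * of_real (moment j) * zf x ^ k"
      unfolding cyl_integral_cmult cyl_integral_zf_power[OF x] by (simp add: power_mult_distrib)
  qed simp
  finally show ?thesis
    using t by (simp add: rim_average_eq[OF x t] zonal_expand s_def sum_distrib_right)
qed

text \<open>Write \<open>1 - w ^ k = k (1 - w) + R\<close>. Since the first moment vanishes,
  \<open>w\<close> has mean exactly \<open>t\<close>, so the linear term contributes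
  \<open>k * (1 - t)\<close>; the remainder contributes at most
  \<open>2 * k\<^sup>2 * (1 - t)\<close>. The constant 3 arises from
  \<open>k \<le> k\<^sup>2\<close>.\<close>

lemma norm_one_minus_zonal:
  assumes t: "0 \<le> t" "t \<le> 1"
  shows "cmod (1 - zonal k t) \<le> 3 * real k ^ 2 * (1 - t)"
proof -
  define w :: "'a \<Rightarrow> complex" where "w u = of_real t + \<i> * of_real (sqrt (1 - t\<^sup>2) * (u \<bullet> e2))" for u
  have [measurable]: "w \<in> borel_measurable borel" unfolding w_def by measurable
  have w: "cmod (w u) \<le> 1" "(cmod (1 - w u))\<^sup>2 \<le> 2 * (1 - t)" if "norm u \<le> 1" for u
    using norm_disc_point[OF t that] by (simp_all add: w_def)
  have "zonal 1 t = of_real t"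
    using cyl_volume_pos t moment_odd[of 1] cyl_integral_1[OF norm_e1] cyl_integral_of_real[of e1 "\<lambda>_. 1"]
    by (simp add: zonal_expand moment_def)
  moreover have "zonal 1 t = cyl_integral e1 w / of_real cyl_volume"
    by (simp only: zonal_def power_one_right w_def[abs_def])
  ultimately have w1: "cyl_integral e1 w = of_real t * of_real cyl_volume"
    using cyl_volume_pos by (simp add: field_simps)
  define R where "R u = 1 - w u ^ k - of_nat k * (1 - w u)" for u
  have [measurable]: "R \<in> borel_measurable borel" unfolding R_def by measurable
  have R: "cmod (R u) \<le> 2 * real k ^ 2 * (1 - t)" if "norm u \<le> 1" for u
    using norm_one_minus_power_taylor[OF w(1)[OF that], of k] mult_left_mono[OF w(2)[OF that], of "real k ^ 2"]
    by (simp add: R_def algebra_simps)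
  have int: "integrable lborel (\<lambda>z. indicator (tangent_cylinder e1) z *\<^sub>R R (tangent_dir e1 z))"
    "integrable lborel (\<lambda>z. indicator (tangent_cylinder e1) z *\<^sub>R w (tangent_dir e1 z))"
    "integrable lborel (\<lambda>z. indicator (tangent_cylinder e1) z *\<^sub>R (1::complex))"
    "integrable lborel (\<lambda>z. indicator (tangent_cylinder e1) z * (2 * real k ^ 2 * (1 - t)))"
    using cyl_integrable[OF norm_e1, of R "2 * real k ^ 2 * (1 - t)"] cyl_integrable[OF norm_e1, of w 1]
      cyl_integrable[OF norm_e1, of "\<lambda>_. 1 :: complex" 1]
      cyl_integrable[OF norm_e1, of "\<lambda>_. 2 * real k ^ 2 * (1 - t)" "2 * real k ^ 2 * (1 - t)"] R w(1) t
    by (simp_all del: mult_eq_0_iff)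
  have "w u ^ k = (1 - R u) - of_nat k * (1 - w u)" for u by (simp add: R_def)
  then have "cyl_integral e1 (\<lambda>u. w u ^ k) = cyl_integral e1 (\<lambda>_. 1) - cyl_integral e1 R
      - of_nat k * (cyl_integral e1 (\<lambda>_. 1) - cyl_integral e1 w)"
    using int(1-3) unfolding cyl_integral_def
    by (simp add: scaleR_diff_right Bochner_Integration.integral_diff integrable_diff
        mult_scaleR_right[symmetric] del: mult_scaleR_right)
  moreover have "cyl_integral e1 (\<lambda>u. w u ^ k) = zonal k t * of_real cyl_volume"
    using cyl_volume_pos unfolding zonal_def w_def[abs_def] by simp
  ultimately have "cyl_integral e1 R = (1 - zonal k t) * of_real cyl_volume
      - of_nat k * (1 - of_real t) * of_real cyl_volume"
    using cyl_integral_1[OF norm_e1] w1 by (simp add: algebra_simps)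
  moreover have "cmod (cyl_integral e1 R) \<le> 2 * real k ^ 2 * (1 - t) * cyl_volume"
  proof -
    have "cmod (cyl_integral e1 R) \<le> (LINT z|lborel. cmod (indicator (tangent_cylinder e1) z *\<^sub>R R (tangent_dir e1 z)))"
      unfolding cyl_integral_def by (rule integral_norm_bound)
    also have "\<dots> \<le> (LINT z|lborel. indicator (tangent_cylinder e1) z * (2 * real k ^ 2 * (1 - t)))"
    proof (rule integral_mono[OF integrable_norm[OF int(1)] int(4)])
      fix z show "cmod (indicator (tangent_cylinder e1) z *\<^sub>R R (tangent_dir e1 z)) \<le>
          indicator (tangent_cylinder e1) z * (2 * real k ^ 2 * (1 - t))"
        using R[OF norm_tangent_dir_le] by (simp add: indicator_def)
    qed
    finally show ?thesis by (simp add: cyl_volume_def mult.commute)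
  qed
  ultimately have "cmod (((1 - zonal k t) - of_nat k * (1 - of_real t)) * of_real cyl_volume)
      \<le> 2 * real k ^ 2 * (1 - t) * cyl_volume"
    by (simp add: left_diff_distrib)
  then have 1: "cmod ((1 - zonal k t) - of_nat k * (1 - of_real t)) \<le> 2 * real k ^ 2 * (1 - t)"
    using cyl_volume_pos by (simp add: norm_mult)
  have "cmod (of_nat k * (1 - of_real t)) = cmod (of_nat k) * cmod (of_real (1 - t))"
    by (simp add: norm_mult)
  also have "\<dots> = real k * (1 - t)"
    using t unfolding norm_of_real norm_of_nat by simp
  also have "\<dots> \<le> real k ^ 2 * (1 - t)"
    using t le_square[of k] by (intro mult_right_mono) (auto simp: power2_eq_square simp flip: of_nat_mult)
  finally show ?thesis
    using 1 norm_triangle_sub[of "1 - zonal k t" "of_nat k * (1 - of_real t)"] by linarith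
qed

text \<open>The quotient is a difference quotient of \<open>zonal_poly k\<close> at 1, and the
  complex derivative may be computed along real arguments approaching 1 from the left.\<close>

lemma zonal_tendsto:
  "((\<lambda>t. (1 - zonal k t) / of_real (1 - t)) \<longlongrightarrow> LB_eigenvalue k) (at_left 1)"
proof -
  have "(\<lambda>T::complex. if even j then (T\<^sup>2 - 1) ^ (j div 2) else 0) field_differentiable (at 1)" for j
    by (cases "even j") (auto intro!: derivative_intros)
  then have "(zonal_poly k) field_differentiable (at 1)"
    unfolding zonal_poly_def using cyl_volume_pos by (intro derivative_intros) auto
  then have "((\<lambda>T. (zonal_poly k T - zonal_poly k 1) / (T - 1)) \<longlongrightarrow> LB_eigenvalue k) (at 1)"
    unfolding LB_eigenvalue_def field_differentiable_derivI[unfolded has_field_derivative_iff]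
    using field_differentiable_derivI has_field_derivative_iff by blast
  moreover have "filterlim (of_real :: real \<Rightarrow> complex) (at 1) (at_left 1)"
    unfolding filterlim_at
    by (auto intro!: tendsto_eq_intros eventually_at_leftI[of 0])
  ultimately have "((\<lambda>t. (zonal_poly k (of_real t) - zonal_poly k 1) / (of_real t - 1)) \<longlongrightarrow> LB_eigenvalue k) (at_left (1::real))"
    by (rule filterlim_compose)
  then show ?thesis
  proof (rule Lim_transform_eventually)
    have 1: "zonal_poly k 1 = 1" using zonal_eq_poly[of 1 k] zonal_1 by simp
    have "(zonal_poly k (of_real t) - zonal_poly k 1) / (of_real t - 1) = (1 - zonal k t) / of_real (1 - t)"
      if "0 \<le> t" "t < 1" for t :: real
      unfolding 1 using zonal_eq_poly[of t k] that by (simp add: divide_simps) (simp add: algebra_simps)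
    then show "\<forall>\<^sub>F t in at_left 1. (zonal_poly k (of_real t) - zonal_poly k 1) / (of_real t - 1) =
        (1 - zonal k t) / of_real (1 - t)"
      by (intro eventually_at_leftI[of 0]) auto
  qed
qed

lemma zonal_quotient_bound:
  assumes "0 \<le> t" "t < 1"
  shows "cmod ((1 - zonal k t) / of_real (1 - t)) \<le> 3 * real k ^ 2"
  unfolding norm_divide norm_of_real
  using norm_one_minus_zonal[of t k] assms by (simp add: divide_le_eq)

lemma norm_LB_eigenvalue: "cmod (LB_eigenvalue k) \<le> 3 * real k ^ 2"
proof (rule tendsto_upperbound)
  show "((\<lambda>t. cmod ((1 - zonal k t) / of_real (1 - t))) \<longlongrightarrow> cmod (LB_eigenvalue k)) (at_left 1)"
    by (intro tendsto_norm zonal_tendsto)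
  show "\<forall>\<^sub>F t in at_left 1. cmod ((1 - zonal k t) / of_real (1 - t)) \<le> 3 * real k ^ 2"
    using zonal_quotient_bound by (intro eventually_at_leftI[of 0]) auto
qed simp

section \<open>Power series in the linear form and their derivatives\<close>

definition zf_series :: "(nat \<Rightarrow> complex) \<Rightarrow> 'a \<Rightarrow> complex" where
  "zf_series \<alpha> x = (\<Sum>k. \<alpha> k * zf x ^ k)"

lemma zf_series_measurable [measurable]: "zf_series \<alpha> \<in> borel_measurable borel"
  unfolding zf_series_def by measurable

lemma zf_series_term_le: "norm x \<le> 1 \<Longrightarrow> cmod (\<alpha> k * zf x ^ k) \<le> cmod (\<alpha> k)"
  using norm_zf_power[of x k] by (simp add: norm_mult mult_left_le)

lemma zf_series_summable_norm:
  assumes "summable (\<lambda>k. cmod (\<alpha> k))" "norm x \<le> 1"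
  shows "summable (\<lambda>k. cmod (\<alpha> k * zf x ^ k))"
  using assms zf_series_term_le by (intro summable_comparison_test'[OF assms(1), of 0]) auto

lemma norm_zf_series_le:
  assumes "summable (\<lambda>k. cmod (\<alpha> k))" "norm x \<le> 1"
  shows "cmod (zf_series \<alpha> x) \<le> (\<Sum>k. cmod (\<alpha> k))"
proof -
  have "cmod (zf_series \<alpha> x) \<le> (\<Sum>k. cmod (\<alpha> k * zf x ^ k))"
    unfolding zf_series_def by (rule summable_norm[OF zf_series_summable_norm[OF assms]])
  also have "\<dots> \<le> (\<Sum>k. cmod (\<alpha> k))"
    by (intro suminf_le zf_series_term_le zf_series_summable_norm assms)
  finally show ?thesis .
qed

lemma zf_series_in_L2:
  assumes "summable (\<lambda>k. cmod (\<alpha> k))"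
  shows "zf_series \<alpha> \<in> L2_sphere"
  using norm_zf_series_le[OF assms]
  by (intro bounded_in_L2_sphere[where B = "\<Sum>k. cmod (\<alpha> k)"] borel_measurable_sphere_measure
      zf_series_measurable) auto

text \<open>Rim points have norm 1, so the \<open>k\<close>-th term is dominated by
  \<open>cmod (\<alpha> k)\<close> on a cylinder of finite volume, which permits termwise
  integration.\<close>

lemma rim_average_zf_series:
  assumes \<alpha>: "summable (\<lambda>k. cmod (\<alpha> k))" and x: "norm x = 1" and t: "0 \<le> t" "t < 1"
  shows "(\<lambda>k. \<alpha> k * (zonal k t * zf x ^ k)) sums rim_average t (zf_series \<alpha>) x"
proof -
  define s where "s = sqrt (1 - t\<^sup>2)"
  define g where "g k z = indicator (tangent_cylinder x) z *\<^sub>R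
      (\<alpha> k * zf (t *\<^sub>R x + s *\<^sub>R tangent_dir x z) ^ k)" for k z
  have point: "norm (t *\<^sub>R x + s *\<^sub>R tangent_dir x z) \<le> 1" if "z \<in> tangent_cylinder x" for z
    using norm_rim_point[OF x, of t "tangent_dir x z"] that t x
    by (simp add: s_def norm_tangent_dir inner_tangent_dir)
  have g_le: "cmod (g k z) \<le> indicator (tangent_cylinder x) z * cmod (\<alpha> k)" for k z
    using zf_series_term_le[OF point] by (auto simp: g_def indicator_def)
  have [measurable]: "g k \<in> borel_measurable lborel" for k
    unfolding g_def by measurable
  have dom: "integrable lborel (\<lambda>z. indicator (tangent_cylinder x) z * c)" for c :: real
    using tangent_cylinder_finite[OF x] by (intro integrable_mult_left integrable_real_indicator) auto
  have int: "integrable lborel (g k)" for k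
    by (rule Bochner_Integration.integrable_bound[OF dom[of "cmod (\<alpha> k)"]]) (use g_le in auto)
  have "(\<lambda>k. integral\<^sup>L lborel (g k)) sums (LINT z|lborel. (\<Sum>k. g k z))"
  proof (rule sums_integral[OF int])
    show "AE z in lborel. summable (\<lambda>k. norm (g k z))"
    proof (rule AE_I2)
      fix z show "summable (\<lambda>k. norm (g k z))"
        by (rule summable_comparison_test'[OF summable_mult[OF \<alpha>], of 0]) (use g_le in auto)
    qed
    show "summable (\<lambda>k. LINT z|lborel. norm (g k z))"
    proof (rule summable_comparison_test')
      show "summable (\<lambda>k. measure lborel (tangent_cylinder x) * cmod (\<alpha> k))"
        by (rule summable_mult[OF \<alpha>])
      fix k
      have "(LINT z|lborel. norm (g k z)) \<le> (LINT z|lborel. indicator (tangent_cylinder x) z * cmod (\<alpha> k))"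
        by (intro integral_mono integrable_norm int dom g_le)
      then show "norm (LINT z|lborel. norm (g k z)) \<le> measure lborel (tangent_cylinder x) * cmod (\<alpha> k)"
        by simp
    qed
  qed
  moreover have "(\<Sum>k. g k z) = indicator (tangent_cylinder x) z *\<^sub>R
      zf_series \<alpha> (t *\<^sub>R x + s *\<^sub>R tangent_dir x z)" for z
    by (simp add: g_def zf_series_def indicator_def)
  moreover have "integral\<^sup>L lborel (g k) = \<alpha> k * (zonal k t * zf x ^ k) * of_real cyl_volume" for k
  proof -
    have "integral\<^sup>L lborel (g k) = \<alpha> k * cyl_integral x (\<lambda>u. zf (t *\<^sub>R x + s *\<^sub>R u) ^ k)"
      unfolding cyl_integral_cmult[symmetric] unfolding cyl_integral_def g_def[abs_def] by (rule refl)
    also have "cyl_integral x (\<lambda>u. zf (t *\<^sub>R x + s *\<^sub>R u) ^ k) = zonal k t * zf x ^ k * of_real cyl_volume"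
      using rim_average_zf_power[OF x t, of k] cyl_volume_pos
      by (simp add: rim_average_eq[OF x t] s_def divide_eq_eq)
    finally show ?thesis by simp
  qed
  ultimately have "(\<lambda>k. \<alpha> k * (zonal k t * zf x ^ k) * of_real cyl_volume) sums
      (rim_average t (zf_series \<alpha>) x * of_real cyl_volume)"
    using cyl_volume_pos by (simp add: rim_average_eq[OF x t] cyl_integral_def s_def)
  then show ?thesis
    using cyl_volume_pos by (subst (asm) sums_mult2_iff) auto
qed

lemma rapidly_decreasing_LB:
  "rapidly_decreasing \<alpha> \<Longrightarrow> rapidly_decreasing (\<lambda>k. \<alpha> k * LB_eigenvalue k)"
  using rapidly_decreasing_mult norm_LB_eigenvalue by blast

lemma zf_series_diff:
  assumes "summable (\<lambda>k. cmod (\<alpha> k))" "summable (\<lambda>k. cmod (\<beta> k))" "norm x \<le> 1"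
  shows "zf_series (\<lambda>k. \<alpha> k - \<beta> k) x = zf_series \<alpha> x - zf_series \<beta> x"
  unfolding zf_series_def left_diff_distrib
  by (intro suminf_diff[symmetric] summable_norm_cancel[OF zf_series_summable_norm] assms)

lemma rapidly_decreasing_quotient:
  assumes "rapidly_decreasing \<alpha>" "0 \<le> t" "t < 1"
  shows "rapidly_decreasing (\<lambda>k. \<alpha> k * ((1 - zonal k t) / of_real (1 - t)))"
  by (rule rapidly_decreasing_mult[OF assms(1)]) (rule zonal_quotient_bound[OF assms(2,3)])

lemma LB_quotient_zf_series:
  assumes \<alpha>: "rapidly_decreasing \<alpha>" and x: "norm x = 1" and t: "0 \<le> t" "t < 1"
  shows "(zf_series \<alpha> x - rim_average t (zf_series \<alpha>) x) / of_real (1 - t) =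
    zf_series (\<lambda>k. \<alpha> k * ((1 - zonal k t) / of_real (1 - t))) x"
proof -
  note sum = rapidly_decreasing_summable[OF \<alpha>]
  have "(\<lambda>k. (\<alpha> k * zf x ^ k - \<alpha> k * (zonal k t * zf x ^ k)) / of_real (1 - t)) sums
      ((zf_series \<alpha> x - rim_average t (zf_series \<alpha>) x) / of_real (1 - t))"
    unfolding zf_series_def[of _ x]
    using x by (intro sums_diff sums_divide rim_average_zf_series sum t
         summable_sums summable_norm_cancel[OF zf_series_summable_norm]) auto
  moreover have "(\<alpha> k * zf x ^ k - \<alpha> k * (zonal k t * zf x ^ k)) / of_real (1 - t) =
      \<alpha> k * ((1 - zonal k t) / of_real (1 - t)) * zf x ^ k" for k
    by (simp add: algebra_simps diff_divide_distrib)
  ultimately have "(\<lambda>k. \<alpha> k * ((1 - zonal k t) / of_real (1 - t)) * zf x ^ k) sums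
      ((zf_series \<alpha> x - rim_average t (zf_series \<alpha>) x) / of_real (1 - t))"
    by (simp only:)
  then show ?thesis
    unfolding zf_series_def[of _ x] by (rule sums_unique)
qed

text \<open>The error of the difference quotient is bounded uniformly on the sphere by
  \<open>E t\<close>, a series with terms \<open>cmod (\<alpha> k) * cmod (d k t)\<close>. Each term
  tends to 0, and the majorant \<open>D\<close>, whose constant is 3 + 3 from the quotient and its
  limit, allows Tannery's theorem to conclude.\<close>

lemma zf_series_has_LB_derivative:
  assumes \<alpha>: "rapidly_decreasing \<alpha>"
  shows "has_LB_derivative (zf_series \<alpha>) (zf_series (\<lambda>k. \<alpha> k * LB_eigenvalue k))"
proof -
  note sum = rapidly_decreasing_summable[OF \<alpha>] rapidly_decreasing_summable[OF rapidly_decreasing_LB[OF \<alpha>]]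
  define d where "d k t = (1 - zonal k t) / of_real (1 - t) - LB_eigenvalue k" for k t
  define E where "E t = (\<Sum>k. cmod (\<alpha> k) * cmod (d k t))" for t
  define D where "D k = 6 * (cmod (\<alpha> k) * real k ^ 2)" for k
  have D: "summable D"
    using \<alpha> unfolding D_def rapidly_decreasing_def by (intro summable_mult) blast
  have d_le: "cmod (\<alpha> k) * cmod (d k t) \<le> D k" if "0 \<le> t" "t < 1" for k t
  proof -
    have "cmod (d k t) \<le> 3 * real k ^ 2 + 3 * real k ^ 2"
      unfolding d_def by (intro norm_triangle_le_diff add_mono zonal_quotient_bound[OF that] norm_LB_eigenvalue)
    then show ?thesis using mult_left_mono[of "cmod (d k t)" "6 * real k ^ 2" "cmod (\<alpha> k)"] by (simp add: D_def)
  qed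
  have Esum: "summable (\<lambda>k. cmod (\<alpha> k) * cmod (d k t))" if "0 \<le> t" "t < 1" for t
    using d_le[OF that] by (intro summable_comparison_test'[OF D, of 0]) auto
  have "(E \<longlongrightarrow> (\<Sum>k. 0)) (at_left 1)"
    unfolding E_def
  proof (rule conjunct2[OF conjunct2[OF tannerys_theorem]])
    show "((\<lambda>t. cmod (\<alpha> k) * cmod (d k t)) \<longlongrightarrow> 0) (at_left 1)" for k
    proof -
      have "((\<lambda>t. d k t) \<longlongrightarrow> LB_eigenvalue k - LB_eigenvalue k) (at_left 1)"
        unfolding d_def by (intro tendsto_diff zonal_tendsto tendsto_const)
      then show ?thesis by (auto intro!: tendsto_eq_intros tendsto_norm_zero)
    qed
    have "\<forall>\<^sub>F t in at_left 1. (0::real) \<le> t \<and> t < 1"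
      by (intro eventually_at_leftI[of 0]) auto
    then show "\<forall>\<^sub>F (k, t) in at_top \<times>\<^sub>F at_left 1. norm (cmod (\<alpha> k) * cmod (d k t)) \<le> D k"
      using d_le unfolding eventually_prod_filter
      by (intro exI[of _ "\<lambda>_. True"] exI[of _ "\<lambda>t. 0 \<le> t \<and> t < 1"]) auto
  qed (use D in auto)
  then have E0: "(E \<longlongrightarrow> 0) (at_left 1)" by simp
  have bound: "sphere_norm (\<lambda>x. (zf_series \<alpha> x - rim_average t (zf_series \<alpha>) x) / of_real (1 - t)
      - zf_series (\<lambda>k. \<alpha> k * LB_eigenvalue k) x) \<le> E t" if t: "0 \<le> t" "t < 1" for t
  proof (rule sphere_norm_le)
    fix x :: 'a assume x: "norm x = 1"
    have s: "(zf_series \<alpha> x - rim_average t (zf_series \<alpha>) x) / of_real (1 - t)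
      - zf_series (\<lambda>k. \<alpha> k * LB_eigenvalue k) x = zf_series (\<lambda>k. \<alpha> k * d k t) x"
      unfolding LB_quotient_zf_series[OF \<alpha> x t] d_def right_diff_distrib
      using x by (intro zf_series_diff[symmetric] sum rapidly_decreasing_summable[OF rapidly_decreasing_quotient[OF \<alpha> t]]) simp
    show "cmod ((zf_series \<alpha> x - rim_average t (zf_series \<alpha>) x) / of_real (1 - t)
      - zf_series (\<lambda>k. \<alpha> k * LB_eigenvalue k) x) \<le> E t"
      unfolding s E_def norm_mult[symmetric]
      using x Esum[OF t] by (intro norm_zf_series_le) (auto simp: norm_mult)
  next
    show "0 \<le> E t" unfolding E_def by (intro suminf_nonneg Esum t) auto
  qed
  have nonneg: "0 \<le> sphere_norm f" for f :: "'a \<Rightarrow> complex"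
    by (rule sphere_norm_nonneg)
  have "((\<lambda>t. sphere_norm (\<lambda>x. (zf_series \<alpha> x - rim_average t (zf_series \<alpha>) x) / of_real (1 - t)
      - zf_series (\<lambda>k. \<alpha> k * LB_eigenvalue k) x)) \<longlongrightarrow> 0) (at_left 1)"
  proof (rule tendsto_sandwich[OF _ _ tendsto_const E0])
    show "\<forall>\<^sub>F t in at_left 1. sphere_norm (\<lambda>x. (zf_series \<alpha> x - rim_average t (zf_series \<alpha>) x) / of_real (1 - t)
      - zf_series (\<lambda>k. \<alpha> k * LB_eigenvalue k) x) \<le> E t"
      using bound by (intro eventually_at_leftI[of 0]) auto
  qed (simp add: nonneg)
  then show ?thesis
    unfolding has_LB_derivative_def by (intro conjI zf_series_in_L2 sum)
qed

end

section \<open>Rim averages and null sets\<close>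

lemma measure_sphere_pos: "0 < measure (sphere_measure :: 'a::euclidean_space measure) (sphere 0 1)"
proof -
  have "0 < emeasure (sphere_measure :: 'a measure) (sphere 0 1)"
    using content_cball_pos[of 1 "0::'a"]
    by (auto simp: emeasure_sphere_measure measure_def enn2real_positive_iff ennreal_zero_less_mult_iff)
  then show ?thesis
    using sphere.emeasure_finite[of "sphere 0 1 :: 'a set"]
    by (simp add: measure_def enn2real_positive_iff less_top[symmetric])
qed

lemma sphere_norm_sq:
  "measure (sphere_measure :: 'a::euclidean_space measure) (sphere 0 1) * (sphere_norm (f :: 'a \<Rightarrow> complex))\<^sup>2 =
    (LINT x|sphere_measure. (cmod (f x))\<^sup>2)"
proof -
  have "0 \<le> (LINT x|(sphere_measure :: 'a measure). (cmod (f x))\<^sup>2)" by (intro Bochner_Integration.integral_nonneg) simp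
  then show ?thesis
    using measure_sphere_pos[where 'a='a] by (simp add: sphere_norm_eq)
qed

lemma cmod_diff_sq_le: "(cmod (a - b))\<^sup>2 \<le> 2 * (cmod a)\<^sup>2 + 2 * (cmod b)\<^sup>2"
proof -
  have "(cmod (a - b))\<^sup>2 \<le> (cmod a + cmod b)\<^sup>2" by (intro power_mono norm_triangle_ineq4) auto
  also have "\<dots> \<le> 2 * (cmod a)\<^sup>2 + 2 * (cmod b)\<^sup>2"
    using zero_le_power2[of "cmod a - cmod b"] by (simp add: power2_eq_square algebra_simps)
  finally show ?thesis .
qed

lemma L2_diff:
  assumes "f \<in> L2 M" "g \<in> L2 M"
  shows "(\<lambda>x. f x - g x) \<in> L2 M"
proof -
  have [measurable]: "f \<in> borel_measurable M" "g \<in> borel_measurable M"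
    and int: "integrable M (\<lambda>x. (cmod (f x))\<^sup>2)" "integrable M (\<lambda>x. (cmod (g x))\<^sup>2)"
    using assms by (auto simp: L2_def)
  have "integrable M (\<lambda>x. (cmod (f x - g x))\<^sup>2)"
    by (rule Bochner_Integration.integrable_bound[of _ "\<lambda>x. 2 * (cmod (f x))\<^sup>2 + 2 * (cmod (g x))\<^sup>2"])
       (use int cmod_diff_sq_le in auto)
  then show ?thesis by (simp add: L2_def)
qed

text \<open>The solid cone \<open>S\<close> is convex, and the frontier of a convex set is null.
  Surface points are not interior: stepping from \<open>x\<close> by
  \<open>- \<delta> *\<^sub>R z\<close> lowers \<open>x \<bullet> z\<close> by
  \<open>\<delta> * (norm z)\<^sup>2\<close>, but lowers the other side by at most
  \<open>t < 1\<close> times that amount.\<close>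

lemma negligible_cone_surface:
  fixes z :: "'a::euclidean_space"
  assumes "z \<noteq> 0" "0 < t" "t < 1"
  shows "negligible {x. x \<bullet> z = t * norm x * norm z}"
proof (rule negligible_subset)
  define S where "S = {x. t * norm x * norm z \<le> x \<bullet> z}"
  have "convex S"
    unfolding convex_def
  proof (intro ballI allI impI)
    fix x y and u v :: real
    assume "x \<in> S" "y \<in> S" "0 \<le> u" "0 \<le> v" "u + v = 1"
    have "t * norm (u *\<^sub>R x + v *\<^sub>R y) * norm z \<le> t * (u * norm x + v * norm y) * norm z"
      using norm_triangle_ineq[of "u *\<^sub>R x" "v *\<^sub>R y"] \<open>0 \<le> u\<close> \<open>0 \<le> v\<close> assms
      by (intro mult_right_mono mult_left_mono) auto
    also have "\<dots> = u * (t * norm x * norm z) + v * (t * norm y * norm z)" by (simp add: algebra_simps)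
    also have "\<dots> \<le> u * (x \<bullet> z) + v * (y \<bullet> z)"
      using \<open>x \<in> S\<close> \<open>y \<in> S\<close> \<open>0 \<le> u\<close> \<open>0 \<le> v\<close> by (intro add_mono mult_left_mono) (auto simp: S_def)
    finally show "u *\<^sub>R x + v *\<^sub>R y \<in> S" by (simp add: S_def inner_add_left)
  qed
  then show "negligible (frontier S)" by (rule negligible_convex_frontier)
  show "{x. x \<bullet> z = t * norm x * norm z} \<subseteq> frontier S"
  proof safe
    fix x assume x: "x \<bullet> z = t * norm x * norm z"
    have "x \<notin> interior S"
    proof
      assume "x \<in> interior S"
      then obtain e where e: "e > 0" "cball x e \<subseteq> S" by (auto simp: mem_interior_cball)
      define \<delta> where "\<delta> = e / norm z"
      have \<delta>: "\<delta> > 0" "norm (\<delta> *\<^sub>R z) = e" using e assms by (auto simp: \<delta>_def)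
      then have "x - \<delta> *\<^sub>R z \<in> S" using e by (intro subsetD[OF e(2)]) (simp add: dist_norm)
      then have "t * norm (x - \<delta> *\<^sub>R z) * norm z \<le> t * norm x * norm z - \<delta> * (norm z * norm z)"
        by (simp add: S_def inner_diff_left x power2_norm_eq_inner[symmetric] power2_eq_square)
      moreover have "t * (norm x - \<delta> * norm z) * norm z \<le> t * norm (x - \<delta> *\<^sub>R z) * norm z"
        using norm_triangle_ineq2[of x "\<delta> *\<^sub>R z"] assms \<delta> by (intro mult_right_mono mult_left_mono) auto
      ultimately have "\<delta> * (norm z * norm z) \<le> t * (\<delta> * (norm z * norm z))"
        by (simp add: algebra_simps)
      moreover have "t * (\<delta> * (norm z * norm z)) < 1 * (\<delta> * (norm z * norm z))"
        using assms \<delta> by (intro mult_strict_right_mono) auto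
      ultimately show False by simp
    qed
    moreover have "x \<in> closure S" using x by (intro subsetD[OF closure_subset]) (simp add: S_def)
    ultimately show "x \<in> frontier S" by (simp add: frontier_def)
  qed
qed

lemma differentiable_norm_comp:
  fixes q :: "'a::euclidean_space \<Rightarrow> 'a"
  assumes "q differentiable (at y)" "q y \<noteq> 0"
  shows "(\<lambda>y. norm (q y)) differentiable (at y)"
  using differentiable_chain_at[OF assms(1) differentiable_norm_at[OF assms(2)]] by (simp add: o_def)

text \<open>
  For fixed \<open>z\<close> the map taking \<open>x\<close> to the point of its rim in the direction of \<open>z\<close> rotates \<open>x\<close>
  by a fixed angle towards \<open>z\<close>. Outside a cone it is inverted by one of two differentiable maps,
  the rotations towards \<open>z\<close> and away from \<open>z\<close>, so that preimages of null sets are null sets.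
\<close>

lemma negligible_rotated_preimage:
  fixes N :: "'a::euclidean_space set" and z :: 'a
  assumes t: "0 < t" "t < 1" and N: "negligible {y. y \<noteq> 0 \<and> norm y \<le> 1 \<and> y /\<^sub>R norm y \<in> N}"
  shows "negligible {x. x \<noteq> 0 \<and> norm x \<le> 1 \<and> tangent_part (x /\<^sub>R norm x) z \<noteq> 0 \<and>
    t *\<^sub>R (x /\<^sub>R norm x) + sqrt (1 - t\<^sup>2) *\<^sub>R tangent_dir (x /\<^sub>R norm x) z \<in> N}"
    (is "negligible ?B")
proof (cases "z = 0")
  case True
  then have "?B = {}" by (auto simp: tangent_part_def)
  then show ?thesis by (simp only: negligible_empty)
next
  case z: False
  define s where "s = sqrt (1 - t\<^sup>2)"
  have "t\<^sup>2 < 1" using t by (simp add: abs_square_less_1)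
  then have s: "0 < s" "t * t + s * s = 1" by (auto simp: s_def power2_eq_square)
  \<comment> \<open>This is \<open>(norm y)\<^sup>2\<close> times the tangent part of
    \<open>z\<close> at the direction of \<open>y\<close>, written without division to be polynomial
    in \<open>y\<close>. The map \<open>g \<sigma>\<close> turns \<open>y\<close> by the angle with
    cosine \<open>t\<close>, towards \<open>z\<close> for \<open>\<sigma> = 1\<close> and away from
    it for \<open>\<sigma> = -1\<close>.\<close>
  define q where "q y = (y \<bullet> y) *\<^sub>R z - (y \<bullet> z) *\<^sub>R y" for y
  define g where "g \<sigma> y = t *\<^sub>R y + (\<sigma> * s * norm y / norm (q y)) *\<^sub>R q y" for \<sigma> :: real and y
  define C where "C = {y. y \<noteq> 0 \<and> norm y \<le> 1 \<and> y /\<^sub>R norm y \<in> N \<and> q y \<noteq> 0}"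
  have "negligible C" by (rule negligible_subset[OF N]) (auto simp: C_def)
  have neg: "negligible (g \<sigma> ` C)" for \<sigma>
  proof (rule negligible_differentiable_image_negligible[OF order_refl \<open>negligible C\<close>])
    have "g \<sigma> differentiable (at y)" if "y \<in> C" for y
    proof -
      have "q differentiable (at y)"
        unfolding q_def by (intro differentiable_diff differentiable_scaleR differentiable_inner
            differentiable_ident differentiable_const)
      moreover have "y \<noteq> 0" "q y \<noteq> 0" using that by (auto simp: C_def)
      ultimately show ?thesis
        unfolding g_def using differentiable_norm_comp[of q y] differentiable_norm_at[of y]
        by (intro differentiable_add differentiable_scaleR differentiable_mult differentiable_divide
            differentiable_ident differentiable_const) auto
    qed
    then show "g \<sigma> differentiable_on C"
      by (auto simp: differentiable_on_def intro: differentiable_at_withinI)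
  qed
  have "?B \<subseteq> g 1 ` C \<union> g (-1) ` C \<union> {x. x \<bullet> z = t * norm x * norm z}"
  proof
    fix x assume "x \<in> ?B"
    then have x: "x \<noteq> 0" "norm x \<le> 1" "tangent_part (x /\<^sub>R norm x) z \<noteq> 0"
      "t *\<^sub>R (x /\<^sub>R norm x) + s *\<^sub>R tangent_dir (x /\<^sub>R norm x) z \<in> N"
      by (auto simp: s_def)
    define h where "h = x /\<^sub>R norm x"
    have h: "norm h = 1" "x = norm x *\<^sub>R h" using x by (simp_all add: h_def)
    define u where "u = tangent_dir h z"
    define \<beta> where "\<beta> = norm (tangent_part h z)"
    define \<alpha> where "\<alpha> = h \<bullet> z"
    have \<beta>: "\<beta> > 0" using x by (simp add: \<beta>_def h_def)
    have u: "norm u = 1" "h \<bullet> u = 0" using \<beta> inner_tangent_dir[OF h(1), of z]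
      by (auto simp add: u_def tangent_dir_def \<beta>_def)
    have zz: "z = \<alpha> *\<^sub>R h + \<beta> *\<^sub>R u" using \<beta> by (simp add: \<alpha>_def u_def tangent_dir_def \<beta>_def tangent_part_def)
    have in1: "h \<bullet> h = 1" "u \<bullet> u = 1" "u \<bullet> h = 0" using h(1) u by (simp_all add: norm_eq_1 inner_commute)
    \<comment> \<open>The vectors \<open>y'\<close> and \<open>w\<close> form another orthonormal
      basis of the plane of \<open>h\<close> and \<open>u\<close>: \<open>y'\<close> is the rotated
      point, and \<open>w\<close> is the direction in which to turn back to
      \<open>h\<close>.\<close>
    define y' where "y' = t *\<^sub>R h + s *\<^sub>R u"
    define w where "w = s *\<^sub>R h - t *\<^sub>R u"
    have y'w: "y' \<bullet> y' = 1" "w \<bullet> w = 1" "y' \<bullet> w = 0"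
      using s(2) by (simp_all add: y'_def w_def inner_add_left inner_add_right inner_diff_left inner_diff_right in1 u)
    have hu: "h = t *\<^sub>R y' + s *\<^sub>R w" "u = s *\<^sub>R y' - t *\<^sub>R w"
    proof -
      have "t *\<^sub>R y' + s *\<^sub>R w = (t * t + s * s) *\<^sub>R h" by (simp add: y'_def w_def algebra_simps)
      then show "h = t *\<^sub>R y' + s *\<^sub>R w" using s(2) by simp
      have "s *\<^sub>R y' - t *\<^sub>R w = (t * t + s * s) *\<^sub>R u" by (simp add: y'_def w_def algebra_simps)
      then show "u = s *\<^sub>R y' - t *\<^sub>R w" using s(2) by simp
    qed
    \<comment> \<open>The component of \<open>z\<close> along \<open>w\<close>. If it is positive,
      the rotation went past \<open>z\<close> and turning towards \<open>z\<close> leads back; if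
      negative, turning away from \<open>z\<close> does. If it is zero, \<open>y'\<close> is a
      positive multiple of \<open>z\<close>, and \<open>x\<close> lies on the exceptional
      cone.\<close>
    define b where "b = \<alpha> * s - \<beta> * t"
    have zb: "z = (\<alpha> * t + \<beta> * s) *\<^sub>R y' + b *\<^sub>R w"
      by (subst zz, subst hu(1), subst hu(2)) (simp add: b_def algebra_simps)
    define y where "y = norm x *\<^sub>R y'"
    have ny: "norm y' = 1" "norm y = norm x" using y'w by (simp_all add: norm_eq_1 y_def)
    have yN: "y \<noteq> 0" "norm y \<le> 1" "y /\<^sub>R norm y \<in> N"
    proof -
      show "y \<noteq> 0" "norm y \<le> 1" using x ny by (metis norm_eq_zero) (use x ny in simp)
      have "y /\<^sub>R norm y = y'" using x ny by (simp add: y_def)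
      then show "y /\<^sub>R norm y \<in> N" using x(4) by (simp add: y'_def u_def h_def)
    qed
    have "y' \<bullet> z = \<alpha> * t + \<beta> * s" by (subst zb) (simp add: inner_add_right y'w)
    then have "z - (y' \<bullet> z) *\<^sub>R y' = b *\<^sub>R w" by (subst zb) simp
    moreover have "q y = (norm x)\<^sup>2 *\<^sub>R (z - (y' \<bullet> z) *\<^sub>R y')"
      by (simp add: q_def y_def y'w power2_eq_square algebra_simps)
    ultimately have qy: "q y = ((norm x)\<^sup>2 * b) *\<^sub>R w" by simp
    have nw: "norm w = 1" using y'w by (simp add: norm_eq_1)
    show "x \<in> g 1 ` C \<union> g (-1) ` C \<union> {x. x \<bullet> z = t * norm x * norm z}"
    proof (cases "b = 0")
      case True
      then have "\<alpha> * s = \<beta> * t" by (simp add: b_def)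
      then have \<alpha>: "\<alpha> = \<beta> * t / s" using s(1) by (simp add: field_simps)
      have "norm z = norm (\<beta> *\<^sub>R ((t / s) *\<^sub>R h + u))" by (subst zz) (simp add: \<alpha> algebra_simps)
      also have "(t / s) *\<^sub>R h + u = (1 / s) *\<^sub>R y'" using s(1) by (simp add: y'_def algebra_simps)
      finally have "norm z = \<beta> / s" using \<beta> s ny by simp
      then have "h \<bullet> z = t * norm z" using \<alpha> by (simp add: \<alpha>_def)
      then have "x \<bullet> z = t * norm x * norm z" by (subst h(2)) simp
      then show ?thesis by simp
    next
      case False
      have "q y \<noteq> 0" using False x nw by (auto simp: qy)
      then have "y \<in> C" using yN by (simp add: C_def)
      have "g (sgn b) y = t *\<^sub>R y + (sgn b * s * norm x / ((norm x)\<^sup>2 * \<bar>b\<bar>) * ((norm x)\<^sup>2 * b)) *\<^sub>R w"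
        by (simp add: g_def qy nw ny abs_mult)
      also have "sgn b * s * norm x / ((norm x)\<^sup>2 * \<bar>b\<bar>) * ((norm x)\<^sup>2 * b) = s * norm x"
        using False x by (simp add: sgn_if abs_if)
      also have "t *\<^sub>R y + (s * norm x) *\<^sub>R w = norm x *\<^sub>R h"
        by (subst hu(1)) (simp add: y_def algebra_simps)
      finally have "x = g (sgn b) y" using h(2) by simp
      moreover have "sgn b = 1 \<or> sgn b = -1" using False by (simp add: sgn_if)
      ultimately show ?thesis using \<open>y \<in> C\<close> by auto
    qed
  qed
  then show ?thesis
    by (rule negligible_subset[rotated]) (intro negligible_Un neg negligible_cone_surface z t)
qed

text \<open>Passing to the cone over \<open>N\<close> makes the theory of Lebesgue null sets under
  differentiable maps applicable to the sphere.\<close>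

lemma null_sets_sphere_cone:
  fixes N :: "'a::euclidean_space set"
  assumes "N \<in> null_sets sphere_measure"
  shows "N \<in> sets borel" "negligible {y. y \<noteq> 0 \<and> norm y \<le> 1 \<and> y /\<^sub>R norm y \<in> N}"
proof -
  have "N \<in> sets (restrict_space borel (sphere 0 1))" using assms by (auto simp: null_sets_def)
  then show [measurable]: "N \<in> sets borel"
    by (subst (asm) sets_restrict_space_iff) auto
  have [measurable]: "{y. y \<noteq> 0 \<and> norm y \<le> 1 \<and> y /\<^sub>R norm y \<in> N} \<in> sets borel" by measurable
  have "0 = (\<integral>\<^sup>+x. indicator N x \<partial>(sphere_measure :: 'a measure))"
    using assms by (subst nn_integral_indicator) auto
  also have "\<dots> = of_nat DIM('a) * (\<integral>\<^sup>+x. indicator (cball 0 1 - {0}) x * indicator N (x /\<^sub>R norm x) \<partial>lborel)"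
    unfolding sphere_measure_def by (rule nn_integral_cone_measure) auto
  also have "(\<integral>\<^sup>+x. indicator (cball 0 1 - {0}) x * indicator N (x /\<^sub>R norm x) \<partial>lborel) =
      (\<integral>\<^sup>+x. indicator {y. y \<noteq> 0 \<and> norm y \<le> 1 \<and> y /\<^sub>R norm y \<in> N} x \<partial>lborel)"
    by (intro nn_integral_cong) (auto simp: indicator_def)
  also have "\<dots> = emeasure lborel {y. y \<noteq> 0 \<and> norm y \<le> 1 \<and> y /\<^sub>R norm y \<in> N}"
    by (rule nn_integral_indicator) measurable
  finally have "{y. y \<noteq> 0 \<and> norm y \<le> 1 \<and> y /\<^sub>R norm y \<in> N} \<in> null_sets lborel"
    by (auto simp: null_sets_def)
  then show "negligible {y. y \<noteq> 0 \<and> norm y \<le> 1 \<and> y /\<^sub>R norm y \<in> N}"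
    by (simp add: negligible_iff_null_sets null_sets_completionI)
qed

text \<open>The set \<open>N\<close> may contain entire rims, so the claim can hold only for almost
  every centre. After exchanging the integrals, \<open>z\<close> is fixed and \<open>x\<close> runs
  over a rotated preimage of \<open>N\<close>, which is null.\<close>

lemma AE_rim_not_in_null_set:
  fixes N :: "'a::euclidean_space set"
  assumes t: "0 < t" "t < 1" and N: "N \<in> null_sets sphere_measure"
  shows "AE x in sphere_measure. AE z in lborel.
    z \<in> tangent_cylinder x \<longrightarrow> t *\<^sub>R x + sqrt (1 - t\<^sup>2) *\<^sub>R tangent_dir x z \<notin> N"
proof -
  note [measurable] = null_sets_sphere_cone(1)[OF N]
  define F :: "'a \<Rightarrow> 'a \<Rightarrow> ennreal" where
    "F x z = indicator {z. z \<in> tangent_cylinder x \<and> t *\<^sub>R x + sqrt (1 - t\<^sup>2) *\<^sub>R tangent_dir x z \<in> N} z" for x z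
  have [measurable]: "(\<lambda>w. F (f w) (g w)) \<in> borel_measurable M"
    if [measurable]: "f \<in> borel_measurable M" "g \<in> borel_measurable M" for f g and M :: "'b measure"
    unfolding F_def indicator_def mem_Collect_eq by measurable
  have F_meas: "(\<lambda>x. \<integral>\<^sup>+z. F x z \<partial>lborel) \<in> borel_measurable borel" by measurable
  have "(\<integral>\<^sup>+x. (\<integral>\<^sup>+z. F x z \<partial>lborel) \<partial>sphere_measure) =
    of_nat DIM('a) * (\<integral>\<^sup>+x. indicator (cball 0 1 - {0}) x * (\<integral>\<^sup>+z. F (x /\<^sub>R norm x) z \<partial>lborel) \<partial>lborel)"
    unfolding sphere_measure_def by (rule nn_integral_cone_measure) (use F_meas in auto)
  also have "(\<integral>\<^sup>+x. indicator (cball 0 1 - {0}) x * (\<integral>\<^sup>+z. F (x /\<^sub>R norm x) z \<partial>lborel) \<partial>lborel) =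
    (\<integral>\<^sup>+x. (\<integral>\<^sup>+z. indicator (cball 0 1 - {0}) x * F (x /\<^sub>R norm x) z \<partial>lborel) \<partial>lborel)"
    by (intro nn_integral_cong nn_integral_cmult[symmetric]) measurable
  also have "\<dots> = (\<integral>\<^sup>+z. (\<integral>\<^sup>+x. indicator (cball 0 1 - {0}) x * F (x /\<^sub>R norm x) z \<partial>lborel) \<partial>lborel)"
    by (rule lborel_pair.Fubini') measurable
  also have "\<dots> = (\<integral>\<^sup>+(z::'a). 0 \<partial>lborel)"
  proof (rule nn_integral_cong)
    fix z :: 'a
    let ?B = "{x. x \<noteq> 0 \<and> norm x \<le> 1 \<and> tangent_part (x /\<^sub>R norm x) z \<noteq> 0 \<and>
      t *\<^sub>R (x /\<^sub>R norm x) + sqrt (1 - t\<^sup>2) *\<^sub>R tangent_dir (x /\<^sub>R norm x) z \<in> N}"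
    have B: "?B \<in> sets borel" by measurable
    moreover have "negligible ?B"
      by (rule negligible_rotated_preimage[OF t null_sets_sphere_cone(2)[OF N]])
    ultimately have "?B \<in> null_sets lborel"
      by (simp add: negligible_iff_null_sets null_sets_completion_iff)
    have "(\<integral>\<^sup>+x. indicator (cball 0 1 - {0}) x * F (x /\<^sub>R norm x) z \<partial>lborel) \<le> (\<integral>\<^sup>+x. indicator ?B x \<partial>lborel)"
      by (intro nn_integral_mono) (auto simp: F_def indicator_def tangent_cylinder_def)
    also have "\<dots> = 0" using B \<open>?B \<in> null_sets lborel\<close> by (subst nn_integral_indicator) auto
    finally show "(\<integral>\<^sup>+x. indicator (cball 0 1 - {0}) x * F (x /\<^sub>R norm x) z \<partial>lborel) = 0" by simp
  qed
  finally have "(\<integral>\<^sup>+x. (\<integral>\<^sup>+z. F x z \<partial>lborel) \<partial>sphere_measure) = 0" by simp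
  then have "AE x in sphere_measure. (\<integral>\<^sup>+z. F x z \<partial>lborel) = 0"
    using nn_integral_0_iff_AE[OF borel_measurable_sphere_measure[OF F_meas]] by simp
  then show ?thesis
  proof eventually_elim
    fix x :: 'a assume "(\<integral>\<^sup>+z. F x z \<partial>lborel) = 0"
    then have "AE z in lborel. F x z = 0" by (subst (asm) nn_integral_0_iff_AE) auto
    then show "AE z in lborel. z \<in> tangent_cylinder x \<longrightarrow>
        t *\<^sub>R x + sqrt (1 - t\<^sup>2) *\<^sub>R tangent_dir x z \<notin> N"
      by (rule AE_mp) (auto simp: F_def indicator_def)
  qed
qed

text \<open>Square-integrable functions are measurable only on the sphere, whereas the integral
  formulas above take Borel functions on the whole space. Rims lie on the sphere, so averages are
  unaffected by the extension.\<close>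

definition zero_extend :: "('a::euclidean_space \<Rightarrow> complex) \<Rightarrow> 'a \<Rightarrow> complex" where
  "zero_extend f y = (if norm y = 1 then f y else 0)"

lemma zero_extend_measurable:
  fixes f :: "'a::euclidean_space \<Rightarrow> complex"
  assumes "f \<in> borel_measurable sphere_measure"
  shows "zero_extend f \<in> borel_measurable borel"
proof -
  have "f \<in> borel_measurable (restrict_space borel (sphere 0 1))"
    using assms measurable_cong_sets[OF sets_sphere_measure refl] by blast
  then have "(\<lambda>x. indicator (sphere 0 1) x *\<^sub>R f x) \<in> borel_measurable borel"
    by (subst borel_measurable_restrict_space_iff[symmetric]) auto
  moreover have "zero_extend f = (\<lambda>x. indicator (sphere 0 1) x *\<^sub>R f x)"
    by (auto simp: zero_extend_def indicator_def)
  ultimately show ?thesis by simp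
qed

lemma rim_average_zero_extend: "rim_average t (zero_extend f) x = rim_average t f x"
proof -
  have "(LINT y|rim_measure x t. zero_extend f y) = (LINT y|rim_measure x t. f y)"
    by (intro Bochner_Integration.integral_cong)
       (auto simp: rim_measure_def space_restrict_space rim_def zero_extend_def)
  then show ?thesis by (simp add: rim_average_def)
qed

section \<open>Uniqueness of iterated derivatives almost everywhere\<close>

context frame
begin

lemma rim_average_cong_AE:
  fixes f g :: "'a \<Rightarrow> complex"
  assumes t: "0 < t" "t < 1"
    and f: "f \<in> borel_measurable sphere_measure" and g: "g \<in> borel_measurable sphere_measure"
    and eq: "AE y in sphere_measure. f y = g y"
  shows "AE x in sphere_measure. rim_average t f x = rim_average t g x"
proof -
  define N where "N = {y \<in> space sphere_measure. f y \<noteq> g y}"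
  have [measurable]: "zero_extend f \<in> borel_measurable borel" "zero_extend g \<in> borel_measurable borel"
    using f g by (auto intro: zero_extend_measurable)
  have "N \<in> sets sphere_measure" unfolding N_def using f g by measurable
  then have N: "N \<in> null_sets sphere_measure"
    using eq by (simp add: AE_iff_null N_def)
  have zN: "zero_extend f y = zero_extend g y" if "y \<notin> N" for y
    using that by (auto simp: zero_extend_def N_def)
  show ?thesis
    using AE_rim_not_in_null_set[OF t N] AE_space
  proof eventually_elim
    fix x :: 'a
    assume AE: "AE z in lborel. z \<in> tangent_cylinder x \<longrightarrow> t *\<^sub>R x + sqrt (1 - t\<^sup>2) *\<^sub>R tangent_dir x z \<notin> N"
      and "x \<in> space sphere_measure"
    then have x: "norm x = 1" by simp
    have "cyl_integral x (\<lambda>u. zero_extend f (t *\<^sub>R x + sqrt (1 - t\<^sup>2) *\<^sub>R u)) =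
        cyl_integral x (\<lambda>u. zero_extend g (t *\<^sub>R x + sqrt (1 - t\<^sup>2) *\<^sub>R u))"
      unfolding cyl_integral_def
    proof (rule integral_cong_AE)
      show "AE z in lborel. indicator (tangent_cylinder x) z *\<^sub>R zero_extend f (t *\<^sub>R x + sqrt (1 - t\<^sup>2) *\<^sub>R tangent_dir x z) =
         indicator (tangent_cylinder x) z *\<^sub>R zero_extend g (t *\<^sub>R x + sqrt (1 - t\<^sup>2) *\<^sub>R tangent_dir x z)"
        using AE by eventually_elim (auto simp: indicator_def zN)
    qed measurable
    then show "rim_average t f x = rim_average t g x"
      using t by (simp add: rim_average_zero_extend[of t f, symmetric] rim_average_zero_extend[of t g, symmetric]
          rim_average_eq[OF x])
  qed
qed

lemma rim_average_measurable:
  fixes f :: "'a \<Rightarrow> complex"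
  assumes t: "0 \<le> t" "t < 1" and f: "f \<in> borel_measurable sphere_measure"
  shows "rim_average t f \<in> borel_measurable sphere_measure"
proof -
  have [measurable]: "zero_extend f \<in> borel_measurable borel"
    using f by (rule zero_extend_measurable)
  have "(\<lambda>x. cyl_integral x (\<lambda>u. zero_extend f (t *\<^sub>R x + sqrt (1 - t\<^sup>2) *\<^sub>R u)) / of_real cyl_volume)
      \<in> borel_measurable borel"
    unfolding cyl_integral_def indicator_def by measurable
  then have "(\<lambda>x. cyl_integral x (\<lambda>u. zero_extend f (t *\<^sub>R x + sqrt (1 - t\<^sup>2) *\<^sub>R u)) / of_real cyl_volume)
      \<in> borel_measurable sphere_measure"
    by (rule borel_measurable_sphere_measure)
  moreover have "rim_average t f x =
      cyl_integral x (\<lambda>u. zero_extend f (t *\<^sub>R x + sqrt (1 - t\<^sup>2) *\<^sub>R u)) / of_real cyl_volume"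
    if "x \<in> space sphere_measure" for x
    using that by (subst rim_average_zero_extend[symmetric], subst rim_average_eq[OF _ t]) auto
  ultimately show ?thesis by (subst measurable_cong) auto
qed

text \<open>Here \<open>f\<close> is any representative, such as an intermediate function of an
  iterated derivative. Its difference quotient \<open>P' t\<close> agrees almost everywhere with the
  quotient \<open>P t\<close> of the series, and two limits of the same quotients in the
  square-integral norm coincide. The triangle inequality is used in squared form, with factor
  2.\<close>

lemma LB_derivative_unique:
  fixes f g :: "'a \<Rightarrow> complex"
  assumes \<alpha>: "rapidly_decreasing \<alpha>" and eq: "AE x in sphere_measure. f x = zf_series \<alpha> x"
    and fg: "has_LB_derivative f g"
  shows "AE x in sphere_measure. g x = zf_series (\<lambda>k. \<alpha> k * LB_eigenvalue k) x"
proof -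
  let ?M = "sphere_measure :: 'a measure"
  define h where "h = zf_series (\<lambda>k. \<alpha> k * LB_eigenvalue k)"
  define \<omega> where "\<omega> = measure ?M (sphere 0 1)"
  define P where "P t x = (zf_series \<alpha> x - rim_average t (zf_series \<alpha>) x) / of_real (1 - t)" for t x
  define P' where "P' t x = (f x - rim_average t f x) / of_real (1 - t)" for t x
  have f: "f \<in> L2_sphere" and g: "g \<in> L2_sphere"
    and lim': "((\<lambda>t. sphere_norm (\<lambda>x. P' t x - g x)) \<longlongrightarrow> 0) (at_left 1)"
    using fg by (auto simp: has_LB_derivative_def P'_def)
  have h: "h \<in> L2_sphere"
    and lim: "((\<lambda>t. sphere_norm (\<lambda>x. P t x - h x)) \<longlongrightarrow> 0) (at_left 1)"
    using zf_series_has_LB_derivative[OF \<alpha>] by (auto simp: has_LB_derivative_def P_def h_def)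
  have [measurable]: "f \<in> borel_measurable ?M" "g \<in> borel_measurable ?M" "h \<in> borel_measurable ?M"
    "zf_series \<alpha> \<in> borel_measurable ?M"
    using f g h by (auto simp: L2_def intro!: borel_measurable_sphere_measure)
  have bound: "(LINT x|?M. (cmod (h x - g x))\<^sup>2) \<le>
      2 * (\<omega> * (sphere_norm (\<lambda>x. P t x - h x))\<^sup>2) + 2 * (\<omega> * (sphere_norm (\<lambda>x. P' t x - g x))\<^sup>2)"
    if t: "0 < t" "t < 1" for t
  proof -
    have t0: "0 \<le> t" using t by simp
    have [measurable]: "rim_average t f \<in> borel_measurable ?M" "rim_average t (zf_series \<alpha>) \<in> borel_measurable ?M"
      using t by (auto intro!: rim_average_measurable)
    have Pm [measurable]: "P t \<in> borel_measurable ?M" "P' t \<in> borel_measurable ?M"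
      unfolding P_def P'_def by measurable
    have "P t \<in> L2_sphere"
    proof (rule bounded_in_L2_sphere[OF Pm(1)])
      fix x :: 'a assume x: "norm x = 1"
      show "cmod (P t x) \<le> (\<Sum>k. cmod (\<alpha> k * ((1 - zonal k t) / of_real (1 - t))))"
        unfolding P_def LB_quotient_zf_series[OF \<alpha> x t0 t(2)] using x
        by (intro norm_zf_series_le rapidly_decreasing_summable[OF rapidly_decreasing_quotient[OF \<alpha> t0 t(2)]]) simp
    qed
    have eqP: "AE x in ?M. P' t x = P t x"
      using eq rim_average_cong_AE[OF t _ _ eq, simplified]
      by eventually_elim (simp add: P_def P'_def)
    have "(LINT x|?M. (cmod (h x - g x))\<^sup>2) \<le> (LINT x|?M. 2 * (cmod (P t x - h x))\<^sup>2 + 2 * (cmod (P t x - g x))\<^sup>2)"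
    proof (rule integral_mono)
      show "integrable ?M (\<lambda>x. (cmod (h x - g x))\<^sup>2)"
        using L2_diff[OF h g] by (simp add: L2_def)
      show "integrable ?M (\<lambda>x. 2 * (cmod (P t x - h x))\<^sup>2 + 2 * (cmod (P t x - g x))\<^sup>2)"
        using L2_diff[OF \<open>P t \<in> L2_sphere\<close> h] L2_diff[OF \<open>P t \<in> L2_sphere\<close> g] by (simp add: L2_def)
      show "(cmod (h x - g x))\<^sup>2 \<le> 2 * (cmod (P t x - h x))\<^sup>2 + 2 * (cmod (P t x - g x))\<^sup>2" for x
        using cmod_diff_sq_le[of "P t x - g x" "P t x - h x"] by simp
    qed
    also have "\<dots> = 2 * (LINT x|?M. (cmod (P t x - h x))\<^sup>2) + 2 * (LINT x|?M. (cmod (P t x - g x))\<^sup>2)"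
      using L2_diff[OF \<open>P t \<in> L2_sphere\<close> h] L2_diff[OF \<open>P t \<in> L2_sphere\<close> g]
      by (subst Bochner_Integration.integral_add) (auto simp: L2_def)
    also have "(LINT x|?M. (cmod (P t x - g x))\<^sup>2) = (LINT x|?M. (cmod (P' t x - g x))\<^sup>2)"
      by (rule integral_cong_AE) (use eqP in auto)
    finally show ?thesis unfolding \<omega>_def sphere_norm_sq .
  qed
  have "((\<lambda>t. 2 * (\<omega> * (sphere_norm (\<lambda>x. P t x - h x))\<^sup>2) + 2 * (\<omega> * (sphere_norm (\<lambda>x. P' t x - g x))\<^sup>2))
     \<longlongrightarrow> 2 * (\<omega> * 0\<^sup>2) + 2 * (\<omega> * 0\<^sup>2)) (at_left 1)"
    by (intro tendsto_intros lim lim')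
  then have "(LINT x|?M. (cmod (h x - g x))\<^sup>2) \<le> 2 * (\<omega> * 0\<^sup>2) + 2 * (\<omega> * 0\<^sup>2)"
    by (rule tendsto_lowerbound) (use bound in \<open>auto intro!: eventually_at_leftI[of 0]\<close>)
  then have "(LINT x|?M. (cmod (h x - g x))\<^sup>2) = 0"
    by (intro antisym Bochner_Integration.integral_nonneg) auto
  then have "AE x in ?M. (cmod (h x - g x))\<^sup>2 = 0"
    using L2_diff[OF h g] by (subst (asm) integral_nonneg_eq_0_iff_AE) (auto simp: L2_def)
  then show ?thesis by (rule AE_mp) (auto simp: h_def)
qed

lemma rapidly_decreasing_LB_power:
  assumes "rapidly_decreasing \<alpha>"
  shows "rapidly_decreasing (\<lambda>k. \<alpha> k * LB_eigenvalue k ^ r)"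
proof (induction r)
  case (Suc r)
  then show ?case using rapidly_decreasing_LB[OF Suc] by (simp add: mult_ac)
qed (use assms in simp)

lemma zf_series_iterated_LB:
  assumes "rapidly_decreasing \<alpha>"
  shows "(has_LB_derivative ^^ r) (zf_series \<alpha>) (zf_series (\<lambda>k. \<alpha> k * LB_eigenvalue k ^ r))"
proof (induction r)
  case (Suc r)
  have "has_LB_derivative (zf_series (\<lambda>k. \<alpha> k * LB_eigenvalue k ^ r))
      (zf_series (\<lambda>k. \<alpha> k * LB_eigenvalue k ^ Suc r))"
    using zf_series_has_LB_derivative[OF rapidly_decreasing_LB_power[OF assms, of r]] by (simp add: mult_ac)
  then show ?case using Suc by auto
qed simp

lemma iterated_LB_unique:
  assumes \<alpha>: "rapidly_decreasing \<alpha>" and "(has_LB_derivative ^^ r) (zf_series \<alpha>) g"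
  shows "g \<in> L2_sphere" "AE x in sphere_measure. g x = zf_series (\<lambda>k. \<alpha> k * LB_eigenvalue k ^ r) x"
proof -
  have "g \<in> L2_sphere \<and> (AE x in sphere_measure. g x = zf_series (\<lambda>k. \<alpha> k * LB_eigenvalue k ^ r) x)"
    using assms(2)
  proof (induction r arbitrary: g)
    case 0
    then show ?case using zf_series_in_L2[OF rapidly_decreasing_summable[OF \<alpha>]] by auto
  next
    case (Suc r)
    then obtain f where f: "(has_LB_derivative ^^ r) (zf_series \<alpha>) f" "has_LB_derivative f g" by auto
    have "g \<in> L2_sphere" using f(2) by (simp add: has_LB_derivative_def)
    moreover have "AE x in sphere_measure. g x = zf_series (\<lambda>k. \<alpha> k * LB_eigenvalue k ^ Suc r) x"
      using LB_derivative_unique[OF rapidly_decreasing_LB_power[OF \<alpha>, of r] _ f(2)] Suc.IH[OF f(1)]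
      by (simp add: mult_ac)
    ultimately show ?case by blast
  qed
  then show "g \<in> L2_sphere" "AE x in sphere_measure. g x = zf_series (\<lambda>k. \<alpha> k * LB_eigenvalue k ^ r) x"
    by auto
qed

text \<open>Termwise differentiation shows that the choice is made from a non-empty set, and
  uniqueness pins down the chosen element almost everywhere.\<close>

lemma LB_derivative_zf_series:
  assumes \<alpha>: "rapidly_decreasing \<alpha>"
  shows "LB_derivative r (zf_series \<alpha>) \<in> L2_sphere"
    "AE x in sphere_measure. LB_derivative r (zf_series \<alpha>) x = zf_series (\<lambda>k. \<alpha> k * LB_eigenvalue k ^ r) x"
proof -
  have "(has_LB_derivative ^^ r) (zf_series \<alpha>) (LB_derivative r (zf_series \<alpha>))"
    unfolding LB_derivative_def
    using someI[of "(has_LB_derivative ^^ r) (zf_series \<alpha>)", OF zf_series_iterated_LB[OF \<alpha>]] by simp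
  then show "LB_derivative r (zf_series \<alpha>) \<in> L2_sphere"
    "AE x in sphere_measure. LB_derivative r (zf_series \<alpha>) x = zf_series (\<lambda>k. \<alpha> k * LB_eigenvalue k ^ r) x"
    using iterated_LB_unique[OF \<alpha>] by blast+
qed

lemma zf_series_in_W2_infinity:
  assumes "rapidly_decreasing \<alpha>"
  shows "zf_series \<alpha> \<in> W2_infinity"
  using zf_series_in_L2[OF rapidly_decreasing_summable[OF assms]] zf_series_iterated_LB[OF assms]
  unfolding W2_infinity_def by blast

end

section \<open>The diagonal kernel\<close>

lemma L2_sphere_integrable:
  fixes f :: "'a::euclidean_space \<Rightarrow> complex"
  assumes "f \<in> L2_sphere"
  shows "integrable sphere_measure f"
proof (rule Bochner_Integration.integrable_bound)
  show "integrable sphere_measure (\<lambda>x. 1 + (cmod (f x))\<^sup>2)"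
    using assms by (intro Bochner_Integration.integrable_add) (auto simp: L2_def)
  have "y \<le> 1 + y\<^sup>2" for y :: real
    using zero_le_power2[of "y - 1 / 2"] by (simp add: power2_eq_square algebra_simps)
  then show "AE x in sphere_measure. norm (f x) \<le> norm (1 + (cmod (f x))\<^sup>2)" by simp
qed (use assms in \<open>simp add: L2_def\<close>)

text \<open>Cauchy-Schwarz against the constant 1, obtained from the non-negativity of the variance
  of \<open>cmod (f x)\<close> about its mean \<open>I / \<omega>\<close>.\<close>

lemma L1_le_sphere_norm:
  fixes f :: "'a::euclidean_space \<Rightarrow> complex"
  assumes f: "f \<in> L2_sphere"
  shows "(LINT x|sphere_measure. cmod (f x)) \<le>
    measure (sphere_measure :: 'a measure) (sphere 0 1) * sphere_norm f"
proof -
  let ?M = "sphere_measure :: 'a measure"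
  define \<omega> where "\<omega> = measure ?M (sphere 0 1)"
  define I where "I = (LINT x|?M. cmod (f x))"
  have \<omega>: "\<omega> > 0" using measure_sphere_pos by (simp add: \<omega>_def)
  have int: "integrable ?M (\<lambda>x. cmod (f x))" "integrable ?M (\<lambda>x. (cmod (f x))\<^sup>2)"
    using f L2_sphere_integrable[OF f] by (auto simp: L2_def)
  have "0 \<le> (LINT x|?M. (cmod (f x) - I / \<omega>)\<^sup>2)" by (intro Bochner_Integration.integral_nonneg) simp
  also have "\<dots> = (LINT x|?M. (cmod (f x))\<^sup>2 + (- 2 * I / \<omega>) * cmod (f x) + (I / \<omega>)\<^sup>2)"
    by (simp add: power2_diff algebra_simps)
  also have "\<dots> = (LINT x|?M. (cmod (f x))\<^sup>2) + (- 2 * I / \<omega>) * I + (I / \<omega>)\<^sup>2 * \<omega>"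
    using int by (simp add: I_def \<omega>_def)
  also have "\<dots> = (LINT x|?M. (cmod (f x))\<^sup>2) - I\<^sup>2 / \<omega>"
  proof -
    have "(- 2 * I / \<omega>) * I + (I / \<omega>)\<^sup>2 * \<omega> = - I\<^sup>2 / \<omega>"
      using \<omega> by (simp add: power2_eq_square)
    then show ?thesis by simp
  qed
  also have "(LINT x|?M. (cmod (f x))\<^sup>2) = \<omega> * (sphere_norm f)\<^sup>2"
    unfolding \<omega>_def by (rule sphere_norm_sq[symmetric])
  finally have "I\<^sup>2 \<le> (\<omega> * sphere_norm f)\<^sup>2"
    using \<omega> by (simp add: divide_le_eq power_mult_distrib power2_eq_square[of \<omega>] mult_ac)
  then show ?thesis
    using \<omega> sphere_norm_nonneg[of f] unfolding I_def[symmetric] \<omega>_def[symmetric]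
    by (auto intro: power2_le_imp_le mult_nonneg_nonneg)
qed

context frame
begin

definition zbar_series :: "(nat \<Rightarrow> complex) \<Rightarrow> 'a \<Rightarrow> complex" where
  "zbar_series \<beta> x = (\<Sum>k. \<beta> k * cnj (zf x) ^ k)"

text \<open>Without conjugation on \<open>zf\<close>, this is the pairing of \<open>f\<close> with
  \<open>cnj (zf y) ^ k\<close>, hence an expansion coefficient with respect to the
  eigenfunctions.\<close>

definition coef :: "nat \<Rightarrow> ('a \<Rightarrow> complex) \<Rightarrow> complex" where
  "coef k f = (LINT y|sphere_measure. zf y ^ k * f y)"

text \<open>Taken with the unnormalised surface measure, like \<open>kernel_op\<close>, so that the
  eigenvalues are exactly \<open>b k * zf_norm_sq k\<close>.\<close>

definition zf_norm_sq :: "nat \<Rightarrow> real" where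
  "zf_norm_sq k = (LINT x|sphere_measure. (cmod (zf x) ^ k)\<^sup>2)"

text \<open>The powers of \<open>cnj (zf x)\<close> are absorbed into the coefficients, which makes
  every row a \<open>zf_series\<close> to which the differentiation results apply.\<close>

definition diag_kernel :: "(nat \<Rightarrow> complex) \<Rightarrow> 'a \<Rightarrow> 'a \<Rightarrow> complex" where
  "diag_kernel b x = zf_series (\<lambda>k. b k * cnj (zf x) ^ k)"

lemma zbar_series_measurable [measurable]: "zbar_series \<beta> \<in> borel_measurable borel"
  unfolding zbar_series_def by measurable

lemma zbar_series_eq:
  assumes "summable (\<lambda>k. cmod (\<beta> k))" "norm x \<le> 1"
  shows "zbar_series \<beta> x = cnj (zf_series (\<lambda>k. cnj (\<beta> k)) x)"
proof -
  have "(\<lambda>k. cnj (\<beta> k) * zf x ^ k) sums zf_series (\<lambda>k. cnj (\<beta> k)) x"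
    unfolding zf_series_def
    using assms by (intro summable_sums summable_norm_cancel[OF zf_series_summable_norm]) auto
  then have "(\<lambda>k. cnj (cnj (\<beta> k) * zf x ^ k)) sums cnj (zf_series (\<lambda>k. cnj (\<beta> k)) x)"
    by (simp only: sums_cnj)
  then show ?thesis by (simp add: zbar_series_def sums_iff)
qed

lemma norm_zbar_series_le:
  assumes "summable (\<lambda>k. cmod (\<beta> k))" "norm x \<le> 1"
  shows "cmod (zbar_series \<beta> x) \<le> (\<Sum>k. cmod (\<beta> k))"
  using norm_zf_series_le[of "\<lambda>k. cnj (\<beta> k)" x] assms by (simp add: zbar_series_eq)

lemma zf_power_mult_integrable:
  assumes f: "integrable sphere_measure f"
  shows "integrable sphere_measure (\<lambda>x. zf x ^ k * f x)"
    and "(LINT x|sphere_measure. cmod (zf x ^ k * f x)) \<le> (LINT x|sphere_measure. cmod (f x))"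
proof -
  have [measurable]: "f \<in> borel_measurable sphere_measure" "zf \<in> borel_measurable sphere_measure"
    using f by (auto intro: borel_measurable_sphere_measure)
  have le: "cmod (zf x ^ k * f x) \<le> cmod (f x)" if "norm x = 1" for x
    using norm_zf_power[of x k] that by (simp add: norm_mult mult_right_le_one_le mult_left_le_one_le)
  show int: "integrable sphere_measure (\<lambda>x. zf x ^ k * f x)"
    by (rule Bochner_Integration.integrable_bound[OF f]) (auto intro!: AE_I2 le)
  show "(LINT x|sphere_measure. cmod (zf x ^ k * f x)) \<le> (LINT x|sphere_measure. cmod (f x))"
    by (rule integral_mono) (auto intro!: le int f integrable_norm)
qed

lemma norm_coef_le:
  assumes "integrable sphere_measure f"
  shows "cmod (coef k f) \<le> (LINT x|sphere_measure. cmod (f x))"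
  unfolding coef_def using integral_norm_bound zf_power_mult_integrable(2)[OF assms] by (rule order_trans)

lemma summable_mult_bounded:
  fixes a c :: "nat \<Rightarrow> complex"
  assumes "summable (\<lambda>k. cmod (a k))" "\<And>k. cmod (c k) \<le> B"
  shows "summable (\<lambda>k. cmod (a k * c k))"
  by (rule summable_comparison_test'[OF summable_mult2[OF assms(1), of B], of 0])
     (auto simp: norm_mult assms(2) mult_left_mono)

lemma integral_zf_series:
  assumes \<beta>: "summable (\<lambda>k. cmod (\<beta> k))" and f: "integrable sphere_measure f"
  shows "(\<lambda>k. \<beta> k * coef k f) sums (LINT y|sphere_measure. zf_series \<beta> y * f y)"
proof -
  let ?M = "sphere_measure :: 'a measure"
  note int = zf_power_mult_integrable[OF f]
  have int': "integrable ?M (\<lambda>y. \<beta> k * (zf y ^ k * f y))" for k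
    by (intro integrable_mult_right int)
  have "(\<lambda>k. (LINT y|?M. \<beta> k * (zf y ^ k * f y))) sums (LINT y|?M. (\<Sum>k. \<beta> k * (zf y ^ k * f y)))"
  proof (rule sums_integral[OF int'])
    show "AE y in ?M. summable (\<lambda>k. norm (\<beta> k * (zf y ^ k * f y)))"
    proof (rule AE_I2)
      fix y :: 'a assume "y \<in> space ?M"
      then have "summable (\<lambda>k. cmod (\<beta> k * zf y ^ k) * cmod (f y))"
        by (intro summable_mult2 zf_series_summable_norm \<beta>) simp
      then show "summable (\<lambda>k. norm (\<beta> k * (zf y ^ k * f y)))" by (simp add: norm_mult mult_ac)
    qed
    show "summable (\<lambda>k. LINT y|?M. norm (\<beta> k * (zf y ^ k * f y)))"
    proof (rule summable_comparison_test'[OF summable_mult2[OF \<beta>, of "LINT x|?M. cmod (f x)"]])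
      fix k
      have "(LINT y|?M. norm (\<beta> k * (zf y ^ k * f y))) = cmod (\<beta> k) * (LINT y|?M. cmod (zf y ^ k * f y))"
        unfolding norm_mult[of "\<beta> k"] by simp
      also have "\<dots> \<le> cmod (\<beta> k) * (LINT x|?M. cmod (f x))"
        by (intro mult_left_mono int) simp
      finally have "(LINT y|?M. norm (\<beta> k * (zf y ^ k * f y))) \<le> cmod (\<beta> k) * (LINT x|?M. cmod (f x))" .
      moreover have "0 \<le> (LINT y|?M. norm (\<beta> k * (zf y ^ k * f y)))"
        by (intro Bochner_Integration.integral_nonneg) simp
      ultimately show "norm (LINT y|?M. norm (\<beta> k * (zf y ^ k * f y))) \<le> cmod (\<beta> k) * (LINT x|?M. cmod (f x))"
        by simp
    qed
  qed
  moreover have "(LINT y|?M. (\<Sum>k. \<beta> k * (zf y ^ k * f y))) = (LINT y|?M. zf_series \<beta> y * f y)"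
  proof (rule Bochner_Integration.integral_cong[OF refl])
    fix y :: 'a assume "y \<in> space ?M"
    then have "summable (\<lambda>k. \<beta> k * zf y ^ k)"
      by (intro summable_norm_cancel[OF zf_series_summable_norm] \<beta>) simp
    then show "(\<Sum>k. \<beta> k * (zf y ^ k * f y)) = zf_series \<beta> y * f y"
      by (simp add: zf_series_def suminf_mult2 mult.assoc)
  qed
  ultimately show ?thesis by (simp add: coef_def)
qed

lemma integral_diag_kernel:
  assumes b: "summable (\<lambda>k. cmod (b k))" and x: "norm x = 1" and f: "integrable sphere_measure f"
  shows "(LINT y|sphere_measure. diag_kernel b x y * f y) = zbar_series (\<lambda>k. b k * coef k f) x"
proof -
  have "summable (\<lambda>k. cmod (b k * cnj (zf x) ^ k))"
    using norm_zf_power[of x] x by (intro summable_mult_bounded[OF b, of _ 1]) (simp add: norm_power)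
  then have "(\<lambda>k. b k * cnj (zf x) ^ k * coef k f) sums (LINT y|sphere_measure. diag_kernel b x y * f y)"
    unfolding diag_kernel_def by (rule integral_zf_series[OF _ f])
  then show ?thesis by (simp add: zbar_series_def sums_iff mult_ac)
qed

lemma coef_summable:
  assumes b: "summable (\<lambda>k. cmod (b k))" and f: "integrable sphere_measure f"
  shows "summable (\<lambda>k. cmod (b k * coef k f))"
  by (rule summable_mult_bounded[OF b norm_coef_le[OF f]])

text \<open>The image of \<open>f\<close> is bounded pointwise by the sum of the coefficients times
  the integral of \<open>cmod (f x)\<close>. \<open>T\<close> is described only by its values on the
  sphere, so that operators whose kernel rows are merely chosen representatives are covered
  too.\<close>

lemma diag_operator_bounded:
  assumes b: "summable (\<lambda>k. cmod (b k))"
    and T: "\<And>f x. f \<in> L2_sphere \<Longrightarrow> norm x = 1 \<Longrightarrow> T f x = (LINT y|sphere_measure. diag_kernel b x y * f y)"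
  shows "bounded_on_L2 T"
proof -
  let ?M = "sphere_measure :: 'a measure"
  define S where "S = (\<Sum>k. cmod (b k))"
  have "S \<ge> 0" unfolding S_def by (intro suminf_nonneg b) simp
  have "T f \<in> L2_sphere \<and> sphere_norm (T f) \<le> S * measure ?M (sphere 0 1) * sphere_norm f"
    if f: "f \<in> L2_sphere" for f
  proof -
    define I where "I = (LINT x|?M. cmod (f x))"
    have "I \<ge> 0" unfolding I_def by (intro Bochner_Integration.integral_nonneg) simp
    note fi = L2_sphere_integrable[OF f]
    have Tf: "T f x = zbar_series (\<lambda>k. b k * coef k f) x" if "norm x = 1" for x
      using T[OF f that] integral_diag_kernel[OF b that fi] by simp
    have bound: "cmod (T f x) \<le> S * I" if "norm x = 1" for x
    proof -
      have "cmod (T f x) \<le> (\<Sum>k. cmod (b k * coef k f))"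
        unfolding Tf[OF that] using that by (intro norm_zbar_series_le coef_summable b fi) simp
      also have "\<dots> \<le> (\<Sum>k. cmod (b k) * I)"
        using norm_coef_le[OF fi]
        by (intro suminf_le coef_summable b fi summable_mult2) (auto simp: norm_mult I_def intro: mult_left_mono)
      also have "\<dots> = S * I" unfolding S_def by (rule suminf_mult2[OF b, symmetric])
      finally show ?thesis .
    qed
    have "T f \<in> borel_measurable ?M"
      using borel_measurable_sphere_measure[OF zbar_series_measurable, of "\<lambda>k. b k * coef k f"]
      by (subst measurable_cong[where g = "zbar_series (\<lambda>k. b k * coef k f)"]) (simp_all add: Tf)
    then have "T f \<in> L2_sphere" by (rule bounded_in_L2_sphere[OF _ bound])
    moreover have "sphere_norm (T f) \<le> S * I"
      using \<open>S \<ge> 0\<close> \<open>I \<ge> 0\<close> by (intro sphere_norm_le bound) auto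
    moreover have "S * I \<le> S * (measure ?M (sphere 0 1) * sphere_norm f)"
      unfolding I_def by (intro mult_left_mono L1_le_sphere_norm f \<open>S \<ge> 0\<close>)
    ultimately show ?thesis by (simp add: mult.assoc)
  qed
  then show ?thesis unfolding bounded_on_L2_def by blast
qed

lemma rapidly_decreasing_row:
  assumes "rapidly_decreasing b" "norm x = 1"
  shows "rapidly_decreasing (\<lambda>k. b k * cnj (zf x) ^ k)"
  by (rule rapidly_decreasing_mult[OF assms(1), of _ 1 0])
     (use norm_zf_power[of x] assms(2) in \<open>simp add: norm_power\<close>)

text \<open>The representative is chosen separately for every \<open>x\<close>. Each row is
  determined almost everywhere in \<open>y\<close>, and the integral against \<open>f\<close> sees
  no more than that, so the operator is the one with coefficients
  \<open>b k * LB_eigenvalue k ^ r\<close>.\<close>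

lemma kernel_op_LB_derivative_bounded:
  assumes b: "rapidly_decreasing b"
  shows "bounded_on_L2 (kernel_op (kernel_LB_derivative r (diag_kernel b)))"
proof (rule diag_operator_bounded[OF rapidly_decreasing_summable[OF rapidly_decreasing_LB_power[OF b, of r]]])
  fix f :: "'a \<Rightarrow> complex" and x :: 'a assume f: "f \<in> L2_sphere" and x: "norm x = 1"
  have [measurable]: "f \<in> borel_measurable sphere_measure" using f by (simp add: L2_def)
  note LB = LB_derivative_zf_series[OF rapidly_decreasing_row[OF b x], of r]
  have [measurable]: "LB_derivative r (zf_series (\<lambda>k. b k * cnj (zf x) ^ k)) \<in> borel_measurable sphere_measure"
    using LB(1) by (simp add: L2_def)
  have [measurable]: "diag_kernel (\<lambda>k. b k * LB_eigenvalue k ^ r) x \<in> borel_measurable sphere_measure"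
    unfolding diag_kernel_def by (rule borel_measurable_sphere_measure) measurable
  have "AE y in sphere_measure. LB_derivative r (zf_series (\<lambda>k. b k * cnj (zf x) ^ k)) y =
      diag_kernel (\<lambda>k. b k * LB_eigenvalue k ^ r) x y"
    using LB(2) by (simp add: diag_kernel_def mult_ac)
  then show "kernel_op (kernel_LB_derivative r (diag_kernel b)) f x =
      (LINT y|sphere_measure. diag_kernel (\<lambda>k. b k * LB_eigenvalue k ^ r) x y * f y)"
    unfolding kernel_op_def kernel_LB_derivative_def diag_kernel_def[of b]
    by (intro integral_cong_AE) auto
qed

lemma diag_kernel_in_W2_infinity:
  assumes "rapidly_decreasing b"
  shows "kernel_in_W2_infinity (diag_kernel b)"
  unfolding kernel_in_W2_infinity_def diag_kernel_def
  using zf_series_in_W2_infinity[OF rapidly_decreasing_row[OF assms]] by (intro AE_I2) simp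

text \<open>Up to the normalisation, the quadratic form is the sum of
  \<open>b k * (cmod (coef k f))\<^sup>2\<close>. Square-integrability of the kernel follows from
  its bound by the sum of the \<open>b k\<close>.\<close>

lemma diag_kernel_positive_definite:
  fixes b :: "nat \<Rightarrow> real"
  assumes b: "summable b" "\<And>k. 0 \<le> b k"
  shows "L2_positive_definite (diag_kernel (\<lambda>k. of_real (b k)))"
proof -
  let ?M = "sphere_measure :: 'a measure" and ?b = "\<lambda>k. of_real (b k) :: complex"
  have sb: "summable (\<lambda>k. cmod (?b k))" using b by simp
  have zm [measurable]: "zf \<in> borel_measurable ?M" by (rule borel_measurable_sphere_measure) measurable
  have [measurable]: "(\<lambda>x. cnj (zf x)) \<in> borel_measurable ?M"
    by (rule borel_measurable_sphere_measure) measurable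
  have [measurable]: "case_prod (diag_kernel ?b) \<in> borel_measurable (?M \<Otimes>\<^sub>M ?M)"
    unfolding diag_kernel_def zf_series_def by measurable
  interpret pair: finite_measure "?M \<Otimes>\<^sub>M ?M"
    by (rule finite_measure_pair_measure) (rule finite_sphere_measure)+
  have "integrable (?M \<Otimes>\<^sub>M ?M) (\<lambda>p. (cmod (case_prod (diag_kernel ?b) p))\<^sup>2)"
  proof (rule pair.integrable_const_bound[of _ "(\<Sum>k. b k)\<^sup>2"])
    show "AE p in ?M \<Otimes>\<^sub>M ?M. norm ((cmod (case_prod (diag_kernel ?b) p))\<^sup>2) \<le> (\<Sum>k. b k)\<^sup>2"
    proof (rule AE_I2)
      fix p assume "p \<in> space (?M \<Otimes>\<^sub>M ?M)"
      then obtain x y where p: "p = (x, y)" "norm x = 1" "norm y = 1"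
        by (auto simp: space_pair_measure)
      have le: "cmod (?b k * cnj (zf x) ^ k) \<le> b k" for k
        using norm_zf_power[of x k] p b by (simp add: norm_mult norm_power mult_left_le)
      have s: "summable (\<lambda>k. cmod (?b k * cnj (zf x) ^ k))"
        using le by (intro summable_comparison_test'[OF b(1), of 0]) simp
      have "cmod (diag_kernel ?b x y) \<le> (\<Sum>k. cmod (?b k * cnj (zf x) ^ k))"
        unfolding diag_kernel_def using p by (intro norm_zf_series_le s) simp
      also have "\<dots> \<le> (\<Sum>k. b k)" by (intro suminf_le le s b)
      finally show "norm ((cmod (case_prod (diag_kernel ?b) p))\<^sup>2) \<le> (\<Sum>k. b k)\<^sup>2"
        by (simp add: p power_mono)
    qed
  qed measurable
  then have "case_prod (diag_kernel ?b) \<in> L2 (?M \<Otimes>\<^sub>M ?M)" by (simp add: L2_def)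
  moreover have "sphere_inner (kernel_op (diag_kernel ?b) f) f \<in> \<real>\<^sub>\<ge>\<^sub>0" if f: "f \<in> L2_sphere" for f
  proof -
    note fi = L2_sphere_integrable[OF f]
    define \<beta> where "\<beta> k = ?b k * coef k f" for k
    have \<beta>: "summable (\<lambda>k. cmod (\<beta> k))" unfolding \<beta>_def by (rule coef_summable[OF sb fi])
    have "(LINT x|?M. kernel_op (diag_kernel ?b) f x * cnj (f x)) =
        (LINT x|?M. cnj (zf_series (\<lambda>k. cnj (\<beta> k)) x * f x))"
      by (intro Bochner_Integration.integral_cong)
         (simp_all add: kernel_op_def integral_diag_kernel[OF sb _ fi] zbar_series_eq \<beta> \<beta>_def[symmetric])
    also have "\<dots> = cnj (LINT x|?M. zf_series (\<lambda>k. cnj (\<beta> k)) x * f x)"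
      by (rule Bochner_Integration.integral_cnj)
    finally have I: "(LINT x|?M. kernel_op (diag_kernel ?b) f x * cnj (f x)) =
        cnj (LINT x|?M. zf_series (\<lambda>k. cnj (\<beta> k)) x * f x)" .
    define S where "S = (LINT x|?M. zf_series (\<lambda>k. cnj (\<beta> k)) x * f x)"
    have "(\<lambda>k. cnj (\<beta> k) * coef k f) sums S"
      unfolding S_def using \<beta> by (intro integral_zf_series fi) simp
    moreover have "cnj (\<beta> k) * coef k f = of_real (b k * (cmod (coef k f))\<^sup>2)" for k
      unfolding \<beta>_def of_real_mult complex_norm_square by (simp add: mult_ac)
    ultimately have S: "(\<lambda>k. of_real (b k * (cmod (coef k f))\<^sup>2)) sums S" by simp
    have "(\<lambda>k. b k * (cmod (coef k f))\<^sup>2) sums Re S" using sums_Re[OF S] by simp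
    then have "0 \<le> Re S" by (rule sums_le[OF _ sums_zero, rotated]) (simp add: b)
    moreover have "Im S = 0" using sums_Im[OF S] by (simp add: sums_iff)
    ultimately show ?thesis
      unfolding sphere_inner_def I S_def[symmetric]
      by (simp add: complex_nonneg_Reals_iff Re_divide_of_real Im_divide_of_real)
  qed
  ultimately show ?thesis unfolding L2_positive_definite_def by blast
qed

section \<open>Orthogonality of the powers and the spectrum of the diagonal kernel\<close>

lemma reflect_zf:
  obtains Q where "orthogonal_transformation Q" "\<And>x. zf (Q x) = - (cis \<phi>)\<^sup>2 * cnj (zf x)"
proof -
  \<comment> \<open>The reflection negates \<open>a\<close> and fixes \<open>a'\<close>, which is
    \<open>a\<close> turned by a right angle in the plane of \<open>e1\<close> and
    \<open>e2\<close>. In the coordinate \<open>zf\<close> this is the planar reflection in the line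
    spanned by \<open>a'\<close>.\<close>
  define a where "a = cos \<phi> *\<^sub>R e1 + sin \<phi> *\<^sub>R e2"
  define a' where "a' = (- sin \<phi>) *\<^sub>R e1 + cos \<phi> *\<^sub>R e2"
  obtain Q where Q: "orthogonal_transformation Q" "Q a = - a" "\<And>v. v \<bullet> a = v \<bullet> (- a) \<Longrightarrow> Q v = v"
    using orthogonal_transformation_reflect[of a "- a"] by (metis norm_minus_cancel)
  have lin: "linear Q" using Q(1) by (rule orthogonal_transformation_linear)
  have "a' \<bullet> a = 0"
    unfolding a_def a'_def inner_add_left inner_add_right inner_scaleR_left inner_scaleR_right by simp
  then have Qa': "Q a' = a'" using Q(3) by simp
  have cs: "cos \<phi> * cos \<phi> + sin \<phi> * sin \<phi> = 1" using sin_cos_squared_add3[of \<phi>] by simp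
  have e: "e1 = cos \<phi> *\<^sub>R a - sin \<phi> *\<^sub>R a'" "e2 = sin \<phi> *\<^sub>R a + cos \<phi> *\<^sub>R a'"
  proof -
    have "c *\<^sub>R (c *\<^sub>R e1 + s *\<^sub>R e2) - s *\<^sub>R ((- s) *\<^sub>R e1 + c *\<^sub>R e2) = (c * c + s * s) *\<^sub>R e1"
      "s *\<^sub>R (c *\<^sub>R e1 + s *\<^sub>R e2) + c *\<^sub>R ((- s) *\<^sub>R e1 + c *\<^sub>R e2) = (c * c + s * s) *\<^sub>R e2" for c s
      by (simp_all add: algebra_simps)
    note gen = this[where c = "cos \<phi>" and s = "sin \<phi>", folded a_def a'_def]
    have "cos \<phi> *\<^sub>R a - sin \<phi> *\<^sub>R a' = (cos \<phi> * cos \<phi> + sin \<phi> * sin \<phi>) *\<^sub>R e1"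
      by (rule gen)
    then show "e1 = cos \<phi> *\<^sub>R a - sin \<phi> *\<^sub>R a'" unfolding cs scaleR_one by (rule sym)
    have "sin \<phi> *\<^sub>R a + cos \<phi> *\<^sub>R a' = (cos \<phi> * cos \<phi> + sin \<phi> * sin \<phi>) *\<^sub>R e2"
      by (rule gen)
    then show "e2 = sin \<phi> *\<^sub>R a + cos \<phi> *\<^sub>R a'" unfolding cs scaleR_one by (rule sym)
  qed
  have "zf (Q x) = - (cis \<phi>)\<^sup>2 * cnj (zf x)" for x
  proof -
    have "Q x \<bullet> a = - (x \<bullet> a)" "Q x \<bullet> a' = x \<bullet> a'"
    proof -
      have "Q x \<bullet> Q a = x \<bullet> a" "Q x \<bullet> Q a' = x \<bullet> a'"
        using Q(1) by (simp_all add: orthogonal_transformation_def)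
      then show "Q x \<bullet> a = - (x \<bullet> a)" "Q x \<bullet> a' = x \<bullet> a'" using Q(2) Qa' by simp_all
    qed
    moreover have "Q x \<bullet> e1 = cos \<phi> * (Q x \<bullet> a) - sin \<phi> * (Q x \<bullet> a')"
      "Q x \<bullet> e2 = sin \<phi> * (Q x \<bullet> a) + cos \<phi> * (Q x \<bullet> a')"
      by (subst e, simp add: inner_diff_right inner_add_right)+
    moreover have "x \<bullet> a = cos \<phi> * (x \<bullet> e1) + sin \<phi> * (x \<bullet> e2)"
      "x \<bullet> a' = - sin \<phi> * (x \<bullet> e1) + cos \<phi> * (x \<bullet> e2)"
      by (simp_all add: a_def a'_def inner_add_right inner_diff_right)
    ultimately have
      "Q x \<bullet> e1 = cos \<phi> * (- (cos \<phi> * (x \<bullet> e1) + sin \<phi> * (x \<bullet> e2)))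
         - sin \<phi> * (- sin \<phi> * (x \<bullet> e1) + cos \<phi> * (x \<bullet> e2))"
      "Q x \<bullet> e2 = sin \<phi> * (- (cos \<phi> * (x \<bullet> e1) + sin \<phi> * (x \<bullet> e2)))
         + cos \<phi> * (- sin \<phi> * (x \<bullet> e1) + cos \<phi> * (x \<bullet> e2))"
      by simp_all
    then show ?thesis
      by (simp add: complex_eq_iff zf_def power2_eq_square algebra_simps)
  qed
  then show ?thesis using that Q(1) by blast
qed

lemma coef_cnj_zf_power:
  "coef k (\<lambda>x. cnj (zf x) ^ l) = (if k = l then of_real (zf_norm_sq l) else 0)"
proof (cases "k = l")
  case True
  have "zf x ^ l * cnj (zf x) ^ l = of_real ((cmod (zf x) ^ l)\<^sup>2)" for x
    by (simp add: complex_norm_square[symmetric] power_mult_distrib[symmetric] power_mult[symmetric] mult.commute)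
  then show ?thesis using True unfolding coef_def zf_norm_sq_def by (simp only: integral_complex_of_real refl if_True)
next
  case False
  define I where "I = coef k (\<lambda>x. cnj (zf x) ^ l)"
  have reflect: "I = (-1) ^ (k + l) * cis (2 * (real k - real l) * \<phi>) * cnj I" for \<phi>
  proof -
    obtain Q where Q: "orthogonal_transformation Q" "\<And>x. zf (Q x) = - (cis \<phi>)\<^sup>2 * cnj (zf x)"
      using reflect_zf by metis
    have "I = (LINT x|sphere_measure. zf (Q x) ^ k * cnj (zf (Q x)) ^ l)"
      unfolding I_def coef_def by (rule integral_sphere_measure_orthogonal[OF Q(1), symmetric]) measurable
    also have "\<dots> = (LINT x|sphere_measure. ((-1) ^ (k + l) * cis (2 * (real k - real l) * \<phi>)) *
        cnj (zf x ^ k * cnj (zf x) ^ l))"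
    proof (rule Bochner_Integration.integral_cong[OF refl])
      fix x
      have zQ: "zf (Q x) = (-1) * cis (2 * \<phi>) * cnj (zf x)"
        "cnj (zf (Q x)) = (-1) * cis (- (2 * \<phi>)) * zf x"
        by (simp_all add: Q(2) power2_eq_square cis_mult cis_cnj)
      have "cis (real k * (2 * \<phi>)) * cis (real l * (- (2 * \<phi>))) = cis (2 * (real k - real l) * \<phi>)"
        unfolding cis_mult by (simp add: algebra_simps)
      then have 2: "cis (2 * \<phi>) ^ k * cis (- (2 * \<phi>)) ^ l = cis (2 * (real k - real l) * \<phi>)"
        by (simp only: Complex.DeMoivre)
      have "zf (Q x) ^ k * cnj (zf (Q x)) ^ l =
          (-1) ^ k * (-1) ^ l * (cis (2 * \<phi>) ^ k * cis (- (2 * \<phi>)) ^ l) * (cnj (zf x) ^ k * zf x ^ l)"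
        by (subst zQ(2), subst zQ(1)) (simp only: power_mult_distrib mult_ac)
      then show "zf (Q x) ^ k * cnj (zf (Q x)) ^ l =
          ((-1) ^ (k + l) * cis (2 * (real k - real l) * \<phi>)) * cnj (zf x ^ k * cnj (zf x) ^ l)"
        unfolding 2 power_add by simp
    qed
    also have "\<dots> = (-1) ^ (k + l) * cis (2 * (real k - real l) * \<phi>) * cnj I"
      unfolding I_def coef_def by (simp only: integral_mult_right_zero Bochner_Integration.integral_cnj)
    finally show ?thesis .
  qed
  have "real k - real l \<noteq> 0" using False by simp
  \<comment> \<open>This angle makes the phase equal to -1, whereas the angle 0 makes it 1. Together
    the two symmetries give \<open>I = - I\<close>.\<close>
  then have "2 * (real k - real l) * (pi / (2 * (real k - real l))) = pi" by (simp add: field_simps)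
  then have "I = - ((-1) ^ (k + l) * cnj I)"
    using reflect[of "pi / (2 * (real k - real l))"] by (simp only: cis_pi) simp
  moreover have "I = (-1) ^ (k + l) * cnj I" using reflect[of 0] by simp
  ultimately have "I = - I" by simp
  then show ?thesis using False by (simp add: I_def[symmetric])
qed

lemma cnj_zf_power_in_L2: "(\<lambda>x. cnj (zf x) ^ l) \<in> L2_sphere"
proof (rule bounded_in_L2_sphere[where B = 1])
  show "(\<lambda>x. cnj (zf x) ^ l) \<in> borel_measurable sphere_measure"
    by (rule borel_measurable_sphere_measure) measurable
qed (use norm_zf_power in \<open>simp add: norm_power\<close>)

lemma kernel_op_cnj_zf_power:
  assumes b: "summable (\<lambda>k. cmod (b k))" and x: "norm x = 1"
  shows "kernel_op (diag_kernel b) (\<lambda>x. cnj (zf x) ^ l) x = b l * of_real (zf_norm_sq l) * cnj (zf x) ^ l"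
proof -
  have "kernel_op (diag_kernel b) (\<lambda>x. cnj (zf x) ^ l) x =
      (\<Sum>k. b k * coef k (\<lambda>x. cnj (zf x) ^ l) * cnj (zf x) ^ k)"
    unfolding kernel_op_def integral_diag_kernel[OF b x L2_sphere_integrable[OF cnj_zf_power_in_L2]]
    by (simp add: zbar_series_def)
  also have "\<dots> = (\<Sum>k\<in>{l}. b k * coef k (\<lambda>x. cnj (zf x) ^ l) * cnj (zf x) ^ k)"
    by (rule suminf_finite) (auto simp: coef_cnj_zf_power)
  finally show ?thesis by (simp add: coef_cnj_zf_power)
qed

text \<open>Integrating the eigenvalue equation against \<open>zf x ^ l\<close> isolates one
  coefficient, by orthogonality. The first part leaves only coefficients whose index belongs to the
  eigenvalue; for \<open>\<mu> \<noteq> 0\<close> the second part recovers \<open>f\<close> from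
  them.\<close>

lemma eigenfunction_coef:
  assumes b: "summable (\<lambda>k. cmod (b k))" and f: "f \<in> L2_sphere"
    and eig: "AE x in sphere_measure. kernel_op (diag_kernel b) f x = \<mu> * f x"
  shows "\<mu> * coef l f = b l * of_real (zf_norm_sq l) * coef l f"
    and "AE x in sphere_measure. \<mu> * f x = zbar_series (\<lambda>k. b k * coef k f) x"
proof -
  let ?M = "sphere_measure :: 'a measure"
  note fi = L2_sphere_integrable[OF f]
  define \<beta> where "\<beta> k = b k * coef k f" for k
  have \<beta>: "summable (\<lambda>k. cmod (\<beta> k))" unfolding \<beta>_def by (rule coef_summable[OF b fi])
  show eq: "AE x in ?M. \<mu> * f x = zbar_series (\<lambda>k. b k * coef k f) x"
    using eig AE_space
  proof eventually_elim
    fix x :: 'a assume "kernel_op (diag_kernel b) f x = \<mu> * f x" "x \<in> space ?M"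
    then show "\<mu> * f x = zbar_series (\<lambda>k. b k * coef k f) x"
      using integral_diag_kernel[OF b _ fi, of x] by (simp add: kernel_op_def)
  qed
  have [measurable]: "f \<in> borel_measurable ?M" "zf \<in> borel_measurable ?M" "zbar_series \<gamma> \<in> borel_measurable ?M" for \<gamma>
    using fi by (auto intro!: borel_measurable_sphere_measure)
  have "\<mu> * coef l f = (LINT x|?M. zf x ^ l * (\<mu> * f x))"
    by (simp add: coef_def mult.left_commute)
  also have "\<dots> = (LINT x|?M. zf x ^ l * zbar_series \<beta> x)"
    by (rule integral_cong_AE) (use eq in \<open>auto simp: \<beta>_def[abs_def]\<close>)
  also have "\<dots> = (LINT x|?M. cnj (zf_series (\<lambda>k. cnj (\<beta> k)) x * cnj (zf x) ^ l))"
    by (intro Bochner_Integration.integral_cong) (simp_all add: zbar_series_eq[OF \<beta>] mult.commute)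
  also have "\<dots> = cnj (LINT x|?M. zf_series (\<lambda>k. cnj (\<beta> k)) x * cnj (zf x) ^ l)"
    by (rule Bochner_Integration.integral_cnj)
  also have "(LINT x|?M. zf_series (\<lambda>k. cnj (\<beta> k)) x * cnj (zf x) ^ l) =
      (\<Sum>k. cnj (\<beta> k) * coef k (\<lambda>x. cnj (zf x) ^ l))"
    using \<beta> by (intro sums_unique integral_zf_series L2_sphere_integrable cnj_zf_power_in_L2) simp
  also have "\<dots> = (\<Sum>k\<in>{l}. cnj (\<beta> k) * coef k (\<lambda>x. cnj (zf x) ^ l))"
    by (rule suminf_finite) (auto simp: coef_cnj_zf_power)
  finally show "\<mu> * coef l f = b l * of_real (zf_norm_sq l) * coef l f"
    by (simp add: coef_cnj_zf_power \<beta>_def mult_ac)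
qed

lemma zf_norm_sq_decreasing:
  assumes "k \<le> l"
  shows "zf_norm_sq l \<le> zf_norm_sq k"
proof -
  let ?M = "sphere_measure :: 'a measure"
  have zm [measurable]: "zf \<in> borel_measurable ?M" by (rule borel_measurable_sphere_measure) measurable
  have le1: "cmod (zf x) \<le> 1" if "norm x = 1" for x using norm_zf[of x] that by simp
  have int: "integrable ?M (\<lambda>x. (cmod (zf x) ^ j)\<^sup>2)" for j
    by (rule sphere.integrable_const_bound[of _ 1]) (auto intro!: AE_I2 power_le_one le1)
  show ?thesis
    unfolding zf_norm_sq_def
    using assms le1 by (intro integral_mono int power_mono power_decreasing) auto
qed

text \<open>Near the direction \<open>e1\<close> the form has modulus close to its maximum 1. On a
  ball of radius proportional to \<open>1 / k\<close> around \<open>e1 / 2\<close> its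
  \<open>2 * k\<close>-th power stays above 1/2, and the volume of that ball gives the power of
  \<open>k\<close>. The exponent is not sharp, but any fixed exponent suffices.\<close>

lemma zf_norm_sq_lower_bound:
  "\<exists>C>0. \<forall>k\<ge>1. C / real k ^ DIM('a) \<le> zf_norm_sq k"
proof (intro exI conjI allI impI)
  let ?V = "measure lborel (ball (0::'a) 1)"
  show "0 < real DIM('a) * (1 / 2) * (?V / 16 ^ DIM('a))"
    using content_ball_pos[of 1 "0::'a"] by simp
  fix k :: nat assume k: "1 \<le> k"
  \<comment> \<open>On the ball the normalised modulus is at least
    \<open>(1/2 - \<rho>) / (1/2 + \<rho>) \<ge> 1 - 4 * \<rho>\<close>, and Bernoulli's inequality
    yields \<open>1 - 8 * real k * \<rho>\<close>, which this radius makes equal to 1/2.\<close>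
  define \<rho> where "\<rho> = 1 / (16 * real k)"
  have \<rho>: "0 < \<rho>" "\<rho> \<le> 1 / 16" "8 * real k * \<rho> = 1 / 2" using k by (simp_all add: \<rho>_def field_simps)
  define p where "p = (1 / 2) *\<^sub>R e1"
  define g where "g x = (indicator (cball 0 1 - {0}) x * (cmod (zf (x /\<^sub>R norm x)) ^ k)\<^sup>2 :: real)" for x :: 'a
  have [measurable]: "g \<in> borel_measurable borel" unfolding g_def by measurable
  have g01: "0 \<le> g x" "g x \<le> indicator (cball 0 1) x" for x
  proof -
    have "cmod (zf (x /\<^sub>R norm x)) \<le> 1" using norm_zf[of "x /\<^sub>R norm x"] by (cases "x = 0") auto
    then show "0 \<le> g x" "g x \<le> indicator (cball 0 1) x"
      by (auto simp: g_def indicator_def intro!: power_le_one)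
  qed
  have fin: "emeasure lborel (cball 0 1 :: 'a set) < \<infinity>" by (rule emeasure_lborel_cball_finite)
  have gi: "integrable lborel g"
    by (rule Bochner_Integration.integrable_bound[OF integrable_real_indicator[of "cball 0 1"]])
       (use g01 fin in auto)
  have g_ge: "1 / 2 \<le> g x" if "x \<in> ball p \<rho>" for x
  proof -
    define v where "v = x - p"
    have v: "x = p + v" "norm v < \<rho>"
      using that by (simp_all add: v_def dist_norm norm_minus_commute)
    have "\<bar>v \<bullet> e1\<bar> \<le> norm v" using Cauchy_Schwarz_ineq2[of v e1] by simp
    moreover have "x \<bullet> e1 = 1 / 2 + v \<bullet> e1" by (simp add: v p_def inner_add_left)
    ultimately have 1: "1 / 2 - \<rho> \<le> x \<bullet> e1" using v by linarith
    have nx: "norm x \<le> 1 / 2 + \<rho>"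
      using norm_triangle_ineq[of p v] v by (simp add: p_def)
    have "x \<noteq> 0" using 1 \<rho> by auto
    have "(1 - 4 * \<rho>) * norm x \<le> (1 - 4 * \<rho>) * (1 / 2 + \<rho>)"
      using nx \<rho> by (intro mult_left_mono) auto
    also have "\<dots> \<le> 1 / 2 - \<rho>" by (simp add: algebra_simps)
    also have "\<dots> \<le> cmod (zf x)"
      using 1 abs_Re_le_cmod[of "zf x"] by (simp add: zf_def)
    finally have "1 - 4 * \<rho> \<le> cmod (zf x) / norm x"
      using \<open>x \<noteq> 0\<close> by (simp add: le_divide_eq)
    also have "\<dots> = cmod (zf (x /\<^sub>R norm x))"
      by (simp add: zf_scale norm_mult norm_inverse divide_inverse mult.commute)
    finally have "(1 - 4 * \<rho>) ^ (2 * k) \<le> cmod (zf (x /\<^sub>R norm x)) ^ (2 * k)"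
      using \<rho> by (intro power_mono) auto
    moreover have "1 + real (2 * k) * (- 4 * \<rho>) \<le> (1 + (- 4 * \<rho>)) ^ (2 * k)"
      using \<rho> by (intro Bernoulli_inequality) auto
    ultimately have "1 / 2 \<le> cmod (zf (x /\<^sub>R norm x)) ^ (2 * k)"
      using \<rho>(3) by simp
    then show ?thesis
      using nx \<rho> \<open>x \<noteq> 0\<close> by (simp add: g_def power_mult[symmetric] mult.commute)
  qed
  have "(1 / 2) * (?V / 16 ^ DIM('a)) / real k ^ DIM('a) = (1 / 2) * measure lborel (ball p \<rho>)"
    using \<rho> content_ball_conv_unit_ball[of \<rho> p] by (simp add: \<rho>_def power_divide power_mult_distrib)
  also have "\<dots> = (LINT x|lborel. indicator (ball p \<rho>) x * (1 / 2))" by simp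
  also have "\<dots> \<le> (LINT x|lborel. g x)"
  proof (rule integral_mono[OF _ gi])
    show "integrable lborel (\<lambda>x. indicator (ball p \<rho>) x * (1 / 2) :: real)"
      using emeasure_lborel_ball_finite by (intro integrable_mult_left integrable_real_indicator) auto
    show "indicator (ball p \<rho>) x * (1 / 2) \<le> g x" for x
      using g_ge[of x] g01(1)[of x] by (auto simp: indicator_def)
  qed
  finally have le: "(1 / 2) * (?V / 16 ^ DIM('a)) / real k ^ DIM('a) \<le> (LINT x|lborel. g x)" .
  have "zf_norm_sq k = real DIM('a) *\<^sub>R (LINT x|lborel. indicator (cball 0 1 - {0}) x *\<^sub>R (cmod (zf (x /\<^sub>R norm x)) ^ k)\<^sup>2)"
    unfolding zf_norm_sq_def sphere_measure_def by (rule integral_cone_measure) auto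
  then have "zf_norm_sq k = real DIM('a) * (LINT x|lborel. g x)" by (simp add: g_def)
  then show "real DIM('a) * (1 / 2) * (?V / 16 ^ DIM('a)) / real k ^ DIM('a) \<le> zf_norm_sq k"
    using mult_left_mono[OF le, of "real DIM('a)"] by simp
qed

lemma zf_norm_sq_pos: "0 < zf_norm_sq k"
proof -
  obtain C where C: "C > 0" "\<forall>k\<ge>1. C / real k ^ DIM('a) \<le> zf_norm_sq k"
    using zf_norm_sq_lower_bound by blast
  \<comment> \<open>The lower bound starts at index 1, so index 0 is reached from its successor by
    monotonicity.\<close>
  have "0 < C / real (Suc k) ^ DIM('a)" using C(1) by simp
  also have "\<dots> \<le> zf_norm_sq (Suc k)" using C(2) by (metis le_add1 plus_1_eq_Suc)
  also have "\<dots> \<le> zf_norm_sq k" by (rule zf_norm_sq_decreasing) simp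
  finally show ?thesis .
qed

text \<open>Strict decrease makes every positive eigenvalue simple, with eigenfunction
  \<open>cnj (zf x) ^ l\<close>. For any other \<open>\<mu> > 0\<close> all coefficients of an
  eigenfunction vanish, hence so does the eigenfunction. The list of eigenvalues starts at 1 and the
  powers at 0, whence the shift \<open>n - 1\<close>.\<close>

lemma diag_kernel_eigenvalue_sequence:
  fixes b :: "nat \<Rightarrow> real"
  assumes b: "summable b" "\<And>k. 0 < b k" "\<And>k l. k < l \<Longrightarrow> b l < b k"
  shows "eigenvalue_sequence (kernel_op (diag_kernel (\<lambda>k. of_real (b k)))) (\<lambda>n. b (n - 1) * zf_norm_sq (n - 1))"
proof -
  let ?M = "sphere_measure :: 'a measure" and ?b = "\<lambda>k. of_real (b k) :: complex"
  define lam where "lam k = b k * zf_norm_sq k" for k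
  define T where "T = kernel_op (diag_kernel ?b)"
  have sb: "summable (\<lambda>k. cmod (?b k))" using b(1) b(2)[THEN less_imp_le] by simp
  have lam_pos: "0 < lam k" for k using b(2) zf_norm_sq_pos by (simp add: lam_def)
  have lam_less: "lam l < lam k" if "k < l" for k l
  proof -
    have "b l * zf_norm_sq l < b k * zf_norm_sq l"
      using b(3)[OF that] zf_norm_sq_pos by (intro mult_strict_right_mono)
    also have "\<dots> \<le> b k * zf_norm_sq k"
      using that b(2)[of k] by (intro mult_left_mono zf_norm_sq_decreasing) auto
    finally show ?thesis by (simp add: lam_def)
  qed
  then have lam_inj: "lam k = lam l \<longleftrightarrow> k = l" for k l
    by (metis less_irrefl linorder_neqE_nat)
  have eig: "f \<in> eigenspace T (of_real \<mu>) \<Longrightarrow> coef k f = 0 \<or> lam k = \<mu>" for f \<mu> k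
  proof -
    assume "f \<in> eigenspace T (of_real \<mu>)"
    then have "of_real \<mu> * coef k f = of_real (lam k) * coef k f"
      using eigenfunction_coef(1)[OF sb, of f "of_real \<mu>" k] by (simp add: eigenspace_def T_def lam_def)
    then show ?thesis by auto
  qed
  have series: "AE x in ?M. f x = zbar_series (\<lambda>k. ?b k * coef k f) x / of_real \<mu>"
    if "f \<in> eigenspace T (of_real \<mu>)" "0 < \<mu>" for f \<mu>
  proof -
    have "AE x in ?M. of_real \<mu> * f x = zbar_series (\<lambda>k. ?b k * coef k f) x"
      using that eigenfunction_coef(2)[OF sb, of f "of_real \<mu>"] by (simp add: eigenspace_def T_def)
    then show ?thesis
      by eventually_elim (use that in \<open>simp add: field_simps\<close>)
  qed
  have "finite {n. 1 \<le> n \<and> lam (n - 1) = \<mu>} \<and>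
      has_L2_dim (eigenspace T (of_real \<mu>)) (card {n. 1 \<le> n \<and> lam (n - 1) = \<mu>})" if "0 < \<mu>" for \<mu>
  proof (cases "\<exists>l. lam l = \<mu>")
    case False
    then have *: "{n. 1 \<le> n \<and> lam (n - 1) = \<mu>} = {}" by auto
    have "AE x in ?M. f x = 0" if f: "f \<in> eigenspace T (of_real \<mu>)" for f
    proof -
      have "coef k f = 0" for k using eig[OF f] False by blast
      then show ?thesis using series[OF f \<open>0 < \<mu>\<close>] by (simp add: zbar_series_def)
    qed
    then have "has_L2_dim (eigenspace T (of_real \<mu>)) 0"
      by (simp add: has_L2_dim_def)
    then show ?thesis unfolding * by simp
  next
    case True
    then obtain l where l: "lam l = \<mu>" by blast
    have "{n. 1 \<le> n \<and> lam (n - 1) = \<mu>} = {Suc l}"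
      by (auto simp: lam_inj l[symmetric])
    moreover have "has_L2_dim (eigenspace T (of_real \<mu>)) 1"
      unfolding has_L2_dim_def
    proof (intro exI[of _ "\<lambda>_ x. cnj (zf x) ^ l"] conjI allI impI ballI)
      show "(\<lambda>x. cnj (zf x) ^ l) \<in> eigenspace T (of_real \<mu>)"
        using kernel_op_cnj_zf_power[OF sb, of _ l] cnj_zf_power_in_L2
        by (auto simp: eigenspace_def T_def l[symmetric] lam_def)
    next
      fix c :: "nat \<Rightarrow> complex" and i :: nat
      assume *: "AE x in ?M. (\<Sum>i<1. c i * cnj (zf x) ^ l) = 0" and "i < 1"
      have zm [measurable]: "zf \<in> borel_measurable ?M" by (rule borel_measurable_sphere_measure) measurable
      have "c 0 = 0"
      proof (rule ccontr)
        assume "c 0 \<noteq> 0"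
        then have "AE x in ?M. (cmod (zf x) ^ l)\<^sup>2 = 0"
          using * by (auto elim!: AE_mp)
        then have "zf_norm_sq l = (LINT x|?M. 0)"
          unfolding zf_norm_sq_def by (intro integral_cong_AE) auto
        then show False using zf_norm_sq_pos[of l] by simp
      qed
      then show "c i = 0" using \<open>i < 1\<close> by simp
    next
      fix f assume f: "f \<in> eigenspace T (of_real \<mu>)"
      have 0: "coef k f = 0" if "k \<noteq> l" for k using eig[OF f, of k] that lam_inj l by metis
      have "zbar_series (\<lambda>k. ?b k * coef k f) x = (\<Sum>k\<in>{l}. ?b k * coef k f * cnj (zf x) ^ k)" for x
        unfolding zbar_series_def by (rule suminf_finite) (auto simp: 0)
      then have "AE x in ?M. f x = (\<Sum>i<1::nat. (?b l * coef l f / of_real \<mu>) * cnj (zf x) ^ l)"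
        using series[OF f \<open>0 < \<mu>\<close>] by simp
      then show "\<exists>c. AE x in ?M. f x = (\<Sum>i<1::nat. c i * cnj (zf x) ^ l)"
        by (intro exI[of _ "\<lambda>_. ?b l * coef l f / of_real \<mu>"])
    qed
    ultimately show ?thesis by simp
  qed
  moreover have "lam (j - 1) \<le> lam (i - 1)" if "1 \<le> i" "i \<le> j" for i j
    using lam_less[of "i - 1" "j - 1"] that by (cases "i = j") (auto intro: less_imp_le)
  ultimately show ?thesis
    unfolding eigenvalue_sequence_def T_def[symmetric] lam_def[symmetric]
    using lam_pos less_imp_le by blast
qed

end

section \<open>Growth estimates and conclusion\<close>

lemma rapidly_decreasing_exp_root:
  assumes "0 < m"
  shows "rapidly_decreasing (\<lambda>k. of_real (exp (- root m (real k))))"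
  unfolding rapidly_decreasing_def
proof
  fix r :: nat
  \<comment> \<open>Chosen so that the \<open>q\<close>-th power of \<open>root m k\<close> is
    \<open>real k ^ (r + 2)\<close>: a single term of the exponential series then beats
    \<open>real k ^ r\<close> with the summable factor \<open>1 / k ^ 2\<close> to spare.\<close>
  define q where "q = m * (r + 2)"
  have "summable (\<lambda>k. fact q * inverse (real k ^ 2))"
    using inverse_power_summable[of 2, where 'a = real] by (intro summable_mult) simp
  then show "summable (\<lambda>k. cmod (of_real (exp (- root m (real k)))) * real k ^ r)"
  proof (rule summable_comparison_test'[where N = 1])
    fix k :: nat assume k: "1 \<le> k"
    define y where "y = root m (real k)"
    have y: "0 \<le> y" "y ^ q = real k ^ (r + 2)"
      using real_root_pow_pos2[OF assms, of "real k"] real_root_ge_zero[of "real k" m]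
      unfolding y_def q_def power_mult by simp_all
    have "y ^ q / fact q \<le> exp y"
    proof -
      have "(\<Sum>n\<in>{q}. inverse (fact n) * y ^ n) \<le> (\<Sum>n. inverse (fact n) * y ^ n)"
        using y by (intro sum_le_suminf summable_exp) auto
      then show ?thesis by (simp add: exp_def divide_inverse mult.commute)
    qed
    then have "real k ^ r * real k ^ 2 \<le> fact q * exp y"
      unfolding y(2) by (simp add: divide_le_eq power2_eq_square mult_ac)
    then have "exp (- y) * real k ^ r \<le> fact q * inverse (real k ^ 2)"
      using k by (simp add: exp_minus field_simps)
    then show "norm (cmod (of_real (exp (- root m (real k)))) * real k ^ r) \<le> fact q * inverse (real k ^ 2)"
      by (simp add: y_def)
  qed
qed

lemma eventually_root_ge:
  assumes "0 < m"
  shows "\<forall>\<^sub>F n in sequentially. X \<le> root m (real n)"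
proof -
  have "\<forall>\<^sub>F n in sequentially. \<bar>X\<bar> ^ m \<le> real n"
    using filterlim_real_sequentially by (simp add: filterlim_at_top)
  then show ?thesis
  proof eventually_elim
    fix n assume "\<bar>X\<bar> ^ m \<le> real n"
    then have "root m (\<bar>X\<bar> ^ m) \<le> root m (real n)" using assms by simp
    then show "X \<le> root m (real n)" using assms by (simp add: real_root_power_cancel)
  qed
qed

lemma slow_decay_not_null:
  fixes \<delta> :: real and \<beta> ev :: "nat \<Rightarrow> real"
  assumes m: "0 < m" and \<delta>: "0 < \<delta>" and C: "0 < C" and c: "0 < c"
    and \<beta>: "\<forall>\<^sub>F n in sequentially. c * root m (real n) < \<beta> n"
    and ev: "\<And>n. 1 \<le> n \<Longrightarrow> exp (- root m (real n)) * (C / real n ^ d) \<le> ev n"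
  shows "\<not> (\<lambda>n. real n powr (root m (real n) / (\<delta> * real m) + \<beta> n) * ev n) \<longlonglongrightarrow> 0"
proof
  assume lim: "(\<lambda>n. real n powr (root m (real n) / (\<delta> * real m) + \<beta> n) * ev n) \<longlonglongrightarrow> 0"
  have "\<forall>\<^sub>F n in sequentially. \<delta> * real m \<le> ln (real n)"
    using filterlim_compose[OF ln_at_top filterlim_real_sequentially] by (simp add: filterlim_at_top)
  then have "\<forall>\<^sub>F n in sequentially. C \<le> real n powr (root m (real n) / (\<delta> * real m) + \<beta> n) * ev n"
    \<comment> \<open>From this threshold on, \<open>c * root m n\<close> is at least
      \<open>d\<close>, so that \<open>n powr \<beta> n\<close> absorbs the polynomial loss. The
      remaining factors cancel as well, and the constant \<open>C\<close> itself is left.\<close>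
    using \<beta> eventually_root_ge[OF m, of "real d / c"] eventually_ge_at_top[of 1]
  proof eventually_elim
    fix n :: nat
    assume ln: "\<delta> * real m \<le> ln (real n)" and b: "c * root m (real n) < \<beta> n"
      and r: "real d / c \<le> root m (real n)" and n: "1 \<le> n"
    define y where "y = root m (real n)"
    have y: "0 \<le> y" unfolding y_def by (rule real_root_ge_zero) simp
    have "real d \<le> c * y" using r c by (simp add: y_def field_simps)
    then have d: "real d \<le> \<beta> n" using b by (simp add: y_def)
    have "y = y / (\<delta> * real m) * (\<delta> * real m)" using m \<delta> by simp
    also have "\<dots> \<le> y / (\<delta> * real m) * ln (real n)"
      using y m \<delta> ln by (intro mult_left_mono) auto
    finally have "exp y \<le> real n powr (y / (\<delta> * real m))" using n by (simp add: powr_def)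
    moreover have "real n ^ d \<le> real n powr \<beta> n"
      using n d powr_mono[of "real d" "\<beta> n" "real n"] by (simp add: powr_realpow)
    ultimately have "exp y * real n ^ d \<le> real n powr (y / (\<delta> * real m)) * real n powr \<beta> n"
      by (intro mult_mono) auto
    then have "exp y * real n ^ d * (exp (- y) * (C / real n ^ d)) \<le> real n powr (y / (\<delta> * real m) + \<beta> n) * ev n"
      unfolding powr_add by (rule mult_mono[OF _ ev[OF n, folded y_def]]) (use C in auto)
    moreover have "exp y * real n ^ d * (exp (- y) * (C / real n ^ d)) = C"
      using n by (simp add: exp_minus)
    ultimately show "C \<le> real n powr (root m (real n) / (\<delta> * real m) + \<beta> n) * ev n"
      by (simp add: y_def)
  qed
  then have "C \<le> 0" by (rule tendsto_lowerbound[OF lim]) simp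
  then show False using C by simp
qed

theorem theorem5p1:
  fixes m :: nat and \<delta> :: real
  assumes "m \<ge> 2"
    and "CARD('n::finite) = m + 1"
    and "\<delta> = (if m = 2 then 2 else 1)"
  shows "\<exists>K :: real ^ 'n \<Rightarrow> real ^ 'n \<Rightarrow> complex.
    L2_positive_definite K \<and>
    kernel_in_W2_infinity K \<and>
    (\<forall>r. bounded_on_L2 (kernel_op (kernel_LB_derivative r K))) \<and>
    (\<exists>ev. eigenvalue_sequence (kernel_op K) ev \<and>
      (\<forall>\<beta> :: nat \<Rightarrow> real.
        (\<forall>n\<ge>1. 0 < \<beta> n) \<and>
        (\<exists>c>0. \<forall>\<^sub>F n in sequentially. c * root m (real n) < \<beta> n) \<longrightarrow>
        \<not> (\<lambda>n. real n powr (root m (real n) / (\<delta> * real m) + \<beta> n) * ev n) \<longlonglongrightarrow> 0))"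
proof -
  \<comment> \<open>At least two coordinates are available, so two distinct axis vectors form the
    orthonormal pair.\<close>
  have "\<not> card (UNIV :: 'n set) \<le> 1" using assms by simp
  then obtain i j :: 'n where "i \<noteq> j"
    by (metis card_le_Suc0_iff_eq finite_class.finite_UNIV One_nat_def)
  then interpret frame "axis i 1 :: real ^ 'n" "axis j 1"
    by unfold_locales (auto simp: inner_axis_axis)
  define b where "b k = exp (- root m (real k))" for k
  have m: "0 < m" using assms by simp
  have rapid: "rapidly_decreasing (\<lambda>k. of_real (b k))"
    unfolding b_def by (rule rapidly_decreasing_exp_root[OF m])
  have sum: "summable b"
    using rapidly_decreasing_summable[OF rapid] by (simp add: b_def[abs_def])
  have less: "b l < b k" if "k < l" for k l
    using that m by (simp add: b_def)
  obtain C where C: "C > 0" "\<And>k. 1 \<le> k \<Longrightarrow> C / real k ^ DIM(real ^ 'n) \<le> zf_norm_sq k"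
    using zf_norm_sq_lower_bound by blast
  define ev where "ev n = b (n - 1) * zf_norm_sq (n - 1)" for n
  have ev: "exp (- root m (real n)) * (C / real n ^ DIM(real ^ 'n)) \<le> ev n" if "1 \<le> n" for n
  proof -
    \<comment> \<open>Both factors of the eigenvalue are moved from index \<open>n - 1\<close> to
      \<open>n\<close> by monotonicity; the lower bound on the norms then applies already at
      \<open>n = 1\<close>.\<close>
    have "b n \<le> b (n - 1)" using m by (simp add: b_def)
    then have "b n * zf_norm_sq n \<le> ev n"
      unfolding ev_def using zf_norm_sq_pos[of n]
      by (intro mult_mono zf_norm_sq_decreasing) (auto simp: b_def)
    moreover have "b n * (C / real n ^ DIM(real ^ 'n)) \<le> b n * zf_norm_sq n"
      by (intro mult_left_mono C that) (simp add: b_def)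
    ultimately show ?thesis by (simp add: b_def)
  qed
  show ?thesis
  proof (intro exI[of _ "diag_kernel (\<lambda>k. of_real (b k))"] exI[of _ ev] conjI allI impI)
    show "L2_positive_definite (diag_kernel (\<lambda>k. of_real (b k)))"
      by (rule diag_kernel_positive_definite[OF sum]) (simp add: b_def)
    show "kernel_in_W2_infinity (diag_kernel (\<lambda>k. of_real (b k)))"
      by (rule diag_kernel_in_W2_infinity[OF rapid])
    show "bounded_on_L2 (kernel_op (kernel_LB_derivative r (diag_kernel (\<lambda>k. of_real (b k)))))" for r
      by (rule kernel_op_LB_derivative_bounded[OF rapid])
    show "eigenvalue_sequence (kernel_op (diag_kernel (\<lambda>k. of_real (b k)))) ev"
      unfolding ev_def[abs_def] by (rule diag_kernel_eigenvalue_sequence[OF sum _ less]) (simp add: b_def)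
  next
    fix \<beta> :: "nat \<Rightarrow> real"
    assume "(\<forall>n\<ge>1. 0 < \<beta> n) \<and> (\<exists>c>0. \<forall>\<^sub>F n in sequentially. c * root m (real n) < \<beta> n)"
    then obtain c where "c > 0" "\<forall>\<^sub>F n in sequentially. c * root m (real n) < \<beta> n" by blast
    moreover have "0 < \<delta>" using assms by simp
    ultimately show "\<not> (\<lambda>n. real n powr (root m (real n) / (\<delta> * real m) + \<beta> n) * ev n) \<longlonglongrightarrow> 0"
      using m C(1) ev by (intro slow_decay_not_null[where c = c and C = C]) auto
  qed
qed

end
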